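(* Let $\mathbb{F}$ be a field. Every codegree $1$, pointwise finite-dimensional functor $F \colon [0,\infty]^2 \to \mathsf{Vec}_{\mathbb{F}}$ decomposes into a direct sum of interval modules over death blocks, vertical blocks and horizontal blocks. Dually, every degree $1$, pointwise finite-dimensional functor $F \colon [0,\infty]^2 \to \mathsf{Vec}_{\mathbb{F}}$ decomposes into a direct sum of interval modules over birth blocks, vertical blocks and horizontal blocks.
   Context: $\mathsf{Vec}_{\mathbb{F}}$ is the category of $\mathbb{F}$-vector spaces. $[0,\infty]$ is the totally ordered set of nonnegative reals with a maximal element $\infty$ added, and $[0,\infty]^2$ carries the product partial order (a distributive lattice); posets are regarded as categories. A functor $F \colon P \to \mathsf{Vec}_{\mathbb{F}}$ is pointwise finite-dimensional (p.f.d.) if $F(x)$ is finite-dimensional for all $x \in P$. Codegree/degree 1: a functor $F$ from a distributive lattice $P$ to a category with finite colimits (resp. finite limits) is codegree $1$ (resp. degree $1$) if it sends every bicartesian square of $P$ (a square that is both a pushout and a pullback in $P$, i.e. one with corners $x\wedge y, x, y, x \vee y$ for some $x,y\in P$) to a pushout (resp. pullback) square. Intervals: an interval in a poset $P$ is a subset $I \subset P$ such that (a) $x,y\in I$ and $x \le z \le y$ imply $z \in I$, and (b) any $x,y \in I$ are connected by a zigzag $x=a_0\le b_0\ge a_1\le\dots\le b_n=y$ of relations in $I$. The interval module $\mathbb{F}_I \colon P \to \mathsf{Vec}_{\mathbb{F}}$ has $\mathbb{F}_I(x)=\mathbb{F}$ if $x\in I$ and $0$ otherwise, with $\mathbb{F}_I(x\le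 y)=\mathrm{id}_{\mathbb{F}}$ if $x,y\in I$ and $0$ otherwise. Blocks: a subset $J$ of a poset is down-closed (resp. up-closed) if $x\in J$ and $y\le x$ (resp. $y \ge x$) imply $y\in J$. An interval $I\subseteq[0,\infty]^2$ is a death block if $I=J_1\times J_2$ with $J_1,J_2\subseteq[0,\infty]$ down-closed; a birth block if $I=J_1\times J_2$ with $J_1,J_2\subseteq[0,\infty]$ up-closed; a vertical block if $I=J\times[0,\infty]$ for an interval $J\subseteq[0,\infty]$; a horizontal block if $I=[0,\infty]\times J$ for an interval $J\subseteq[0,\infty]$. *)

theory Defs
  imports
    "HOL-Analysis.Analysis"
    "HOL-Library.Product_Order"
    "HOL-Library.Poly_Mapping"
    "HOL-Library.Extended_Nonnegative_Real"
begin

section \<open>Linear maps between subspaces\<close>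

text \<open>
  An object of the category of vector spaces over the field \<open>'k\<close> is a subspace of a vector
  space \<open>'v\<close> with scalar multiplication \<open>s\<close>. Since a family of vector spaces
  embeds into its direct sum, every functor into vector spaces is isomorphic to one whose values
  are subspaces of one vector space. A morphism is a function on the ambient type, of which only
  the restriction to its domain matters.
\<close>

definition vec_hom ::
  "('k::field \<Rightarrow> 'v::ab_group_add \<Rightarrow> 'v) \<Rightarrow> 'v set
   \<Rightarrow> ('k \<Rightarrow> 'w::ab_group_add \<Rightarrow> 'w) \<Rightarrow> 'w set \<Rightarrow> ('v \<Rightarrow> 'w) \<Rightarrow> bool"
  where "vec_hom s U t W f \<longleftrightarrow>
    (\<forall>u\<in>U. f u \<in> W) \<and>
    (\<forall>u\<in>U. \<forall>u'\<in>U. f (u + u') = f u + f u') \<and>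
    (\<forall>c. \<forall>u\<in>U. f (s c u) = t c (f u))"

definition fin_dim_subspace :: "('k::field \<Rightarrow> 'v::ab_group_add \<Rightarrow> 'v) \<Rightarrow> 'v set \<Rightarrow> bool"
  where "fin_dim_subspace s U \<longleftrightarrow> (\<exists>B. finite B \<and> module.span s B = U)"

section \<open>Pushout and pullback squares\<close>

text \<open>
  The squares are labelled

    \<open>A --f--> B\<close>, \<open>A --g--> C\<close>, \<open>B --h--> D\<close>, \<open>C --k--> D\<close>.

  The corners are subspaces for \<open>s\<close>; the universal property is tested on the subspaces for
  \<open>t\<close>. The theorems \<open>pushout_square_universal\<close> and
  \<open>pullback_square_universal\<close> below show that testing on the subspaces for \<open>s\<close>
  already gives the universal property with respect to all vector spaces, in any type.
\<close>

definition commutative_square ::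
  "('k::field \<Rightarrow> 'v::ab_group_add \<Rightarrow> 'v) \<Rightarrow> 'v set \<Rightarrow> 'v set \<Rightarrow> 'v set \<Rightarrow> 'v set
   \<Rightarrow> ('v \<Rightarrow> 'v) \<Rightarrow> ('v \<Rightarrow> 'v) \<Rightarrow> ('v \<Rightarrow> 'v) \<Rightarrow> ('v \<Rightarrow> 'v) \<Rightarrow> bool"
  where "commutative_square s A B C D f g h k \<longleftrightarrow>
    vec_hom s A s B f \<and> vec_hom s A s C g \<and> vec_hom s B s D h \<and> vec_hom s C s D k \<and>
    (\<forall>a\<in>A. h (f a) = k (g a))"

definition pushout_square ::
  "('k::field \<Rightarrow> 'v::ab_group_add \<Rightarrow> 'v) \<Rightarrow> ('k \<Rightarrow> 'w::ab_group_add \<Rightarrow> 'w)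
   \<Rightarrow> 'v set \<Rightarrow> 'v set \<Rightarrow> 'v set \<Rightarrow> 'v set
   \<Rightarrow> ('v \<Rightarrow> 'v) \<Rightarrow> ('v \<Rightarrow> 'v) \<Rightarrow> ('v \<Rightarrow> 'v) \<Rightarrow> ('v \<Rightarrow> 'v) \<Rightarrow> bool"
  where "pushout_square s t A B C D f g h k \<longleftrightarrow>
    commutative_square s A B C D f g h k \<and>
    (\<forall>W \<beta> \<gamma>. module.subspace t W \<and> vec_hom s B t W \<beta> \<and> vec_hom s C t W \<gamma> \<and>
        (\<forall>a\<in>A. \<beta> (f a) = \<gamma> (g a)) \<longrightarrow>
      (\<exists>\<delta>. (vec_hom s D t W \<delta> \<and> (\<forall>b\<in>B. \<delta> (h b) = \<beta> b) \<and> (\<forall>c\<in>C. \<delta> (k c) = \<gamma> c)) \<and>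
        (\<forall>\<delta>'. vec_hom s D t W \<delta>' \<and> (\<forall>b\<in>B. \<delta>' (h b) = \<beta> b) \<and> (\<forall>c\<in>C. \<delta>' (k c) = \<gamma> c)
          \<longrightarrow> (\<forall>d\<in>D. \<delta>' d = \<delta> d))))"

definition pullback_square ::
  "('k::field \<Rightarrow> 'v::ab_group_add \<Rightarrow> 'v) \<Rightarrow> ('k \<Rightarrow> 'w::ab_group_add \<Rightarrow> 'w)
   \<Rightarrow> 'v set \<Rightarrow> 'v set \<Rightarrow> 'v set \<Rightarrow> 'v set
   \<Rightarrow> ('v \<Rightarrow> 'v) \<Rightarrow> ('v \<Rightarrow> 'v) \<Rightarrow> ('v \<Rightarrow> 'v) \<Rightarrow> ('v \<Rightarrow> 'v) \<Rightarrow> bool"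
  where "pullback_square s t A B C D f g h k \<longleftrightarrow>
    commutative_square s A B C D f g h k \<and>
    (\<forall>W \<beta> \<gamma>. module.subspace t W \<and> vec_hom t W s B \<beta> \<and> vec_hom t W s C \<gamma> \<and>
        (\<forall>w\<in>W. h (\<beta> w) = k (\<gamma> w)) \<longrightarrow>
      (\<exists>\<delta>. (vec_hom t W s A \<delta> \<and> (\<forall>w\<in>W. f (\<delta> w) = \<beta> w) \<and> (\<forall>w\<in>W. g (\<delta> w) = \<gamma> w)) \<and>
        (\<forall>\<delta>'. vec_hom t W s A \<delta>' \<and> (\<forall>w\<in>W. f (\<delta>' w) = \<beta> w) \<and> (\<forall>w\<in>W. g (\<delta>' w) = \<gamma> w)
          \<longrightarrow> (\<forall>w\<in>W. \<delta>' w = \<delta> w))))"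

lemma vec_hom_0:
  assumes "vec_hom s U t W f" "0 \<in> U"
  shows "f 0 = 0"
proof -
  have "f (0 + 0) = f 0 + f 0" using assms unfolding vec_hom_def by blast
  then show ?thesis by simp
qed

lemma vec_hom_diff:
  assumes "vec_hom s U t W f" "vector_space s" "module.subspace s U" "u \<in> U" "u' \<in> U"
  shows "f (u - u') = f u - f u'"
proof -
  interpret vector_space s by fact
  have "u - u' \<in> U" using assms(3-5) by (rule subspace_diff)
  then have "f ((u - u') + u') = f (u - u') + f u'"
    using assms(1,5) unfolding vec_hom_def by blast
  then show ?thesis by (simp add: eq_diff_eq)
qed

lemma ex_linear_functional:
  assumes "vector_space s" "module.subspace s E" "d \<notin> E"
  shows "\<exists>\<psi>. Vector_Spaces.linear s (*) \<psi> \<and> (\<forall>e\<in>E. \<psi> e = 0) \<and> \<psi> d = (1::'k::field)"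
proof -
  interpret vs: vector_space s by fact
  interpret k: vector_space "(*) :: 'k \<Rightarrow> 'k \<Rightarrow> 'k"
    by unfold_locales (auto simp: algebra_simps)
  interpret p: vector_space_pair s "(*) :: 'k \<Rightarrow> 'k \<Rightarrow> 'k" by unfold_locales
  obtain B where B: "B \<subseteq> E" "\<not> vs.dependent B" "E \<subseteq> vs.span B"
    using vs.maximal_independent_subset by metis
  have sB: "vs.span B = E" using B assms(2) by (simp add: vs.span_minimal subset_antisym)
  have "\<not> vs.dependent (insert d B)"
    using B(2) assms(3) sB by (simp add: vs.independent_insertI)
  then obtain \<psi> where \<psi>: "Vector_Spaces.linear s (*) \<psi>" "\<forall>x\<in>insert d B. \<psi> x = (if x = d then 1 else (0::'k))"
    using p.linear_independent_extend[of "insert d B" "\<lambda>x. if x = d then 1 else 0"] by auto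
  have "\<psi> x = 0" if "x \<in> B" for x
    using \<psi>(2) that assms(3) B(1) by auto
  then have "\<forall>e\<in>E. \<psi> e = 0"
    using p.linear_eq_0_on_span[OF \<psi>(1)] sB by blast
  then show ?thesis using \<psi> by auto
qed

theorem pushout_square_universal:
  fixes s :: "'k::field \<Rightarrow> 'v::ab_group_add \<Rightarrow> 'v" and t :: "'k \<Rightarrow> 'w::ab_group_add \<Rightarrow> 'w"
  assumes vs: "vector_space s" and vt: "vector_space t"
    and sub: "module.subspace s A" "module.subspace s B" "module.subspace s C" "module.subspace s D"
    and po: "pushout_square s s A B C D f g h k"
  shows "pushout_square s t A B C D f g h k"
proof -
  interpret vs: vector_space s by fact
  interpret vt: vector_space t by fact
  have sq: "commutative_square s A B C D f g h k"
    using po by (simp add: pushout_square_def)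
  then have f: "vec_hom s A s B f" and g: "vec_hom s A s C g" and h: "vec_hom s B s D h"
    and k: "vec_hom s C s D k" and comm: "\<And>a. a \<in> A \<Longrightarrow> h (f a) = k (g a)"
    by (auto simp: commutative_square_def)
  note z = vs.subspace_0[OF sub(1)] vs.subspace_0[OF sub(2)] vs.subspace_0[OF sub(3)]
    vs.subspace_0[OF sub(4)]
  define E where "E = {h b + k c | b c. b \<in> B \<and> c \<in> C}"
  have EI: "h b + k c \<in> E" if "b \<in> B" "c \<in> C" for b c
    using that unfolding E_def by blast
  have subE: "vs.subspace E"
  proof (rule vs.subspaceI)
    show "0 \<in> E" using EI[OF z(2,3)] vec_hom_0[OF h z(2)] vec_hom_0[OF k z(3)] by simp
  next
    fix x y assume "x \<in> E" "y \<in> E"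
    then obtain b c b' c' where *: "x = h b + k c" "y = h b' + k c'" "b \<in> B" "c \<in> C" "b' \<in> B" "c' \<in> C"
      unfolding E_def by blast
    have "x + y = h (b + b') + k (c + c')"
      using * h k unfolding vec_hom_def by (simp add: algebra_simps)
    then show "x + y \<in> E"
      using EI[OF vs.subspace_add[OF sub(2) *(3,5)] vs.subspace_add[OF sub(3) *(4,6)]] by simp
  next
    fix r x assume "x \<in> E"
    then obtain b c where *: "x = h b + k c" "b \<in> B" "c \<in> C" unfolding E_def by blast
    have "s r x = h (s r b) + k (s r c)"
      using * h k unfolding vec_hom_def by (simp add: vs.scale_right_distrib)
    then show "s r x \<in> E"
      using EI[OF vs.subspace_scale[OF sub(2) *(2)] vs.subspace_scale[OF sub(3) *(3)]] by simp
  qed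
  have DE: "d \<in> E" if "d \<in> D" for d
  proof (rule ccontr)
    assume "d \<notin> E"
    then obtain \<psi> where \<psi>: "Vector_Spaces.linear s (*) \<psi>" "\<forall>e\<in>E. \<psi> e = 0" "\<psi> d = (1::'k)"
      using ex_linear_functional[OF vs subE] by blast
    interpret \<psi>: Vector_Spaces.linear s "(*)" \<psi> by fact
    have z1: "vec_hom s B s D (\<lambda>_. 0)" "vec_hom s C s D (\<lambda>_. 0)" "vec_hom s D s D (\<lambda>_. 0)"
      using z by (auto simp: vec_hom_def)
    have h1: "vec_hom s D s D (\<lambda>x. s (\<psi> x) d)"
      using that vs.subspace_scale[OF sub(4)]
      by (auto simp: vec_hom_def \<psi>.add \<psi>.scale vs.scale_left_distrib)
    have "\<psi> (h b) = 0" if "b \<in> B" for b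
      using \<psi>(2) EI[OF that z(3)] vec_hom_0[OF k z(3)] by simp
    moreover have "\<psi> (k c) = 0" if "c \<in> C" for c
      using \<psi>(2) EI[OF z(2) that] vec_hom_0[OF h z(2)] by simp
    moreover obtain \<delta> where "\<And>\<delta>'. vec_hom s D s D \<delta>' \<and> (\<forall>b\<in>B. \<delta>' (h b) = 0) \<and>
        (\<forall>c\<in>C. \<delta>' (k c) = 0) \<Longrightarrow> (\<forall>d\<in>D. \<delta>' d = \<delta> d)"
      using po[unfolded pushout_square_def, THEN conjunct2, rule_format,
          of D "\<lambda>_. 0" "\<lambda>_. 0"] z1 sub(4) by auto
    from this[of "\<lambda>_. 0"] this[of "\<lambda>x. s (\<psi> x) d"] have "s (\<psi> d) d = 0"
      using z1 h1 calculation that by auto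
    then have "d = 0" using \<psi>(3) by simp
    then show False using \<open>d \<notin> E\<close> vs.subspace_0[OF subE] by simp
  qed
  define s2 where "s2 = (\<lambda>r (p::'v \<times> 'v). (s r (fst p), s r (snd p)))"
  have vs2: "vector_space s2"
    by unfold_locales (auto simp: s2_def vs.scale_left_distrib vs.scale_right_distrib)
  interpret vs2: vector_space s2 by fact
  define R where "R = {(f a, - g a) | a. a \<in> A}"
  have RI: "(f a, - g a) \<in> R" if "a \<in> A" for a using that unfolding R_def by blast
  have subR: "vs2.subspace R"
  proof (rule vs2.subspaceI)
    show "0 \<in> R" using RI[OF z(1)] vec_hom_0[OF f z(1)] vec_hom_0[OF g z(1)] by (simp add: zero_prod_def)
  next
    fix x y assume "x \<in> R" "y \<in> R"
    then obtain a a' where *: "x = (f a, - g a)" "y = (f a', - g a')" "a \<in> A" "a' \<in> A"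
      unfolding R_def by blast
    have "x + y = (f (a + a'), - g (a + a'))" using * f g unfolding vec_hom_def by simp
    then show "x + y \<in> R" using RI[OF vs.subspace_add[OF sub(1) *(3,4)]] by simp
  next
    fix r x assume "x \<in> R"
    then obtain a where *: "x = (f a, - g a)" "a \<in> A" unfolding R_def by blast
    have "s2 r x = (f (s r a), - g (s r a))" using * f g unfolding vec_hom_def s2_def by simp
    then show "s2 r x \<in> R" using RI[OF vs.subspace_scale[OF sub(1) *(2)]] by simp
  qed
  have exact: "\<exists>a\<in>A. b = f a \<and> c = - g a" if "b \<in> B" "c \<in> C" "h b + k c = 0" for b c
  proof (rule ccontr)
    assume "\<not> ?thesis"
    then have "(b, c) \<notin> R" unfolding R_def by blast
    then obtain \<psi> where \<psi>: "Vector_Spaces.linear s2 (*) \<psi>" "\<forall>e\<in>R. \<psi> e = 0" "\<psi> (b, c) = (1::'k)"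
      using ex_linear_functional[OF vs2 subR] by blast
    interpret \<psi>: Vector_Spaces.linear s2 "(*)" \<psi> by fact
    have "(b, c) \<noteq> 0" using \<psi>(3) \<psi>.zero by force
    then obtain e :: 'v where e: "e \<noteq> 0" by (auto simp: zero_prod_def)
    have split: "\<psi> (x, y) = \<psi> (x, 0) + \<psi> (0, y)" for x y
      using \<psi>.add[of "(x, 0)" "(0, y)"] by simp
    have ad: "\<psi> (x + y, 0) = \<psi> (x, 0) + \<psi> (y, 0)" "\<psi> (0, x + y) = \<psi> (0, x) + \<psi> (0, y)" for x y
      using \<psi>.add[of "(x, 0)" "(y, 0)"] \<psi>.add[of "(0, x)" "(0, y)"] by simp_all
    have sc: "\<psi> (s r x, 0) = r * \<psi> (x, 0)" "\<psi> (0, s r x) = r * \<psi> (0, x)" for r x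
      using \<psi>.scale[of r "(x, 0)"] \<psi>.scale[of r "(0, x)"] by (simp_all add: s2_def)
    have ng: "\<psi> (0, - x) = - \<psi> (0, x)" for x
      using \<psi>.neg[of "(0, x)"] by simp
    have "\<psi> (f a, 0) = \<psi> (0, g a)" if "a \<in> A" for a
      using \<psi>(2) RI[OF that] split[of "f a" "- g a"] ng by force
    moreover have "vec_hom s B s UNIV (\<lambda>x. s (\<psi> (x, 0)) e)" "vec_hom s C s UNIV (\<lambda>x. s (\<psi> (0, x)) e)"
      by (auto simp: vec_hom_def ad sc vs.scale_left_distrib)
    ultimately obtain \<delta> where \<delta>: "vec_hom s D s UNIV \<delta>" "\<forall>b\<in>B. \<delta> (h b) = s (\<psi> (b, 0)) e"
        "\<forall>c\<in>C. \<delta> (k c) = s (\<psi> (0, c)) e"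
      using po[unfolded pushout_square_def, THEN conjunct2, rule_format,
          of UNIV "\<lambda>x. s (\<psi> (x, 0)) e" "\<lambda>x. s (\<psi> (0, x)) e"] by auto
    have "h b \<in> D" "k c \<in> D" using h k that unfolding vec_hom_def by auto
    then have "\<delta> (h b + k c) = \<delta> (h b) + \<delta> (k c)" using \<delta>(1) unfolding vec_hom_def by blast
    also have "\<dots> = s (\<psi> (b, c)) e"
      using \<delta>(2,3) that by (simp add: split[of b c] vs.scale_left_distrib)
    finally show False using that vec_hom_0[OF \<delta>(1) z(4)] \<psi>(3) e by simp
  qed
  show ?thesis
    unfolding pushout_square_def
  proof (intro conjI allI impI sq)
    fix W \<beta> \<gamma>
    assume "vt.subspace W \<and> vec_hom s B t W \<beta> \<and> vec_hom s C t W \<gamma> \<and> (\<forall>a\<in>A. \<beta> (f a) = \<gamma> (g a))"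
    then have W: "vt.subspace W" and \<beta>: "vec_hom s B t W \<beta>" and \<gamma>: "vec_hom s C t W \<gamma>"
      and cc: "\<And>a. a \<in> A \<Longrightarrow> \<beta> (f a) = \<gamma> (g a)" by auto
    have wd: "\<beta> b + \<gamma> c = \<beta> b' + \<gamma> c'"
      if "b \<in> B" "c \<in> C" "b' \<in> B" "c' \<in> C" "h b + k c = h b' + k c'" for b c b' c'
    proof -
      note b = that(1,3) and c = that(2,4)
      have "h (b - b') + k (c - c') = 0"
        using vec_hom_diff[OF h vs sub(2) that(1,3)] vec_hom_diff[OF k vs sub(3) that(2,4)] that(5)
        by (metis add_diff_add diff_self)
      then obtain a where a: "a \<in> A" "b - b' = f a" "c - c' = - g a"
        using exact[OF vs.subspace_diff[OF sub(2) b] vs.subspace_diff[OF sub(3) c]] by blast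
      have "c' - c = g a" using a(3) by (metis minus_diff_eq minus_minus)
      then have "\<beta> b - \<beta> b' = \<gamma> c' - \<gamma> c"
        using vec_hom_diff[OF \<beta> vs sub(2) that(1,3)] vec_hom_diff[OF \<gamma> vs sub(3) that(4,2)]
          a cc by simp
      then show ?thesis by (simp add: algebra_simps)
    qed
    define \<delta> where "\<delta> = (\<lambda>d. THE w. \<exists>b\<in>B. \<exists>c\<in>C. d = h b + k c \<and> w = \<beta> b + \<gamma> c)"
    have \<delta>: "\<delta> (h b + k c) = \<beta> b + \<gamma> c" if "b \<in> B" "c \<in> C" for b c
      unfolding \<delta>_def
    proof (rule the_equality)
      show "\<exists>b'\<in>B. \<exists>c'\<in>C. h b + k c = h b' + k c' \<and> \<beta> b + \<gamma> c = \<beta> b' + \<gamma> c'"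
        using that by blast
      fix w assume "\<exists>b'\<in>B. \<exists>c'\<in>C. h b + k c = h b' + k c' \<and> w = \<beta> b' + \<gamma> c'"
      then show "w = \<beta> b + \<gamma> c" using wd that by metis
    qed
    have \<delta>h: "vec_hom s D t W \<delta>"
      unfolding vec_hom_def
    proof (intro conjI ballI allI)
      fix u assume "u \<in> D"
      then obtain b c where *: "u = h b + k c" "b \<in> B" "c \<in> C" using DE E_def by blast
      then show "\<delta> u \<in> W" using \<delta> \<beta> \<gamma> W unfolding vec_hom_def by (simp add: vt.subspace_add)
      fix r
      have "s r u = h (s r b) + k (s r c)"
        using * h k unfolding vec_hom_def by (simp add: vs.scale_right_distrib)
      then have "\<delta> (s r u) = \<beta> (s r b) + \<gamma> (s r c)"
        using \<delta>[OF vs.subspace_scale[OF sub(2) *(2)] vs.subspace_scale[OF sub(3) *(3)]] by simp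
      then show "\<delta> (s r u) = t r (\<delta> u)"
        using * \<delta> \<beta> \<gamma> unfolding vec_hom_def by (simp add: vt.scale_right_distrib)
    next
      fix u u' assume "u \<in> D" "u' \<in> D"
      then obtain b c b' c' where *: "u = h b + k c" "b \<in> B" "c \<in> C" "u' = h b' + k c'" "b' \<in> B" "c' \<in> C"
        using DE E_def by blast
      have "u + u' = h (b + b') + k (c + c')"
        using * h k unfolding vec_hom_def by (simp add: algebra_simps)
      then have "\<delta> (u + u') = \<beta> (b + b') + \<gamma> (c + c')"
        using \<delta>[OF vs.subspace_add[OF sub(2) *(2,5)] vs.subspace_add[OF sub(3) *(3,6)]] by simp
      then show "\<delta> (u + u') = \<delta> u + \<delta> u'"
        using * \<delta> \<beta> \<gamma> unfolding vec_hom_def by (simp add: algebra_simps)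
    qed
    have "\<delta> (h b) = \<beta> b" if "b \<in> B" for b
      using \<delta>[OF that z(3)] vec_hom_0[OF k z(3)] vec_hom_0[OF \<gamma> z(3)] by simp
    moreover have "\<delta> (k c) = \<gamma> c" if "c \<in> C" for c
      using \<delta>[OF z(2) that] vec_hom_0[OF h z(2)] vec_hom_0[OF \<beta> z(2)] by simp
    moreover have "\<delta>' d = \<delta> d"
      if "vec_hom s D t W \<delta>'" "\<forall>b\<in>B. \<delta>' (h b) = \<beta> b" "\<forall>c\<in>C. \<delta>' (k c) = \<gamma> c" "d \<in> D" for \<delta>' d
    proof -
      have "d \<in> E" using DE that by blast
      then obtain b c where *: "d = h b + k c" "b \<in> B" "c \<in> C" unfolding E_def by blast
      have "h b \<in> D" "k c \<in> D" using h k * unfolding vec_hom_def by auto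
      then have "\<delta>' d = \<delta>' (h b) + \<delta>' (k c)" using that(1) * unfolding vec_hom_def by blast
      then show ?thesis using that * \<delta> by simp
    qed
    ultimately show "\<exists>\<delta>. (vec_hom s D t W \<delta> \<and> (\<forall>b\<in>B. \<delta> (h b) = \<beta> b) \<and> (\<forall>c\<in>C. \<delta> (k c) = \<gamma> c)) \<and>
        (\<forall>\<delta>'. vec_hom s D t W \<delta>' \<and> (\<forall>b\<in>B. \<delta>' (h b) = \<beta> b) \<and> (\<forall>c\<in>C. \<delta>' (k c) = \<gamma> c)
          \<longrightarrow> (\<forall>d\<in>D. \<delta>' d = \<delta> d))"
      using \<delta>h by blast
  qed
qed

theorem pullback_square_universal:
  fixes s :: "'k::field \<Rightarrow> 'v::ab_group_add \<Rightarrow> 'v" and t :: "'k \<Rightarrow> 'w::ab_group_add \<Rightarrow> 'w"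
  assumes vs: "vector_space s" and vt: "vector_space t"
    and sub: "module.subspace s A" "module.subspace s B" "module.subspace s C" "module.subspace s D"
    and pb: "pullback_square s s A B C D f g h k"
  shows "pullback_square s t A B C D f g h k"
proof -
  interpret vs: vector_space s by fact
  interpret vt: vector_space t by fact
  have sq: "commutative_square s A B C D f g h k"
    using pb by (simp add: pullback_square_def)
  then have f: "vec_hom s A s B f" and g: "vec_hom s A s C g" and h: "vec_hom s B s D h"
    and k: "vec_hom s C s D k" and comm: "\<And>a. a \<in> A \<Longrightarrow> h (f a) = k (g a)"
    by (auto simp: commutative_square_def)
  note z = vs.subspace_0[OF sub(1)] vs.subspace_0[OF sub(2)] vs.subspace_0[OF sub(3)]
    vs.subspace_0[OF sub(4)]
  have ker: "a = 0" if "a \<in> A" "f a = 0" "g a = 0" for a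
  proof -
    define K where "K = {a \<in> A. f a = 0 \<and> g a = 0}"
    have subK: "vs.subspace K"
      using f g vec_hom_0[OF f z(1)] vec_hom_0[OF g z(1)] z(1)
        vs.subspace_add[OF sub(1)] vs.subspace_scale[OF sub(1)]
      by (intro vs.subspaceI) (auto simp: K_def vec_hom_def)
    have hm: "vec_hom s K s B (\<lambda>_. 0)" "vec_hom s K s C (\<lambda>_. 0)" "vec_hom s K s A (\<lambda>_. 0)"
        "vec_hom s K s A (\<lambda>x. x)"
      using z by (auto simp: vec_hom_def K_def)
    have z': "f 0 = 0" "g 0 = 0" "h 0 = 0" "k 0 = 0"
      using vec_hom_0[OF f z(1)] vec_hom_0[OF g z(1)] vec_hom_0[OF h z(2)] vec_hom_0[OF k z(3)] .
    obtain \<delta> where \<delta>: "\<And>\<delta>'. vec_hom s K s A \<delta>' \<and> (\<forall>w\<in>K. f (\<delta>' w) = 0) \<and>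
        (\<forall>w\<in>K. g (\<delta>' w) = 0) \<Longrightarrow> (\<forall>w\<in>K. \<delta>' w = \<delta> w)"
      using pb[unfolded pullback_square_def, THEN conjunct2, rule_format,
          of K "\<lambda>_. 0" "\<lambda>_. 0"] hm subK z' by auto
    have "a \<in> K" using that by (simp add: K_def)
    moreover have "\<forall>w\<in>K. 0 = \<delta> w" using \<delta>[of "\<lambda>_. 0"] hm z' by auto
    moreover have "\<forall>w\<in>K. w = \<delta> w" using \<delta>[of "\<lambda>w. w"] hm by (auto simp: K_def)
    ultimately show "a = 0" by metis
  qed
  have inj: "a = a'" if "a \<in> A" "a' \<in> A" "f a = f a'" "g a = g a'" for a a'
    using ker[OF vs.subspace_diff[OF sub(1) that(1,2)]] vec_hom_diff[OF f vs sub(1) that(1,2)]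
      vec_hom_diff[OF g vs sub(1) that(1,2)] that by simp
  have ex: "\<exists>a\<in>A. f a = b \<and> g a = c" if "b \<in> B" "c \<in> C" "h b = k c" for b c
  proof (cases "b = 0 \<and> c = 0")
    case True
    then show ?thesis using z(1) vec_hom_0[OF f z(1)] vec_hom_0[OF g z(1)] by blast
  next
    case False
    then obtain e :: 'v where e: "e \<noteq> 0" by blast
    then obtain \<psi> where \<psi>: "Vector_Spaces.linear s (*) \<psi>" "\<psi> e = (1::'k)"
      using ex_linear_functional[OF vs vs.subspace_single_0, of e] by auto
    interpret \<psi>: Vector_Spaces.linear s "(*)" \<psi> by fact
    have "vec_hom s UNIV s B (\<lambda>x. s (\<psi> x) b)" "vec_hom s UNIV s C (\<lambda>x. s (\<psi> x) c)"
      using that vs.subspace_scale[OF sub(2)] vs.subspace_scale[OF sub(3)]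
      by (auto simp: vec_hom_def \<psi>.add \<psi>.scale vs.scale_left_distrib)
    moreover have "h (s r b) = k (s r c)" for r
      using h k that unfolding vec_hom_def by simp
    ultimately obtain \<delta> where \<delta>: "vec_hom s UNIV s A \<delta>" "\<forall>w. f (\<delta> w) = s (\<psi> w) b"
        "\<forall>w. g (\<delta> w) = s (\<psi> w) c"
      using pb[unfolded pullback_square_def, THEN conjunct2, rule_format,
          of UNIV "\<lambda>x. s (\<psi> x) b" "\<lambda>x. s (\<psi> x) c"] by auto
    have "\<delta> e \<in> A" "f (\<delta> e) = b" "g (\<delta> e) = c"
      using \<delta> \<psi>(2) unfolding vec_hom_def by auto
    then show ?thesis by blast
  qed
  show ?thesis
    unfolding pullback_square_def
  proof (intro conjI allI impI sq)
    fix W \<beta> \<gamma>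
    assume "vt.subspace W \<and> vec_hom t W s B \<beta> \<and> vec_hom t W s C \<gamma> \<and> (\<forall>w\<in>W. h (\<beta> w) = k (\<gamma> w))"
    then have W: "vt.subspace W" and \<beta>: "vec_hom t W s B \<beta>" and \<gamma>: "vec_hom t W s C \<gamma>"
      and cc: "\<And>w. w \<in> W \<Longrightarrow> h (\<beta> w) = k (\<gamma> w)" by auto
    have BC: "\<beta> w \<in> B" "\<gamma> w \<in> C" if "w \<in> W" for w
      using that \<beta> \<gamma> unfolding vec_hom_def by auto
    have "\<forall>w\<in>W. \<exists>a. a \<in> A \<and> f a = \<beta> w \<and> g a = \<gamma> w"
      using ex BC cc by blast
    then obtain \<delta> where \<delta>: "\<And>w. w \<in> W \<Longrightarrow> \<delta> w \<in> A" "\<And>w. w \<in> W \<Longrightarrow> f (\<delta> w) = \<beta> w"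
        "\<And>w. w \<in> W \<Longrightarrow> g (\<delta> w) = \<gamma> w"
      by metis
    have "vec_hom t W s A \<delta>"
      unfolding vec_hom_def
    proof (intro conjI ballI allI)
      fix u assume u: "u \<in> W"
      then show "\<delta> u \<in> A" by (rule \<delta>)
      fix r
      show "\<delta> (t r u) = s r (\<delta> u)"
      proof (rule inj)
        have "t r u \<in> W" using W u by (rule vt.subspace_scale)
        then show "\<delta> (t r u) \<in> A" "f (\<delta> (t r u)) = f (s r (\<delta> u))" "g (\<delta> (t r u)) = g (s r (\<delta> u))"
          using u \<delta> f g \<beta> \<gamma> unfolding vec_hom_def by simp_all
        show "s r (\<delta> u) \<in> A" using sub(1) \<delta>(1)[OF u] by (rule vs.subspace_scale)
      qed
    next
      fix u u' assume u: "u \<in> W" "u' \<in> W"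
      show "\<delta> (u + u') = \<delta> u + \<delta> u'"
      proof (rule inj)
        have "u + u' \<in> W" using W u by (rule vt.subspace_add)
        then show "\<delta> (u + u') \<in> A" "f (\<delta> (u + u')) = f (\<delta> u + \<delta> u')"
            "g (\<delta> (u + u')) = g (\<delta> u + \<delta> u')"
          using u \<delta> f g \<beta> \<gamma> unfolding vec_hom_def by simp_all
        show "\<delta> u + \<delta> u' \<in> A" using sub(1) \<delta>(1)[OF u(1)] \<delta>(1)[OF u(2)] by (rule vs.subspace_add)
      qed
    qed
    moreover have "\<delta>' w = \<delta> w" if "vec_hom t W s A \<delta>'" "\<forall>w\<in>W. f (\<delta>' w) = \<beta> w"
        "\<forall>w\<in>W. g (\<delta>' w) = \<gamma> w" "w \<in> W" for \<delta>' w
      using that \<delta> unfolding vec_hom_def by (intro inj[of "\<delta>' w" "\<delta> w"]) auto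
    ultimately show "\<exists>\<delta>. (vec_hom t W s A \<delta> \<and> (\<forall>w\<in>W. f (\<delta> w) = \<beta> w) \<and> (\<forall>w\<in>W. g (\<delta> w) = \<gamma> w)) \<and>
        (\<forall>\<delta>'. vec_hom t W s A \<delta>' \<and> (\<forall>w\<in>W. f (\<delta>' w) = \<beta> w) \<and> (\<forall>w\<in>W. g (\<delta>' w) = \<gamma> w)
          \<longrightarrow> (\<forall>w\<in>W. \<delta>' w = \<delta> w))"
      using \<delta> by blast
  qed
qed

section \<open>Functors from a poset to vector spaces\<close>

text \<open>\<open>arr F x y\<close> is the value of \<open>F\<close> on the relation \<open>x \<le> y\<close>; it is irrelevant
  if \<open>x \<le> y\<close> fails.\<close>

record ('k, 'p, 'v) vec_diagram =
  smult :: "'k \<Rightarrow> 'v \<Rightarrow> 'v"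
  obj :: "'p \<Rightarrow> 'v set"
  arr :: "'p \<Rightarrow> 'p \<Rightarrow> 'v \<Rightarrow> 'v"

definition vec_functor :: "('k::field, 'p::order, 'v::ab_group_add) vec_diagram \<Rightarrow> bool"
  where "vec_functor F \<longleftrightarrow>
    vector_space (smult F) \<and>
    (\<forall>x. module.subspace (smult F) (obj F x)) \<and>
    (\<forall>x y. x \<le> y \<longrightarrow> vec_hom (smult F) (obj F x) (smult F) (obj F y) (arr F x y)) \<and>
    (\<forall>x. \<forall>v\<in>obj F x. arr F x x v = v) \<and>
    (\<forall>x y z. x \<le> y \<longrightarrow> y \<le> z \<longrightarrow> (\<forall>v\<in>obj F x. arr F y z (arr F x y v) = arr F x z v))"

definition pointwise_fin_dim :: "('k::field, 'p::order, 'v::ab_group_add) vec_diagram \<Rightarrow> bool"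
  where "pointwise_fin_dim F \<longleftrightarrow> (\<forall>x. fin_dim_subspace (smult F) (obj F x))"

definition codegree_1 :: "('k::field, 'p::distrib_lattice, 'v::ab_group_add) vec_diagram \<Rightarrow> bool"
  where "codegree_1 F \<longleftrightarrow> (\<forall>x y. pushout_square (smult F) (smult F)
    (obj F (inf x y)) (obj F x) (obj F y) (obj F (sup x y))
    (arr F (inf x y) x) (arr F (inf x y) y) (arr F x (sup x y)) (arr F y (sup x y)))"

definition degree_1 :: "('k::field, 'p::distrib_lattice, 'v::ab_group_add) vec_diagram \<Rightarrow> bool"
  where "degree_1 F \<longleftrightarrow> (\<forall>x y. pullback_square (smult F) (smult F)
    (obj F (inf x y)) (obj F x) (obj F y) (obj F (sup x y))
    (arr F (inf x y) x) (arr F (inf x y) y) (arr F x (sup x y)) (arr F y (sup x y)))"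

definition isomorphic_functors ::
  "('k::field, 'p::order, 'v::ab_group_add) vec_diagram
   \<Rightarrow> ('k, 'p, 'w::ab_group_add) vec_diagram \<Rightarrow> bool"
  where "isomorphic_functors F G \<longleftrightarrow> (\<exists>\<phi>.
    (\<forall>x. vec_hom (smult F) (obj F x) (smult G) (obj G x) (\<phi> x) \<and>
         bij_betw (\<phi> x) (obj F x) (obj G x)) \<and>
    (\<forall>x y. x \<le> y \<longrightarrow> (\<forall>v\<in>obj F x. \<phi> y (arr F x y v) = arr G x y (\<phi> x v))))"

text \<open>The direct sum of the functors \<open>G i\<close> over \<open>i \<in> \<Lambda>\<close>: finitely supported families,
  with all operations componentwise.\<close>

definition direct_sum ::
  "'i set \<Rightarrow> ('i \<Rightarrow> ('k::field, 'p::order, 'w::ab_group_add) vec_diagram)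
   \<Rightarrow> ('k, 'p, 'i \<Rightarrow>\<^sub>0 'w) vec_diagram"
  where "direct_sum \<Lambda> G = \<lparr>
    smult = (\<lambda>c. Poly_Mapping.mapp (\<lambda>i. smult (G i) c)),
    obj = (\<lambda>x. {p. (\<forall>i\<in>\<Lambda>. Poly_Mapping.lookup p i \<in> obj (G i) x) \<and> Poly_Mapping.keys p \<subseteq> \<Lambda>}),
    arr = (\<lambda>x y. Poly_Mapping.mapp (\<lambda>i. arr (G i) x y)) \<rparr>"

section \<open>Interval modules and blocks\<close>

definition poset_interval :: "'p::order set \<Rightarrow> bool"
  where "poset_interval I \<longleftrightarrow>
    (\<forall>x\<in>I. \<forall>y\<in>I. \<forall>z. x \<le> z \<and> z \<le> y \<longrightarrow> z \<in> I) \<and>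
    (\<forall>x\<in>I. \<forall>y\<in>I. \<exists>n (a :: nat \<Rightarrow> 'p) b. a 0 = x \<and> b n = y \<and>
      (\<forall>i\<le>n. a i \<in> I \<and> b i \<in> I \<and> a i \<le> b i) \<and> (\<forall>i<n. a (Suc i) \<le> b i))"

definition interval_module :: "'p::order set \<Rightarrow> ('k::field, 'p, 'k) vec_diagram"
  where "interval_module I = \<lparr>
    smult = (*),
    obj = (\<lambda>x. if x \<in> I then UNIV else {0}),
    arr = (\<lambda>x y v. if x \<in> I \<and> y \<in> I then v else 0) \<rparr>"

definition down_closed :: "'p::order set \<Rightarrow> bool"
  where "down_closed J \<longleftrightarrow> (\<forall>x\<in>J. \<forall>y\<le>x. y \<in> J)"

definition up_closed :: "'p::order set \<Rightarrow> bool"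
  where "up_closed J \<longleftrightarrow> (\<forall>x\<in>J. \<forall>y\<ge>x. y \<in> J)"

definition death_block :: "(ennreal \<times> ennreal) set \<Rightarrow> bool"
  where "death_block I \<longleftrightarrow> poset_interval I \<and>
    (\<exists>J1 J2. down_closed J1 \<and> down_closed J2 \<and> I = J1 \<times> J2)"

definition birth_block :: "(ennreal \<times> ennreal) set \<Rightarrow> bool"
  where "birth_block I \<longleftrightarrow> poset_interval I \<and>
    (\<exists>J1 J2. up_closed J1 \<and> up_closed J2 \<and> I = J1 \<times> J2)"

definition vertical_block :: "(ennreal \<times> ennreal) set \<Rightarrow> bool"
  where "vertical_block I \<longleftrightarrow> poset_interval I \<and> (\<exists>J. poset_interval J \<and> I = J \<times> UNIV)"

definition horizontal_block :: "(ennreal \<times> ennreal) set \<Rightarrow> bool"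
  where "horizontal_block I \<longleftrightarrow> poset_interval I \<and> (\<exists>J. poset_interval J \<and> I = UNIV \<times> J)"

text \<open>The index type \<open>'p set \<times> nat\<close> is no restriction for pointwise finite-dimensional functors:
  each nonempty interval then occurs only finitely often, so a summand can be indexed by its
  interval together with a counter.\<close>

definition decomposes_into_intervals ::
  "('k::field, 'p::order, 'v::ab_group_add) vec_diagram \<Rightarrow> ('p set \<Rightarrow> bool) \<Rightarrow> bool"
  where "decomposes_into_intervals F P \<longleftrightarrow>
    (\<exists>(\<Lambda> :: ('p set \<times> nat) set) I. (\<forall>i\<in>\<Lambda>. P (I i)) \<and>
      isomorphic_functors F (direct_sum \<Lambda> (\<lambda>i. interval_module (I i))))"

end

theory Submission
  imports Defs
begin

text \<open>
  A codegree one functor is the pushout of its restrictions to the edges \<open>y = 0\<close> and \<open>x = 0\<close>, and a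
  degree one functor is the pullback of its restrictions to the edges \<open>y = \<infinity>\<close> and \<open>x = \<infinity>\<close>. So the
  datum is a pair of persistence modules over a chain that share the space \<open>U\<close> at the common corner.
  The kernels (resp. images) of the maps out of (resp. into) \<open>U\<close> along the two edges form two flags in
  \<open>U\<close>, and \<open>U\<close> has a basis \<open>\<beta>\<close> adapted to both. The vectors in \<open>\<beta>\<close>, transported along (resp. lifted
  compatibly to) an edge, span a pure submodule there, which is complemented by further interval
  summands not meeting the corner. The vectors in \<open>\<beta>\<close> yield the death (resp. birth) blocks; the other
  summands of the two edges yield the vertical and horizontal blocks.

  Over a chain, a maximal independent family of intervals that spans a pure submodule spans the whole
  module: otherwise one more interval can be split off the quotient, and linear compactness of
  finite-dimensional spaces lifts it to the module itself.
\<close>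

text \<open>The two edges cannot be decomposed separately: each decomposition would choose its own
  basis of \<open>U\<close>, and a summand of one edge need then match no single summand of the
  other. So \<open>U\<close> receives its basis first, and both edges are decomposed relative to it.
  Two flags always have a common basis, whereas three lines in a plane have none; it is essential
  that only two edges meet at the corner.

  Independence alone does not make greedy enlargement safe. For the identity map of a
  one-dimensional space, regarded as a module over two points, the interval at the later point is
  independent, cannot be enlarged, and does not span. Purity excludes such choices.

  The chain need not be well-ordered in either direction, so a lift cannot be built point by point.
  The admissible vectors at each point form an affine subspace, and finite dimension makes
  descending chains of these stationary; this turns pointwise solvability into a simultaneous
  solution.\<close>

section \<open>Flats in finite-dimensional spaces\<close>

text \<open>Affine subspaces, with the empty set included. Three points are used instead of a line
  through two, since over a field with two elements every set is closed under such lines.\<close>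

definition flat :: "('k \<Rightarrow> 'v::ab_group_add \<Rightarrow> 'v) \<Rightarrow> 'v set \<Rightarrow> bool"
  where "flat s A \<longleftrightarrow> (\<forall>x\<in>A. \<forall>y\<in>A. \<forall>z\<in>A. \<forall>c. x + s c (y - z) \<in> A)"

context vector_space
begin

lemma flatD: "flat scale A \<Longrightarrow> x \<in> A \<Longrightarrow> y \<in> A \<Longrightarrow> z \<in> A \<Longrightarrow> x + c *s (y - z) \<in> A"
  unfolding flat_def by blast

lemma flat_subspace: "subspace A \<Longrightarrow> flat scale A"
  unfolding flat_def by (blast intro: subspace_add subspace_scale subspace_diff)

lemma flat_Int: "flat scale A \<Longrightarrow> flat scale B \<Longrightarrow> flat scale (A \<inter> B)"
  unfolding flat_def by blast

lemma flat_Inter: "(\<And>A. A \<in> \<A> \<Longrightarrow> flat scale A) \<Longrightarrow> flat scale (\<Inter>\<A>)"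
  unfolding flat_def by blast

lemma flat_singleton: "flat scale {x}"
  unfolding flat_def by simp

lemma flat_vimage:
  assumes "Vector_Spaces.linear scale scale h" "flat scale A"
  shows "flat scale (h -` A)"
proof -
  interpret h: Vector_Spaces.linear scale scale h by fact
  show ?thesis using assms(2) unfolding flat_def by (simp add: h.add h.scale h.diff)
qed

lemma flat_image:
  assumes "Vector_Spaces.linear scale scale h" "flat scale A"
  shows "flat scale (h ` A)"
proof -
  interpret h: Vector_Spaces.linear scale scale h by fact
  show ?thesis
    unfolding flat_def
  proof (intro ballI allI)
    fix x y z c assume "x \<in> h ` A" "y \<in> h ` A" "z \<in> h ` A"
    then obtain x' y' z' where *: "x = h x'" "y = h y'" "z = h z'" "x' \<in> A" "y' \<in> A" "z' \<in> A" by blast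
    then have "x + c *s (y - z) = h (x' + c *s (y' - z'))" by (simp add: h.add h.scale h.diff)
    then show "x + c *s (y - z) \<in> h ` A" using flatD[OF assms(2) *(4,5,6)] by simp
  qed
qed

lemma flat_translate:
  assumes "flat scale A"
  shows "flat scale {x. x - a \<in> A}"
  unfolding flat_def
proof (intro ballI allI CollectI)
  fix x y z c assume "x \<in> {x. x - a \<in> A}" "y \<in> {x. x - a \<in> A}" "z \<in> {x. x - a \<in> A}"
  then have "(x - a) + c *s ((y - a) - (z - a)) \<in> A" using flatD[OF assms] by blast
  then show "x + c *s (y - z) - a \<in> A" by (simp add: algebra_simps)
qed

text \<open>Choose a member \<open>A\<close> whose difference space \<open>D A\<close> has least
  dimension. A member inside \<open>A\<close> has the same difference space, and one of its points
  together with these differences recovers all of \<open>A\<close>.\<close>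

lemma flat_chain_least:
  assumes "\<A> \<noteq> {}" and "finite E"
    and "\<And>A. A \<in> \<A> \<Longrightarrow> A \<subseteq> span E" "\<And>A. A \<in> \<A> \<Longrightarrow> A \<noteq> {}" "\<And>A. A \<in> \<A> \<Longrightarrow> flat scale A"
    and chain: "\<And>A B. A \<in> \<A> \<Longrightarrow> B \<in> \<A> \<Longrightarrow> A \<subseteq> B \<or> B \<subseteq> A"
  obtains A where "A \<in> \<A>" "\<And>B. B \<in> \<A> \<Longrightarrow> A \<subseteq> B"
proof -
  define D where "D (A :: 'b set) = {y - z | y z. y \<in> A \<and> z \<in> A}" for A
  obtain A where A: "A \<in> \<A>" "\<And>B. B \<in> \<A> \<Longrightarrow> dim (D A) \<le> dim (D B)"
    using assms(1) ex_has_least_nat[of "\<lambda>A. A \<in> \<A>" _ "\<lambda>A. dim (D A)"] by blast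
  have "A \<subseteq> B" if B: "B \<in> \<A>" for B
  proof (cases "A \<subseteq> B")
    case False
    then have BA: "B \<subseteq> A" using chain A(1) B by blast
    then have DBA: "D B \<subseteq> D A" unfolding D_def by blast
    have DA: "D A \<subseteq> span E" using assms(3)[OF A(1)] unfolding D_def by (auto intro: span_diff)
    obtain b where b: "b \<in> B" using assms(4)[OF B] by blast
    have DI: "y - z \<in> D B" if "y \<in> B" "z \<in> B" for y z using that unfolding D_def by blast
    have subD: "subspace (D B)"
    proof (rule subspaceI)
      show "0 \<in> D B" using DI[OF b b] by simp
      fix x y assume "x \<in> D B" "y \<in> D B"
      then obtain p q r t where *: "x = p - q" "y = r - t" "p \<in> B" "q \<in> B" "r \<in> B" "t \<in> B"
        unfolding D_def by blast
      have "p + 1 *s (r - t) \<in> B" by (rule flatD[OF assms(5)[OF B]]) fact+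
      moreover have "p + 1 *s (r - t) - q = x + y" using *(1,2) by (simp add: algebra_simps)
      ultimately show "x + y \<in> D B" using DI *(4) by metis
    next
      fix c x assume "x \<in> D B"
      then obtain p q where *: "x = p - q" "p \<in> B" "q \<in> B" unfolding D_def by blast
      have "b + c *s (p - q) \<in> B" by (rule flatD[OF assms(5)[OF B]]) fact+
      from DI[OF this b] show "c *s x \<in> D B" using * by simp
    qed
    obtain C where C: "C \<subseteq> D B" "independent C" "D B \<subseteq> span C" "card C = dim (D B)"
      by (rule basis_exists)
    obtain C' where C': "C' \<subseteq> D A" "independent C'" "D A \<subseteq> span C'" "card C' = dim (D A)"
      by (rule basis_exists)
    have fin: "finite C'" "finite C"
      using independent_span_bound[OF assms(2)] C'(1,2) C(1,2) DA DBA by blast+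
    have "D A \<subseteq> D B"
    proof
      fix x assume x: "x \<in> D A"
      show "x \<in> D B"
      proof (rule ccontr)
        assume "x \<notin> D B"
        then have "x \<notin> span C" using span_minimal[OF C(1) subD] by blast
        then have "independent (insert x C)" "x \<notin> C" using C(2) by (auto simp: independent_insert span_base)
        moreover have "insert x C \<subseteq> span C'" using x C(1) C'(3) DBA by blast
        ultimately have "Suc (card C) \<le> card C'"
          using independent_span_bound[OF fin(1), of "insert x C"] fin(2) by simp
        then show False using A(2)[OF B] C(4) C'(4) by simp
      qed
    qed
    show ?thesis
    proof
      fix a assume "a \<in> A"
      then have "a - b \<in> D A" using b BA unfolding D_def by blast
      then obtain y z where "a - b = y - z" "y \<in> B" "z \<in> B" using \<open>D A \<subseteq> D B\<close> unfolding D_def by blast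
      then have "a = b + 1 *s (y - z)" by (simp add: algebra_simps)
      then show "a \<in> B" using flatD[OF assms(5)[OF B] b \<open>y \<in> B\<close> \<open>z \<in> B\<close>] by blast
    qed
  qed
  then show thesis using A(1) that by blast
qed

text \<open>The representations of \<open>x\<close> in \<open>A\<close> and in \<open>B\<close> both
  agree with the one in \<open>C\<close>, so they have the same support, and it lies in
  \<open>A\<close> and in \<open>B\<close>.\<close>

lemma independent_span_disjoint:
  assumes "independent C" "A \<subseteq> C" "B \<subseteq> C"
  shows "span A \<inter> span B \<subseteq> span (A \<inter> B)"
proof
  fix x assume x: "x \<in> span A \<inter> span B"
  have iA: "independent A" "independent B" "independent (A \<inter> B)" using assms independent_mono by blast+
  have rA: "representation A x = representation C x" "representation B x = representation C x"
    using x assms by (auto intro!: representation_extend[symmetric])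
  have sub: "{b. representation A x b \<noteq> 0} \<subseteq> A \<inter> B"
    using representation_ne_zero[of A x] representation_ne_zero[of B x] rA by auto
  have "x = (\<Sum>b | representation A x b \<noteq> 0. representation A x b *s b)"
    using sum_nonzero_representation_eq[of A x] iA x by simp
  also have "\<dots> \<in> span (A \<inter> B)"
    using sub by (intro span_sum span_scale span_base) auto
  finally show "x \<in> span (A \<inter> B)" .
qed

text \<open>Allows the arrows of a diagram, which matter only on a subspace, to be replaced by
  linear maps of the ambient space.\<close>

lemma linear_subspace_extension:
  assumes "subspace U" "vec_hom scale U scale W h"
  shows "\<exists>g. Vector_Spaces.linear scale scale g \<and> (\<forall>u\<in>U. g u = h u)"
proof -
  interpret vector_space_pair scale scale by unfold_locales
  obtain B where B: "B \<subseteq> U" "independent B" "U \<subseteq> span B" by (rule maximal_independent_subset)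
  obtain g where g: "Vector_Spaces.linear scale scale g" "\<forall>x\<in>B. g x = h x"
    using linear_independent_extend[OF B(2), of h] by blast
  interpret g: Vector_Spaces.linear scale scale g by fact
  have "u \<in> U \<and> g u = h u" if "u \<in> span B" for u
    using that
  proof (induction rule: span_induct_alt)
    case base
    then show ?case using vec_hom_0[OF assms(2)] subspace_0[OF assms(1)] g.zero by simp
  next
    case (step c x y)
    then have "x \<in> U" "c *s x \<in> U" using B(1) assms(1) subspace_scale by blast+
    then show ?case using step assms g(2) subspace_add unfolding vec_hom_def by (simp add: g.add g.scale)
  qed
  then show ?thesis using g(1) B(3) by blast
qed

end

section \<open>Bars\<close>

text \<open>Each \<open>f x y\<close> is linear on the whole ambient space, even for incomparable
  \<open>x\<close> and \<open>y\<close>, so that linear maps can be used without carrying domains.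
  The spaces \<open>V x\<close> enter the laws for \<open>f\<close> through \<open>f_in\<close>,
  \<open>f_id\<close> and \<open>f_comp\<close>.\<close>

locale persistence = vector_space scale
  for scale :: "'k::field \<Rightarrow> 'v::ab_group_add \<Rightarrow> 'v" (infixr \<open>*s\<close> 75) +
  fixes V :: "'p::order \<Rightarrow> 'v set" and f :: "'p \<Rightarrow> 'p \<Rightarrow> 'v \<Rightarrow> 'v"
  assumes subspace_V: "subspace (V x)"
    and fin_V: "\<exists>E. finite E \<and> span E = V x"
    and linear_f: "Vector_Spaces.linear scale scale (f x y)"
    and f_in: "x \<le> y \<Longrightarrow> v \<in> V x \<Longrightarrow> f x y v \<in> V y"
    and f_id: "v \<in> V x \<Longrightarrow> f x x v = v"
    and f_comp: "x \<le> y \<Longrightarrow> y \<le> z \<Longrightarrow> v \<in> V x \<Longrightarrow> f y z (f x y v) = f x z v"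
begin

sublocale f: Vector_Spaces.linear scale scale "f x y" for x y
  by (rule linear_f)

text \<open>A bar encodes an embedding of an interval module: the interval is the set on which it is nonzero.\<close>

definition bar :: "('p \<Rightarrow> 'v) \<Rightarrow> bool"
  where "bar w \<longleftrightarrow> (\<forall>x. w x \<in> V x) \<and> (\<forall>x y. x \<le> y \<longrightarrow> w x \<noteq> 0 \<longrightarrow> f x y (w x) = w y)"

definition spanned :: "('p \<Rightarrow> 'v) set \<Rightarrow> 'p \<Rightarrow> 'v set"
  where "spanned \<Omega> x = span ((\<lambda>w. w x) ` \<Omega>)"

text \<open>For bars, this says that the direct sum of their interval modules embeds into
  \<open>V\<close>. Independence of the set of values would not notice two bars with the same value,
  hence the injectivity. Bars are dropped at the points where they vanish.\<close>

definition free :: "('p \<Rightarrow> 'v) set \<Rightarrow> bool"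
  where "free \<Omega> \<longleftrightarrow> (\<forall>x. inj_on (\<lambda>w. w x) {w \<in> \<Omega>. w x \<noteq> 0} \<and>
    independent ((\<lambda>w. w x) ` {w \<in> \<Omega>. w x \<noteq> 0}))"

text \<open>A vector that is carried into the submodule can be corrected inside it so as to be
  carried to 0. Equivalently, a kernel between the quotients by \<open>spanned \<Omega>\<close> is
  the image of a kernel in \<open>V\<close>.\<close>

definition pure :: "('p \<Rightarrow> 'v) set \<Rightarrow> bool"
  where "pure \<Omega> \<longleftrightarrow> (\<forall>x y u. x \<le> y \<longrightarrow> u \<in> V x \<longrightarrow> f x y u \<in> spanned \<Omega> y \<longrightarrow>
    (\<exists>\<sigma>\<in>spanned \<Omega> x. f x y u = f x y \<sigma>))"

lemma barD:
  assumes "bar w"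
  shows "w x \<in> V x" "x \<le> y \<Longrightarrow> w x \<noteq> 0 \<Longrightarrow> f x y (w x) = w y"
  using assms unfolding bar_def by auto

lemma barI:
  assumes "\<And>x. w x \<in> V x" "\<And>x y. x \<le> y \<Longrightarrow> w x \<noteq> 0 \<Longrightarrow> f x y (w x) = w y"
  shows "bar w"
  using assms unfolding bar_def by auto

lemma bar_support_convex:
  assumes "bar w" "x \<le> z" "z \<le> y" "w x \<noteq> 0" "w y \<noteq> 0"
  shows "w z \<noteq> 0"
proof
  assume "w z = 0"
  then have "f x z (w x) = 0" using barD(2)[OF assms(1,2,4)] by simp
  then have "f x y (w x) = 0" using f_comp[OF assms(2,3) barD(1)[OF assms(1)]] f.zero by metis
  then show False using barD(2)[OF assms(1) order_trans[OF assms(2,3)] assms(4)] assms(5) by simp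
qed

lemma spanned_base: "w \<in> \<Omega> \<Longrightarrow> w x \<in> spanned \<Omega> x"
  unfolding spanned_def by (blast intro: span_base)

lemma subspace_spanned: "subspace (spanned \<Omega> x)"
  unfolding spanned_def by (rule subspace_span)

lemma spanned_mono: "\<Omega> \<subseteq> \<Omega>' \<Longrightarrow> spanned \<Omega> x \<subseteq> spanned \<Omega>' x"
  unfolding spanned_def by (intro span_mono) blast

lemma spanned_subset:
  assumes "\<And>w. w \<in> \<Omega> \<Longrightarrow> bar w"
  shows "spanned \<Omega> x \<subseteq> V x"
  unfolding spanned_def using assms barD(1) by (intro span_minimal subspace_V) blast

lemma spanned_nonzero: "spanned \<Omega> x = span ((\<lambda>w. w x) ` {w \<in> \<Omega>. w x \<noteq> 0})"
proof -
  have "(\<lambda>w. w x) ` {w \<in> \<Omega>. w x \<noteq> 0} = (\<lambda>w. w x) ` \<Omega> - {0}" by auto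
  then show ?thesis unfolding spanned_def by (simp add: span_delete_0)
qed

lemma f_spanned:
  assumes "\<And>w. w \<in> \<Omega> \<Longrightarrow> bar w" "x \<le> y" "v \<in> spanned \<Omega> x"
  shows "f x y v \<in> spanned \<Omega> y"
proof -
  have "f x y ` spanned \<Omega> x = span (f x y ` (\<lambda>w. w x) ` \<Omega>)"
    unfolding spanned_def by (rule f.span_image[symmetric])
  also have "\<dots> \<subseteq> spanned \<Omega> y"
  proof (intro span_minimal subspace_spanned, safe)
    fix w assume w: "w \<in> \<Omega>"
    show "f x y (w x) \<in> spanned \<Omega> y"
    proof (cases "w x = 0")
      case True
      then show ?thesis using f.zero subspace_0[OF subspace_spanned] by metis
    next
      case False
      then show ?thesis using barD(2)[OF assms(1)[OF w] assms(2)] spanned_base[OF w] by metis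
    qed
  qed
  finally show ?thesis using assms(3) by blast
qed

section \<open>Affine solution sets and their inverse limits\<close>

lemma flat_fibre:
  assumes "subspace W"
  shows "flat scale {u \<in> V s. f s t u - m \<in> W}"
proof -
  have "{u \<in> V s. f s t u - m \<in> W} = V s \<inter> f s t -` {x. x - m \<in> W}" by blast
  then show ?thesis
    using flat_Int[OF flat_subspace[OF subspace_V]
        flat_vimage[OF linear_f flat_translate[OF flat_subspace[OF assms]]]] by metis
qed

lemma flat_chain_least_V:
  assumes "\<A> \<noteq> {}" "\<And>A. A \<in> \<A> \<Longrightarrow> A \<subseteq> V x" "\<And>A. A \<in> \<A> \<Longrightarrow> A \<noteq> {}" "\<And>A. A \<in> \<A> \<Longrightarrow> flat scale A"
    "\<And>A B. A \<in> \<A> \<Longrightarrow> B \<in> \<A> \<Longrightarrow> A \<subseteq> B \<or> B \<subseteq> A"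
  obtains A where "A \<in> \<A>" "\<And>B. B \<in> \<A> \<Longrightarrow> A \<subseteq> B"
proof -
  obtain E where E: "finite E" "span E = V x" using fin_V by blast
  have "A \<subseteq> span E" if "A \<in> \<A>" for A using assms(2)[OF that] E(2) by simp
  then show thesis using flat_chain_least[OF assms(1) E(1) _ assms(3-5)] that by blast
qed

text \<open>Linear compactness. A minimal subsystem \<open>Y\<close> of nonempty flats consists of singletons: a point
  of \<open>Y s0\<close> in the image of all the \<open>Y s\<close> with \<open>s \<le> s0\<close> cuts out a smaller subsystem. For
  the sake of \<open>subset_Zorn\<close>, a subsystem is encoded by its complement.\<close>

lemma flat_inverse_limit:
  assumes tot: "\<And>s s'. s \<in> L \<Longrightarrow> s' \<in> L \<Longrightarrow> s \<le> s' \<or> s' \<le> s"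
    and X: "\<And>s. s \<in> L \<Longrightarrow> X s \<subseteq> V s" "\<And>s. s \<in> L \<Longrightarrow> X s \<noteq> {}" "\<And>s. s \<in> L \<Longrightarrow> flat scale (X s)"
    and fX: "\<And>s s' x. s \<in> L \<Longrightarrow> s' \<in> L \<Longrightarrow> s \<le> s' \<Longrightarrow> x \<in> X s \<Longrightarrow> f s s' x \<in> X s'"
  obtains w where "\<And>s. s \<in> L \<Longrightarrow> w s \<in> X s"
    "\<And>s s'. s \<in> L \<Longrightarrow> s' \<in> L \<Longrightarrow> s \<le> s' \<Longrightarrow> f s s' (w s) = w s'"
proof -
  define Y where "Y Z s = X s - {v. (s, v) \<in> Z}" for Z s
  define system where "system Z \<longleftrightarrow> (\<forall>s\<in>L. Y Z s \<noteq> {} \<and> flat scale (Y Z s)) \<and>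
    (\<forall>s\<in>L. \<forall>s'\<in>L. s \<le> s' \<longrightarrow> (\<forall>x\<in>Y Z s. f s s' x \<in> Y Z s'))" for Z
  have YX: "Y Z s \<subseteq> X s" for Z s unfolding Y_def by blast
  have "\<exists>M\<in>Collect system. \<forall>Z\<in>Collect system. M \<subseteq> Z \<longrightarrow> Z = M"
  proof (rule subset_Zorn_nonempty)
    have "Y {} = X" unfolding Y_def by auto
    then have "system {}" using X fX unfolding system_def by simp
    then show "Collect system \<noteq> {}" by blast
    fix \<C> assume C: "\<C> \<noteq> {}" "subset.chain (Collect system) \<C>"
    have sys: "system Z" if "Z \<in> \<C>" for Z
      using C(2) that unfolding subset.chain_def by blast
    have YC: "Y (\<Union>\<C>) s = (\<Inter>Z\<in>\<C>. Y Z s)" for s using C(1) unfolding Y_def by blast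
    have "Y (\<Union>\<C>) s \<noteq> {}" if s: "s \<in> L" for s
    proof -
      \<comment> \<open>Finite dimension enters here: the intersection at \<open>s\<close> contains
        the least flat of the chain, hence is not empty.\<close>
      obtain A where A: "A \<in> (\<lambda>Z. Y Z s) ` \<C>" "\<And>B. B \<in> (\<lambda>Z. Y Z s) ` \<C> \<Longrightarrow> A \<subseteq> B"
      proof (rule flat_chain_least_V[of "(\<lambda>Z. Y Z s) ` \<C>" s])
        show "(\<lambda>Z. Y Z s) ` \<C> \<noteq> {}" using C(1) by blast
        show "A \<subseteq> V s" if "A \<in> (\<lambda>Z. Y Z s) ` \<C>" for A using that YX X(1)[OF s] by blast
        show "A \<noteq> {}" "flat scale A" if "A \<in> (\<lambda>Z. Y Z s) ` \<C>" for A
          using that sys s unfolding system_def by auto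
        show "A \<subseteq> B \<or> B \<subseteq> A" if AB: "A \<in> (\<lambda>Z. Y Z s) ` \<C>" "B \<in> (\<lambda>Z. Y Z s) ` \<C>" for A B
        proof -
          obtain Z Z' where "A = Y Z s" "B = Y Z' s" "Z \<in> \<C>" "Z' \<in> \<C>" using AB by blast
          moreover have "Z \<subseteq> Z' \<or> Z' \<subseteq> Z"
            using C(2) calculation(3,4) unfolding subset.chain_def by blast
          ultimately show ?thesis unfolding Y_def by blast
        qed
      qed blast
      have "A \<noteq> {}" using A(1) sys s unfolding system_def by auto
      moreover have "A \<subseteq> Y (\<Union>\<C>) s" unfolding YC using A(2) by blast
      ultimately show ?thesis by blast
    qed
    moreover have "flat scale (Y (\<Union>\<C>) s)" if "s \<in> L" for s
      unfolding YC by (rule flat_Inter) (use sys that system_def in blast)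
    moreover have "f s s' x \<in> Y (\<Union>\<C>) s'" if "s \<in> L" "s' \<in> L" "s \<le> s'" "x \<in> Y (\<Union>\<C>) s" for s s' x
      unfolding YC using sys that[unfolded YC] unfolding system_def by blast
    ultimately show "\<Union>\<C> \<in> Collect system" unfolding system_def by blast
  qed
  then obtain M where M: "system M" "\<And>Z. system Z \<Longrightarrow> M \<subseteq> Z \<Longrightarrow> Z = M" by blast
  have YM: "Y M s \<subseteq> V s" "Y M s \<noteq> {}" "flat scale (Y M s)" if "s \<in> L" for s
  proof -
    show "Y M s \<subseteq> V s" using YX X(1)[OF that] by blast
    show "Y M s \<noteq> {}" "flat scale (Y M s)" using M(1) that unfolding system_def by auto
  qed
  have fY: "f s s' x \<in> Y M s'" if "s \<in> L" "s' \<in> L" "s \<le> s'" "x \<in> Y M s" for s s' x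
    using M(1) that unfolding system_def by blast
  have "\<exists>y. Y M s0 = {y}" if s0: "s0 \<in> L" for s0
  proof -
    \<comment> \<open>The images at \<open>s0\<close> shrink as \<open>s\<close> decreases, so there
      is a least one, and each of its points lifts to every earlier \<open>s\<close>.\<close>
    let ?\<A> = "{f s s0 ` Y M s | s. s \<in> L \<and> s \<le> s0}"
    obtain A where A: "A \<in> ?\<A>" "\<And>B. B \<in> ?\<A> \<Longrightarrow> A \<subseteq> B"
    proof (rule flat_chain_least_V[of ?\<A> s0])
      show "?\<A> \<noteq> {}" using s0 by blast
      show "A \<subseteq> V s0" "A \<noteq> {}" "flat scale A" if "A \<in> ?\<A>" for A
      proof -
        obtain s where "A = f s s0 ` Y M s" "s \<in> L" "s \<le> s0" using \<open>A \<in> ?\<A>\<close> by blast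
        then show "A \<subseteq> V s0" "A \<noteq> {}" "flat scale A"
          using YM(1)[OF s0] YM(2,3)[of s] fY[of s s0] s0 flat_image[OF linear_f] by auto
      qed
      have *: "f s s0 ` Y M s \<subseteq> f s' s0 ` Y M s'" if "s \<in> L" "s' \<in> L" "s \<le> s'" "s' \<le> s0" for s s'
      proof
        fix z assume "z \<in> f s s0 ` Y M s"
        then obtain x where "x \<in> Y M s" "z = f s s0 x" by blast
        moreover have "f s' s0 (f s s' x) = f s s0 x"
          using that f_comp calculation(1) YM(1) by blast
        ultimately show "z \<in> f s' s0 ` Y M s'" using fY[OF that(1-3)] by (metis image_eqI)
      qed
      show "A \<subseteq> B \<or> B \<subseteq> A" if AB: "A \<in> ?\<A>" "B \<in> ?\<A>" for A B
      proof -
        obtain s s' where "A = f s s0 ` Y M s" "s \<in> L" "s \<le> s0" "B = f s' s0 ` Y M s'" "s' \<in> L" "s' \<le> s0"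
          using AB by blast
        then show ?thesis using *[of s s'] *[of s' s] tot[of s s'] by metis
      qed
    qed blast
    have "A \<noteq> {}" using A(1) YM(2) by auto
    then obtain y where "y \<in> A" by blast
    moreover have "A \<subseteq> f s s0 ` Y M s" if "s \<in> L" "s \<le> s0" for s
      by (rule A(2)) (use that in blast)
    ultimately have y: "y \<in> f s s0 ` Y M s" if "s \<in> L" "s \<le> s0" for s using that by blast
    have "y \<in> f s0 s0 ` Y M s0" using y s0 by blast
    then have y0: "y \<in> Y M s0" using fY s0 by blast
    \<comment> \<open>The value at \<open>s0\<close> is fixed to be \<open>y\<close>: before
      \<open>s0\<close> the vectors sent to \<open>y\<close> remain, after \<open>s0\<close> only
      the image of \<open>y\<close>. At \<open>s0\<close> itself both conditions apply and
      agree.\<close>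
    define Y' where "Y' s = {x \<in> Y M s. (s \<le> s0 \<longrightarrow> f s s0 x = y) \<and> (s0 \<le> s \<longrightarrow> x = f s0 s y)}" for s
    have Y'I: "x \<in> Y' s" if "x \<in> Y M s" "s \<le> s0 \<Longrightarrow> f s s0 x = y" "s0 \<le> s \<Longrightarrow> x = f s0 s y" for x s
      using that unfolding Y'_def by simp
    have fid: "f s0 s0 y = y" using y0 YM(1) s0 f_id by blast
    define Z where "Z = {(s, v). v \<notin> Y' s}"
    have YZ: "Y Z s = Y' s" for s unfolding Y_def Z_def Y'_def by blast
    have MZ: "M \<subseteq> Z" unfolding Z_def Y'_def Y_def by auto
    have "system Z"
      unfolding system_def YZ
    proof (intro conjI ballI impI)
      fix s assume s: "s \<in> L"
      consider "s \<le> s0" | "s0 \<le> s" using tot s s0 by blast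
      note cs = this
      show "Y' s \<noteq> {}"
      proof (cases rule: cs)
        case 1
        then obtain x where x: "x \<in> Y M s" "y = f s s0 x" using y s by blast
        have "x = f s0 s y" if "s0 \<le> s"
        proof -
          have "s = s0" using 1 that by simp
          then show ?thesis using x fid f_id YM(1)[OF s] by auto
        qed
        then have "x \<in> Y' s" using x by (intro Y'I) auto
        then show ?thesis by blast
      next
        case 2
        have "f s s0 (f s0 s y) = y" if "s \<le> s0"
        proof -
          have "s = s0" using 2 that by simp
          then show ?thesis using fid by simp
        qed
        then have "f s0 s y \<in> Y' s" using fY[OF s0 s 2 y0] by (intro Y'I) auto
        then show ?thesis by blast
      qed
      have flat1: "flat scale {x. f s s0 x = y}"
        using flat_vimage[OF linear_f[of s s0] flat_singleton[of y]] by (simp add: vimage_def)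
      have flat2: "flat scale {x. P \<longrightarrow> Q x}" if "flat scale {x. Q x}" for P and Q
        using that flat_subspace[OF subspace_UNIV] by (cases P) auto
      have "Y' s = Y M s \<inter> {x. s \<le> s0 \<longrightarrow> f s s0 x = y} \<inter> {x. s0 \<le> s \<longrightarrow> x = f s0 s y}"
        unfolding Y'_def by blast
      moreover have "flat scale {x. x = f s0 s y}" using flat_singleton by simp
      ultimately show "flat scale (Y' s)" using flat_Int flat2 flat1 YM(3)[OF s] by metis
    next
      fix s s' x assume s: "s \<in> L" "s' \<in> L" "s \<le> s'" and x: "x \<in> Y' s"
      then have x': "x \<in> Y M s" "s \<le> s0 \<Longrightarrow> f s s0 x = y" "s0 \<le> s \<Longrightarrow> x = f s0 s y"
        unfolding Y'_def by auto
      have xV: "x \<in> V s" using x' YM(1) s by blast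
      have yV: "y \<in> V s0" using y0 YM(1) s0 by blast
      have "f s' s0 (f s s' x) = y" if "s' \<le> s0"
        using f_comp[OF s(3) that xV] x'(2) s(3) that by simp
      moreover have "f s s' x = f s0 s' y" if "s0 \<le> s'"
      proof (cases "s \<le> s0")
        case True
        then show ?thesis using f_comp[OF True that xV] x'(2) by simp
      next
        case False
        then have "s0 \<le> s" using tot s s0 by blast
        then show ?thesis using f_comp[OF _ s(3) yV] x'(3) by simp
      qed
      ultimately show "f s s' x \<in> Y' s'" using fY[OF s x'(1)] by (intro Y'I)
    qed
    then have "Z = M" using M(2) MZ by blast
    then have "Y M s0 = Y' s0" using YZ by simp
    moreover have "Y' s0 \<subseteq> {y}" unfolding Y'_def using fid by auto
    ultimately show ?thesis using y0 by blast
  qed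
  then obtain w where w: "\<And>s. s \<in> L \<Longrightarrow> Y M s = {w s}" by metis
  show thesis
  proof
    show "w s \<in> X s" if "s \<in> L" for s using w[OF that] YX by blast
    show "f s s' (w s) = w s'" if "s \<in> L" "s' \<in> L" "s \<le> s'" for s s'
      using fY[OF that] w that by blast
  qed
qed

end

section \<open>Decomposition over a chain\<close>

context persistence
begin

lemma free_insert:
  assumes "free \<Omega>" "\<And>x. w x \<noteq> 0 \<Longrightarrow> w x \<notin> spanned \<Omega> x"
  shows "free (insert w \<Omega>)"
  unfolding free_def
proof (rule allI)
  fix x
  let ?N = "{v \<in> \<Omega>. v x \<noteq> 0}"
  have *: "inj_on (\<lambda>w. w x) ?N" "independent ((\<lambda>w. w x) ` ?N)"
    using assms(1) unfolding free_def by auto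
  show "inj_on (\<lambda>w. w x) {v \<in> insert w \<Omega>. v x \<noteq> 0} \<and>
    independent ((\<lambda>w. w x) ` {v \<in> insert w \<Omega>. v x \<noteq> 0})"
  proof (cases "w x = 0")
    case True
    then have "{v \<in> insert w \<Omega>. v x \<noteq> 0} = ?N" by auto
    then show ?thesis using * by simp
  next
    case False
    have eq: "{v \<in> insert w \<Omega>. v x \<noteq> 0} = insert w ?N" using False by auto
    have ns: "w x \<notin> span ((\<lambda>w. w x) ` ?N)" using assms(2)[OF False] by (simp add: spanned_nonzero)
    then have "w x \<notin> (\<lambda>w. w x) ` ?N" by (rule contrapos_nn) (rule span_base)
    then have "inj_on (\<lambda>w. w x) (insert w ?N)" using *(1) by auto
    moreover have "independent (insert (w x) ((\<lambda>w. w x) ` ?N))"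
      using ns *(2) by (rule independent_insertI)
    ultimately show ?thesis unfolding eq by simp
  qed
qed

lemma free_Union:
  assumes chain: "\<And>\<Omega> \<Omega>'. \<Omega> \<in> \<C> \<Longrightarrow> \<Omega>' \<in> \<C> \<Longrightarrow> \<Omega> \<subseteq> \<Omega>' \<or> \<Omega>' \<subseteq> \<Omega>"
    and "\<And>\<Omega>. \<Omega> \<in> \<C> \<Longrightarrow> free \<Omega>"
  shows "free (\<Union>\<C>)"
  unfolding free_def
proof (intro allI conjI)
  fix x
  define N where "N \<Omega> = {v \<in> \<Omega>. v x \<noteq> 0}" for \<Omega> :: "('p \<Rightarrow> 'v) set"
  have fr: "inj_on (\<lambda>w. w x) (N \<Omega>)" "independent ((\<lambda>w. w x) ` N \<Omega>)" if "\<Omega> \<in> \<C>" for \<Omega>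
    using assms(2)[OF that] unfolding free_def N_def by auto
  show "inj_on (\<lambda>w. w x) {v \<in> \<Union>\<C>. v x \<noteq> 0}"
  proof (rule inj_onI)
    fix v w assume vw: "v \<in> {v \<in> \<Union>\<C>. v x \<noteq> 0}" "w \<in> {v \<in> \<Union>\<C>. v x \<noteq> 0}" "v x = w x"
    then obtain \<Omega> \<Omega>' where *: "\<Omega> \<in> \<C>" "\<Omega>' \<in> \<C>" "v \<in> N \<Omega>" "w \<in> N \<Omega>'" unfolding N_def by blast
    then obtain \<Omega>'' where "\<Omega>'' \<in> \<C>" "v \<in> N \<Omega>''" "w \<in> N \<Omega>''"
      using chain[OF *(1,2)] unfolding N_def by blast
    then show "v = w" using fr(1) vw(3) by (auto dest: inj_onD)
  qed
  have "independent (\<Union>((\<lambda>\<Omega>. (\<lambda>w. w x) ` N \<Omega>) ` \<C>))"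
  proof (rule independent_Union_directed)
    fix c d assume "c \<in> (\<lambda>\<Omega>. (\<lambda>w. w x) ` N \<Omega>) ` \<C>" "d \<in> (\<lambda>\<Omega>. (\<lambda>w. w x) ` N \<Omega>) ` \<C>"
    then obtain \<Omega> \<Omega>' where *: "\<Omega> \<in> \<C>" "\<Omega>' \<in> \<C>" "c = (\<lambda>w. w x) ` N \<Omega>" "d = (\<lambda>w. w x) ` N \<Omega>'" by blast
    then show "c \<subseteq> d \<or> d \<subseteq> c" using chain[OF *(1,2)] unfolding N_def by blast
  qed (use fr(2) in auto)
  also have "\<Union>((\<lambda>\<Omega>. (\<lambda>w. w x) ` N \<Omega>) ` \<C>) = (\<lambda>w. w x) ` {v \<in> \<Union>\<C>. v x \<noteq> 0}"
    unfolding N_def by blast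
  finally show "independent ((\<lambda>w. w x) ` {v \<in> \<Union>\<C>. v x \<noteq> 0})" .
qed

text \<open>A linear combination involves finitely many bars, and these lie in a single member of
  the chain.\<close>

lemma spanned_Union:
  assumes chain: "\<And>\<Omega> \<Omega>'. \<Omega> \<in> \<C> \<Longrightarrow> \<Omega>' \<in> \<C> \<Longrightarrow> \<Omega> \<subseteq> \<Omega>' \<or> \<Omega>' \<subseteq> \<Omega>" and "\<C> \<noteq> {}"
    and "v \<in> spanned (\<Union>\<C>) x"
  obtains \<Omega> where "\<Omega> \<in> \<C>" "v \<in> spanned \<Omega> x"
proof -
  have "\<exists>\<Omega>\<in>\<C>. v \<in> spanned \<Omega> x"
    using assms(3) unfolding spanned_def[of "\<Union>\<C>"]
  proof (induction rule: span_induct_alt)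
    case base
    then show ?case using assms(2) subspace_0[OF subspace_spanned] by blast
  next
    case (step c v v')
    then obtain w \<Omega> \<Omega>' where *: "v = w x" "w \<in> \<Omega>" "\<Omega> \<in> \<C>" "\<Omega>' \<in> \<C>" "v' \<in> spanned \<Omega>' x" by blast
    have "v \<in> spanned \<Omega> x" using * spanned_base by blast
    then obtain \<Omega>'' where "\<Omega>'' \<in> \<C>" "v \<in> spanned \<Omega>'' x" "v' \<in> spanned \<Omega>'' x"
      using chain[OF *(3,4)] spanned_mono *(3,4,5) by (metis subsetD)
    then show ?case using subspace_add[OF subspace_spanned] subspace_scale[OF subspace_spanned] by blast
  qed
  then show thesis using that by blast
qed

lemma pure_Union:
  assumes chain: "\<And>\<Omega> \<Omega>'. \<Omega> \<in> \<C> \<Longrightarrow> \<Omega>' \<in> \<C> \<Longrightarrow> \<Omega> \<subseteq> \<Omega>' \<or> \<Omega>' \<subseteq> \<Omega>" and "\<C> \<noteq> {}"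
    and "\<And>\<Omega>. \<Omega> \<in> \<C> \<Longrightarrow> pure \<Omega>"
  shows "pure (\<Union>\<C>)"
  unfolding pure_def
proof (intro allI impI)
  fix x y u assume *: "x \<le> y" "u \<in> V x" "f x y u \<in> spanned (\<Union>\<C>) y"
  obtain \<Omega> where \<Omega>: "\<Omega> \<in> \<C>" "f x y u \<in> spanned \<Omega> y"
    by (rule spanned_Union[OF chain assms(2) *(3)])
  then obtain \<sigma> where "\<sigma> \<in> spanned \<Omega> x" "f x y u = f x y \<sigma>"
    using assms(3) * unfolding pure_def by blast
  moreover have "spanned \<Omega> x \<subseteq> spanned (\<Union>\<C>) x" using \<Omega>(1) by (intro spanned_mono) blast
  ultimately show "\<exists>\<sigma>\<in>spanned (\<Union>\<C>) x. f x y u = f x y \<sigma>" by blast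
qed

end

locale chain_persistence = persistence scale V f
  for scale :: "'k::field \<Rightarrow> 'v::ab_group_add \<Rightarrow> 'v" (infixr \<open>*s\<close> 75)
    and V :: "'p::linorder \<Rightarrow> 'v set" and f :: "'p \<Rightarrow> 'p \<Rightarrow> 'v \<Rightarrow> 'v"
begin

text \<open>Among the points below \<open>t\<close> at which some vector has an image outside \<open>spanned \<Omega> t\<close>, the image
  is smallest modulo \<open>spanned \<Omega> t\<close> from some point on; a vector \<open>m\<close> of this smallest image lifts
  compatibly to all of them. By purity, the lift can be chosen to vanish as soon as \<open>m\<close> lies in
  \<open>spanned \<Omega>\<close>.\<close>

lemma extend_pure_free:
  assumes bars: "\<And>w. w \<in> \<Omega> \<Longrightarrow> bar w" and "free \<Omega>" and pure: "pure \<Omega>" and "spanned \<Omega> t \<noteq> V t"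
  obtains w where "w \<notin> \<Omega>" "bar w" "free (insert w \<Omega>)" "pure (insert w \<Omega>)"
proof -
  define S where "S = spanned \<Omega>"
  have subS: "subspace (S x)" for x unfolding S_def by (rule subspace_spanned)
  have SV: "S x \<subseteq> V x" for x unfolding S_def using bars by (rule spanned_subset)
  have fS: "f x y v \<in> S y" if "x \<le> y" "v \<in> S x" for x y v
    using f_spanned[OF bars] that unfolding S_def by blast
  have pureD: "\<exists>\<sigma>\<in>S x. f x y u = f x y \<sigma>" if "x \<le> y" "u \<in> V x" "f x y u \<in> S y" for x y u
    using pure that unfolding pure_def S_def by blast
  \<comment> \<open>The points whose space does not die in \<open>V t\<close> modulo
    \<open>S t\<close>. Up to \<open>t\<close>, the new bar will live exactly there; by
    \<open>Lup\<close> nothing is missing between such a point and \<open>t\<close>.\<close>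
  define L where "L = {s. s \<le> t \<and> (\<exists>u\<in>V s. f s t u \<notin> S t)}"
  have "t \<in> L" using assms(4) SV[of t] f_id unfolding L_def S_def by auto
  have Lup: "s' \<in> L" if s: "s \<in> L" "s \<le> s'" "s' \<le> t" for s s'
  proof -
    obtain u where "u \<in> V s" "f s t u \<notin> S t" using s(1) unfolding L_def by blast
    then have "f s s' u \<in> V s'" "f s' t (f s s' u) \<notin> S t" using f_in f_comp s(2,3) by auto
    then show ?thesis using s(3) unfolding L_def by blast
  qed
  define M where "M s = {x + y | x y. x \<in> f s t ` V s \<and> y \<in> S t}" for s
  have MI: "f s t u + y \<in> M s" if "u \<in> V s" "y \<in> S t" for s u y using that unfolding M_def by blast
  have MV: "M s \<subseteq> V t" if "s \<in> L" for s
    using that SV[of t] f_in[of s t] subspace_add[OF subspace_V[of t]] unfolding M_def L_def by auto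
  have subM: "subspace (M s)" for s
    unfolding M_def by (intro subspace_sums subS f.subspace_image subspace_V)
  have Mmono: "M s \<subseteq> M s'" if "s \<in> L" "s' \<in> L" "s \<le> s'" for s s'
  proof
    fix z assume "z \<in> M s"
    then obtain u y where z: "z = f s t u + y" "u \<in> V s" "y \<in> S t" unfolding M_def by blast
    then have "z = f s' t (f s s' u) + y" using f_comp that unfolding L_def by simp
    then show "z \<in> M s'" using MI f_in z that(3) by simp
  qed
  obtain A where A: "A \<in> M ` L" "\<And>B. B \<in> M ` L \<Longrightarrow> A \<subseteq> B"
  proof (rule flat_chain_least_V[of "M ` L" t])
    show "M ` L \<noteq> {}" using \<open>t \<in> L\<close> by blast
    show "A \<subseteq> V t" "A \<noteq> {}" "flat scale A" if A: "A \<in> M ` L" for A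
    proof -
      obtain s where "A = M s" "s \<in> L" using A by blast
      then show "A \<subseteq> V t" "A \<noteq> {}" "flat scale A"
        using MV flat_subspace[OF subM[of s]] subspace_0[OF subM[of s]] by auto
    qed
    show "A \<subseteq> B \<or> B \<subseteq> A" if AB: "A \<in> M ` L" "B \<in> M ` L" for A B
    proof -
      obtain s s' where "A = M s" "s \<in> L" "B = M s'" "s' \<in> L" using AB by blast
      then show ?thesis using Mmono[of s s'] Mmono[of s' s] linear[of s s'] by blast
    qed
  qed blast
  then obtain s0 where s0: "s0 \<in> L" "\<And>s. s \<in> L \<Longrightarrow> M s0 \<subseteq> M s" by blast
  then obtain u0 where u0: "u0 \<in> V s0" "f s0 t u0 \<notin> S t" unfolding L_def by blast
  define m where "m = f s0 t u0"
  have m: "m \<notin> S t" "m \<in> V t" using u0 f_in s0(1) unfolding m_def L_def by auto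
  have "m \<in> M s0" using MI[OF u0(1) subspace_0[OF subS]] unfolding m_def by simp
  then have mM: "m \<in> M s" if "s \<in> L" for s using s0(2)[OF that] by blast
  \<comment> \<open>From \<open>R\<close> on, \<open>m\<close> lies in the submodule, so the new bar
    has to end there.\<close>
  define R where "R = {r. t \<le> r \<and> f t r m \<in> S r}"
  have Rup: "r' \<in> R" if "r \<in> R" "r \<le> r'" for r r'
  proof -
    have "t \<le> r" "f t r m \<in> S r" using that(1) unfolding R_def by auto
    then have "f t r' m \<in> S r'" using fS[OF that(2)] f_comp[OF _ that(2) m(2)] by metis
    then show ?thesis using \<open>t \<le> r\<close> that(2) unfolding R_def by auto
  qed
  have tR: "t \<notin> R" using m f_id unfolding R_def by simp
  \<comment> \<open>Lifting \<open>m\<close> only modulo \<open>S t\<close> leaves the freedom to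
    subtract vectors of the submodule, which is what allows the lift to vanish on
    \<open>R\<close>.\<close>
  define X0 where "X0 s = {v \<in> V s. f s t v - m \<in> S t}" for s
  define X where "X s = {v \<in> X0 s. \<forall>r\<in>R. f s r v = 0}" for s
  have flatX0: "flat scale (X0 s)" for s unfolding X0_def by (rule flat_fibre[OF subS])
  have flatk: "flat scale {v. f s r v = 0}" for s r
    using flat_subspace[OF f.subspace_kernel] .
  \<comment> \<open>It is enough to meet one condition, or none: the conditions weaken as
    \<open>r\<close> increases, so their solution sets form a chain, and its least member satisfies
    all of them.\<close>
  have X0ne: "\<exists>v\<in>X0 s. \<forall>r\<in>P. f s r v = 0" if s: "s \<in> L" and P: "P = {} \<or> (\<exists>r\<in>R. P = {r})" for s P
  proof -
    have st: "s \<le> t" using s unfolding L_def by blast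
    obtain u y where u: "m = f s t u + y" "u \<in> V s" "y \<in> S t" using mM[OF s] unfolding M_def by blast
    then have um: "f s t u - m \<in> S t" using subspace_neg[OF subS] by simp
    show ?thesis
    proof (cases "P = {}")
      case True
      then show ?thesis using u um unfolding X0_def by blast
    next
      case False
      then obtain r where r: "P = {r}" "t \<le> r" "f t r m \<in> S r" using P unfolding R_def by blast
      have "f t r (f s t u - m) \<in> S r" using fS[OF r(2) um] .
      then have "f t r (f s t u) \<in> S r" using subspace_add[OF subS _ r(3)] by (force simp: f.diff)
      then have "f s r u \<in> S r" using f_comp[OF st r(2) u(2)] by simp
      \<comment> \<open>Purity provides \<open>u - \<sigma>\<close>, which is still a lift of
        \<open>m\<close> modulo \<open>S t\<close> and dies at \<open>r\<close>.\<close>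
      then obtain \<sigma> where \<sigma>: "\<sigma> \<in> S s" "f s r u = f s r \<sigma>" using pureD u(2) st r(2) by (meson order_trans)
      have "u - \<sigma> \<in> V s" using u(2) \<sigma>(1) SV subspace_diff[OF subspace_V] by blast
      moreover have "f s t (u - \<sigma>) - m = (f s t u - m) - f s t \<sigma>" by (simp add: f.diff)
      then have "f s t (u - \<sigma>) - m \<in> S t" using subspace_diff[OF subS um fS[OF st \<sigma>(1)]] by (simp only:)
      moreover have "f s r (u - \<sigma>) = 0" using \<sigma>(2) by (simp add: f.diff)
      ultimately show ?thesis using r(1) unfolding X0_def by blast
    qed
  qed
  have Xne: "X s \<noteq> {}" if s: "s \<in> L" for s
  proof -
    have st: "s \<le> t" using s unfolding L_def by blast
    let ?\<A> = "insert (X0 s) {{v \<in> X0 s. f s r v = 0} | r. r \<in> R}"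
    obtain A where A: "A \<in> ?\<A>" "\<And>B. B \<in> ?\<A> \<Longrightarrow> A \<subseteq> B"
    proof (rule flat_chain_least_V[of ?\<A> s])
      show "A \<subseteq> V s" if "A \<in> ?\<A>" for A using that unfolding X0_def by blast
      show "A \<noteq> {}" if "A \<in> ?\<A>" for A
        using that X0ne[OF s, of "{}"] X0ne[OF s, of "{r}" for r] by blast
      show "flat scale A" if "A \<in> ?\<A>" for A
        using that flatX0 flat_Int[OF flatX0 flatk] by (auto simp: Collect_conj_eq)
      have mono: "{v \<in> X0 s. f s r v = 0} \<subseteq> {v \<in> X0 s. f s r' v = 0}" if "r \<in> R" "r \<le> r'" for r r'
      proof
        fix v assume v: "v \<in> {v \<in> X0 s. f s r v = 0}"
        then have "v \<in> V s" unfolding X0_def by blast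
        moreover have "s \<le> r" using st that(1) unfolding R_def by auto
        ultimately have "f s r' v = f r r' (f s r v)" using f_comp that(2) by simp
        then show "v \<in> {v \<in> X0 s. f s r' v = 0}" using v f.zero by simp
      qed
      show "A \<subseteq> B \<or> B \<subseteq> A" if AB: "A \<in> ?\<A>" "B \<in> ?\<A>" for A B
      proof (cases "A = X0 s \<or> B = X0 s")
        case True
        then show ?thesis using AB by blast
      next
        case False
        then obtain r r' where "A = {v \<in> X0 s. f s r v = 0}" "r \<in> R" "B = {v \<in> X0 s. f s r' v = 0}" "r' \<in> R"
          using AB by blast
        then show ?thesis using mono[of r r'] mono[of r' r] linear[of r r'] by blast
      qed
    qed blast+
    have "A \<noteq> {}" using A(1) X0ne[OF s, of "{}"] X0ne[OF s, of "{r}" for r] by blast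
    moreover have "A \<subseteq> X0 s" using A(2) by blast
    moreover have "A \<subseteq> {v \<in> X0 s. f s r v = 0}" if "r \<in> R" for r by (rule A(2)) (use that in blast)
    ultimately have "A \<subseteq> X s" unfolding X_def by blast
    then show ?thesis using \<open>A \<noteq> {}\<close> by blast
  qed
  have flatX: "flat scale (X s)" for s
  proof -
    have "X s = X0 s \<inter> \<Inter>((\<lambda>r. {v. f s r v = 0}) ` R)" unfolding X_def by auto
    moreover have "flat scale (\<Inter>((\<lambda>r. {v. f s r v = 0}) ` R))"
      by (rule flat_Inter) (use flatk in auto)
    ultimately show ?thesis using flat_Int[OF flatX0] by metis
  qed
  obtain w0 where w0: "\<And>s. s \<in> L \<Longrightarrow> w0 s \<in> X s"
    "\<And>s s'. s \<in> L \<Longrightarrow> s' \<in> L \<Longrightarrow> s \<le> s' \<Longrightarrow> f s s' (w0 s) = w0 s'"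
  proof (rule flat_inverse_limit[of L X])
    show "X s \<subseteq> V s" for s unfolding X_def X0_def by blast
    show "f s s' x \<in> X s'" if "s \<in> L" "s' \<in> L" "s \<le> s'" "x \<in> X s" for s s' x
    proof -
      have x: "x \<in> V s" "f s t x - m \<in> S t" "\<forall>r\<in>R. f s r x = 0" using that(4) unfolding X_def X0_def by auto
      have "f s' t (f s s' x) = f s t x" using f_comp that x(1) unfolding L_def by simp
      moreover have "f s' r (f s s' x) = f s r x" if "r \<in> R" for r
      proof -
        have "s' \<le> r" using \<open>s' \<in> L\<close> that unfolding L_def R_def by auto
        then show ?thesis using f_comp \<open>s \<le> s'\<close> x(1) by simp
      qed
      ultimately show ?thesis using x f_in[OF that(3) x(1)] unfolding X_def X0_def by simp
    qed
  qed (use Xne flatX linear in auto)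
  have w0V: "w0 s \<in> V s" "f s t (w0 s) - m \<in> S t" "r \<in> R \<Longrightarrow> f s r (w0 s) = 0" if "s \<in> L" for s r
    using w0(1)[OF that] unfolding X_def X0_def by auto
  have wt: "w0 t \<in> V t" "w0 t - m \<in> S t" using w0V[OF \<open>t \<in> L\<close>] f_id by auto
  \<comment> \<open>Compatible lifts up to \<open>t\<close>, the transport of \<open>w0 t\<close>
    beyond \<open>t\<close>, and 0 at both ends: below \<open>L\<close>, and on \<open>R\<close>,
    where the transport vanishes by the choice of \<open>w0\<close>.\<close>
  define w where "w x = (if x \<in> L then w0 x else if t \<le> x \<and> x \<notin> R then f t x (w0 t) else 0)" for x
  have wL: "w s = w0 s" if "s \<in> L" for s using that unfolding w_def by simp
  have wU: "w x = f t x (w0 t)" if "t \<le> x" "x \<notin> R" for x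
  proof (cases "x \<in> L")
    case True
    then have "x = t" using that(1) unfolding L_def by simp
    then show ?thesis using wL[OF True] f_id wt(1) by simp
  next
    case False
    then show ?thesis using that unfolding w_def by simp
  qed
  have w_cases: "x \<in> L \<or> t \<le> x \<and> x \<notin> R" if "w x \<noteq> 0" for x using that unfolding w_def by presburger
  \<comment> \<open>The new values avoid the old span, not just 0; freeness and purity of the
    enlarged family both rest on this.\<close>
  have wS: "w x \<notin> S x" if "x \<in> L \<or> t \<le> x \<and> x \<notin> R" for x
  proof
    assume wx: "w x \<in> S x"
    show False
      using that
    proof
      assume x: "x \<in> L"
      then have "x \<le> t" unfolding L_def by blast
      then have "f x t (w0 x) \<in> S t" using fS wx wL[OF x] by simp
      then show False using w0V(2)[OF x] m(1) subspace_diff[OF subS] by force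
    next
      assume x: "t \<le> x \<and> x \<notin> R"
      then have "f t x (w0 t) - f t x m \<in> S x" using fS[of t x "w0 t - m"] wt by (simp add: f.diff)
      moreover have "f t x (w0 t) \<in> S x" using wx wU x by simp
      ultimately have "f t x m \<in> S x" using subspace_diff[OF subS] by force
      then show False using x unfolding R_def by blast
    qed
  qed
  have bar: "bar w"
  proof (rule barI)
    show "w x \<in> V x" for x
      unfolding w_def using w0V(1) f_in[OF _ wt(1)] subspace_0[OF subspace_V] by simp
    fix x y assume xy: "x \<le> y" and wx: "w x \<noteq> 0"
    show "f x y (w x) = w y"
    proof (cases "y \<le> t")
      case True
      then have "x \<in> L" using w_cases[OF wx] \<open>t \<in> L\<close> xy by (metis order.trans order_antisym)
      then show ?thesis using Lup[OF _ xy True] w0(2)[OF _ _ xy] wL by simp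
    next
      case False
      then have ty: "t \<le> y" "y \<notin> L" unfolding L_def by auto
      have "f x y (w x) = f t y (w0 t)"
      proof (cases "x \<in> L")
        case True
        then have "x \<le> t" unfolding L_def by blast
        then show ?thesis
          using f_comp[OF _ ty(1) w0V(1)[OF True]] w0(2)[OF True \<open>t \<in> L\<close>] wL[OF True] by metis
      next
        case False
        then have "t \<le> x" "x \<notin> R" using w_cases[OF wx] by auto
        then show ?thesis using f_comp[OF _ xy wt(1)] wU by simp
      qed
      also have "\<dots> = w y"
      proof (cases "y \<in> R")
        case True
        then show ?thesis using w0V(3)[OF \<open>t \<in> L\<close> True] ty unfolding w_def by simp
      next
        case False
        then show ?thesis using wU ty by simp
      qed
      finally show ?thesis .
    qed
  qed
  have "pure (insert w \<Omega>)"
    unfolding pure_def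
  proof (intro allI impI)
    fix x y u assume xy: "x \<le> y" and u: "u \<in> V x" and fu: "f x y u \<in> spanned (insert w \<Omega>) y"
    have Sx: "S x \<subseteq> spanned (insert w \<Omega>) x" unfolding S_def by (rule spanned_mono) blast
    have wx: "w x \<in> spanned (insert w \<Omega>) x" by (rule spanned_base) blast
    obtain c where c: "f x y u - c *s w y \<in> S y"
      using fu span_breakdown_eq unfolding spanned_def S_def by auto
    show "\<exists>\<sigma>\<in>spanned (insert w \<Omega>) x. f x y u = f x y \<sigma>"
    proof (cases "w x = 0")
      case False
      have "f x y (u - c *s w x) = f x y u - c *s w y"
        using barD(2)[OF bar xy False] by (simp add: f.diff f.scale)
      moreover have wxV: "c *s w x \<in> V x" using barD(1)[OF bar] subspace_scale[OF subspace_V] by blast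
      ultimately obtain \<sigma> where \<sigma>: "\<sigma> \<in> S x" "f x y (u - c *s w x) = f x y \<sigma>"
        using pureD[OF xy subspace_diff[OF subspace_V u wxV]] c by auto
      then have "f x y u = f x y (\<sigma> + c *s w x)" by (simp add: f.diff f.add algebra_simps)
      moreover have "\<sigma> + c *s w x \<in> spanned (insert w \<Omega>) x"
        using \<sigma>(1) Sx wx subspace_add[OF subspace_spanned] subspace_scale[OF subspace_spanned] by blast
      ultimately show ?thesis by blast
    next
      case True
      \<comment> \<open>The aim is that \<open>c *s w y\<close> vanishes. If
        \<open>w y \<noteq> 0\<close>, then \<open>x\<close> lies below \<open>L\<close>, so
        \<open>u\<close> is carried into \<open>S t\<close>. Comparison at \<open>t\<close>, or at
        \<open>y\<close> if \<open>y\<close> is beyond \<open>t\<close>, puts a multiple of a value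
        of \<open>w\<close> by \<open>c\<close> into the old span, and \<open>wS\<close> forces
        \<open>c = 0\<close>.\<close>
      have "f x y u \<in> S y"
      proof (cases "w y = 0")
        case True
        then show ?thesis using c by simp
      next
        case wy: False
        have nx: "\<not> (x \<in> L \<or> t \<le> x \<and> x \<notin> R)" using wS True subspace_0[OF subS] by metis
        have "\<not> t \<le> x"
        proof
          assume tx: "t \<le> x"
          then have "x \<in> R" using nx by blast
          then have "y \<in> R" using Rup xy by blast
          moreover from this have "y \<in> L" using w_cases[OF wy] by blast
          ultimately show False using tR tx xy unfolding L_def R_def by (metis (mono_tags, lifting) mem_Collect_eq order_antisym order_trans)
        qed
        then have xt: "x \<le> t" "x \<notin> L" using nx by auto
        then have fxt: "f x t u \<in> S t" using u unfolding L_def by blast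
        have "c = 0"
        proof (cases "y \<le> t")
          case True
          then have y: "y \<in> L" using w_cases[OF wy] \<open>t \<in> L\<close> by force
          have "f y t (f x y u - c *s w y) \<in> S t" by (rule fS[OF True c])
          then have "f x t u - c *s f y t (w y) \<in> S t"
            using f_comp[OF xy True u] by (simp add: f.diff f.scale)
          then have "f x t u - (f x t u - c *s f y t (w y)) \<in> S t" by (rule subspace_diff[OF subS fxt])
          then have cS: "c *s f y t (w y) \<in> S t" by simp
          show "c = 0"
          proof (rule ccontr)
            assume "c \<noteq> 0"
            then have "f y t (w y) \<in> S t" using subspace_scale[OF subS cS, of "inverse c"] by simp
            moreover have "f y t (w y) = w t" using barD(2)[OF bar True wy] .
            ultimately show False using wS \<open>t \<in> L\<close> by simp
          qed
        next
          case False
          then have ty: "t \<le> y" by simp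
          then have "f x y u \<in> S y" using fS[OF ty fxt] f_comp[OF xt(1) ty u] by simp
          then have "f x y u - (f x y u - c *s w y) \<in> S y" using c subspace_diff[OF subS] by blast
          then have cS: "c *s w y \<in> S y" by simp
          show "c = 0"
          proof (rule ccontr)
            assume "c \<noteq> 0"
            then have "w y \<in> S y" using subspace_scale[OF subS cS, of "inverse c"] by simp
            then show False using wS w_cases[OF wy] by blast
          qed
        qed
        then show ?thesis using c by simp
      qed
      then show ?thesis using pureD[OF xy u] Sx by blast
    qed
  qed
  moreover have wnS: "w x \<notin> spanned \<Omega> x" if "w x \<noteq> 0" for x
    using wS w_cases[OF that] unfolding S_def by blast
  then have "free (insert w \<Omega>)" using free_insert[OF \<open>free \<Omega>\<close>] by blast
  moreover have "w \<notin> \<Omega>"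
  proof
    assume "w \<in> \<Omega>"
    then have "w t \<in> S t" unfolding S_def by (rule spanned_base)
    then show False using wS \<open>t \<in> L\<close> by blast
  qed
  ultimately show thesis using that bar by blast
qed

text \<open>Starting from \<open>\<Omega>0\<close> keeps a prescribed pure family among the
  summands; this is how a basis chosen at the corner enters the decomposition of an edge.\<close>

theorem bar_decomposition:
  assumes "\<And>w. w \<in> \<Omega>0 \<Longrightarrow> bar w" "free \<Omega>0" "pure \<Omega>0"
  obtains \<Omega> where "\<Omega>0 \<subseteq> \<Omega>" "\<And>w. w \<in> \<Omega> \<Longrightarrow> bar w" "free \<Omega>" "\<And>x. spanned \<Omega> x = V x"
proof -
  define \<O> where "\<O> = {\<Omega>. \<Omega>0 \<subseteq> \<Omega> \<and> (\<forall>w\<in>\<Omega>. bar w) \<and> free \<Omega> \<and> pure \<Omega>}"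
  have "\<exists>\<Omega>\<in>\<O>. \<forall>\<Omega>'\<in>\<O>. \<Omega> \<subseteq> \<Omega>' \<longrightarrow> \<Omega>' = \<Omega>"
  proof (rule subset_Zorn_nonempty)
    show "\<O> \<noteq> {}" using assms unfolding \<O>_def by blast
    fix \<C> assume C: "\<C> \<noteq> {}" "subset.chain \<O> \<C>"
    have chain: "\<Omega> \<subseteq> \<Omega>' \<or> \<Omega>' \<subseteq> \<Omega>" if "\<Omega> \<in> \<C>" "\<Omega>' \<in> \<C>" for \<Omega> \<Omega>'
      using C(2) that unfolding subset.chain_def by blast
    have sub: "\<C> \<subseteq> \<O>" using C(2) unfolding subset.chain_def by blast
    have "free (\<Union>\<C>)" using sub unfolding \<O>_def by (intro free_Union chain) blast+
    moreover have "pure (\<Union>\<C>)" using sub unfolding \<O>_def by (intro pure_Union chain C(1)) blast+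
    moreover have "\<Omega>0 \<subseteq> \<Union>\<C>" "\<forall>w\<in>\<Union>\<C>. bar w" using sub C(1) unfolding \<O>_def by blast+
    ultimately show "\<Union>\<C> \<in> \<O>" unfolding \<O>_def by blast
  qed
  then obtain \<Omega> where \<Omega>: "\<Omega> \<in> \<O>" "\<And>\<Omega>'. \<Omega>' \<in> \<O> \<Longrightarrow> \<Omega> \<subseteq> \<Omega>' \<Longrightarrow> \<Omega>' = \<Omega>" by blast
  have "spanned \<Omega> t = V t" for t
  proof (rule ccontr)
    assume "spanned \<Omega> t \<noteq> V t"
    then obtain w where w: "w \<notin> \<Omega>" "bar w" "free (insert w \<Omega>)" "pure (insert w \<Omega>)"
      using extend_pure_free[of \<Omega> t] \<Omega>(1) unfolding \<O>_def by blast
    then have "insert w \<Omega> \<in> \<O>" using \<Omega>(1) unfolding \<O>_def by blast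
    then show False using \<Omega>(2) w(1) by blast
  qed
  then show thesis using that \<Omega>(1) unfolding \<O>_def by blast
qed

end

section \<open>Bases adapted to flags\<close>

context vector_space
begin

text \<open>A basis adapted to two flags is built greedily: the next vector is taken from the smallest member \<open>P\<close>
  of the first flag not yet spanned, and there from the smallest member \<open>Q\<close> of the second flag such that
  \<open>P \<inter> Q\<close> is not yet spanned. The last condition in \<open>adapted\<close> keeps this process going.\<close>

lemma adapted_basis_of_two_flags:
  assumes E: "finite E" "U \<subseteq> span E" and U: "subspace U"
    and \<P>: "\<And>P. P \<in> \<P> \<Longrightarrow> subspace P" "\<And>P. P \<in> \<P> \<Longrightarrow> P \<subseteq> U"
      "\<And>P P'. P \<in> \<P> \<Longrightarrow> P' \<in> \<P> \<Longrightarrow> P \<subseteq> P' \<or> P' \<subseteq> P"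
    and \<Q>: "\<And>Q. Q \<in> \<Q> \<Longrightarrow> subspace Q" "\<And>Q. Q \<in> \<Q> \<Longrightarrow> Q \<subseteq> U"
      "\<And>Q Q'. Q \<in> \<Q> \<Longrightarrow> Q' \<in> \<Q> \<Longrightarrow> Q \<subseteq> Q' \<or> Q' \<subseteq> Q"
  obtains \<beta> where "independent \<beta>" "span \<beta> = U"
    "\<And>P. P \<in> \<P> \<Longrightarrow> P \<subseteq> span (\<beta> \<inter> P)" "\<And>Q. Q \<in> \<Q> \<Longrightarrow> Q \<subseteq> span (\<beta> \<inter> Q)"
proof -
  \<comment> \<open>With \<open>U\<close> in both flags, the greedy choice finds a member in each of
    them as long as the span is proper.\<close>
  let ?\<P> = "insert U \<P>" and ?\<Q> = "insert U \<Q>"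
  \<comment> \<open>With \<open>S = span \<beta>\<close>, the last clause is
    \<open>(P + Q) \<inter> S = P \<inter> S + Q \<inter> S\<close>. Equivalently, modulo
    \<open>S\<close> the images of \<open>P\<close> and \<open>Q\<close> meet only in the image of
    \<open>P \<inter> Q\<close>.\<close>
  define adapted where "adapted \<beta> \<longleftrightarrow> \<beta> \<subseteq> U \<and> independent \<beta> \<and>
      (\<forall>P\<in>?\<P>. span \<beta> \<inter> P \<subseteq> span (\<beta> \<inter> P)) \<and> (\<forall>Q\<in>?\<Q>. span \<beta> \<inter> Q \<subseteq> span (\<beta> \<inter> Q)) \<and>
      (\<forall>P\<in>?\<P>. \<forall>Q\<in>?\<Q>. \<forall>p\<in>P. \<forall>q\<in>Q. p + q \<in> span \<beta> \<longrightarrow>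
        (\<exists>p'\<in>P \<inter> span \<beta>. \<exists>q'\<in>Q \<inter> span \<beta>. p + q = p' + q'))" for \<beta>
  have subP: "subspace P" "P \<subseteq> U" if "P \<in> ?\<P>" for P using that U \<P> by auto
  have subQ: "subspace Q" "Q \<subseteq> U" if "Q \<in> ?\<Q>" for Q using that U \<Q> by auto
  have flP: "A \<subseteq> span E" "A \<noteq> {}" "flat scale A" if "A \<in> ?\<P>" for A
    using subP[OF that] E(2) flat_subspace subspace_0 by auto
  have flQ: "A \<subseteq> span E" "A \<noteq> {}" "flat scale A" if "A \<in> ?\<Q>" for A
    using subQ[OF that] E(2) flat_subspace subspace_0 by auto
  have bound: "finite \<beta> \<and> card \<beta> \<le> card E" if "adapted \<beta>" for \<beta>
    using that E(2) unfolding adapted_def by (intro independent_span_bound[OF E(1)]) auto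
  have "adapted {}"
    unfolding adapted_def using subP(1) subQ(1) subspace_0 by (auto simp: independent_empty)
  then have "\<exists>\<beta>. adapted \<beta> \<and> (\<forall>\<gamma>. adapted \<gamma> \<longrightarrow> card \<gamma> \<le> card \<beta>)"
    using bound by (intro ex_has_greatest_nat[where b = "Suc (card E)"]) (auto simp: less_Suc_eq_le)
  then obtain \<beta> where \<beta>: "adapted \<beta>" "\<And>\<gamma>. adapted \<gamma> \<Longrightarrow> card \<gamma> \<le> card \<beta>" by blast
  define S where "S = span \<beta>"
  have subS: "subspace S" unfolding S_def by simp
  note ad0 = \<beta>(1)[unfolded adapted_def, folded S_def]
  note ad = conjunct1[OF ad0] conjunct1[OF conjunct2[OF ad0]]
    conjunct1[OF conjunct2[OF conjunct2[OF ad0]], rule_format]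
    conjunct1[OF conjunct2[OF conjunct2[OF conjunct2[OF ad0]]], rule_format]
    conjunct2[OF conjunct2[OF conjunct2[OF conjunct2[OF ad0]]], rule_format]
  have "S = U"
  proof (rule ccontr)
    assume "S \<noteq> U"
    moreover have "S \<subseteq> U" unfolding S_def using ad(1) U by (rule span_minimal)
    ultimately have "\<not> U \<subseteq> S" by blast
    obtain P where P: "P \<in> {P \<in> ?\<P>. \<not> P \<subseteq> S}" "\<And>P'. P' \<in> {P \<in> ?\<P>. \<not> P \<subseteq> S} \<Longrightarrow> P \<subseteq> P'"
    proof (rule flat_chain_least[of "{P \<in> ?\<P>. \<not> P \<subseteq> S}", OF _ E(1)])
      show "{P \<in> ?\<P>. \<not> P \<subseteq> S} \<noteq> {}" using \<open>\<not> U \<subseteq> S\<close> by blast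
      show "A \<subseteq> B \<or> B \<subseteq> A" if "A \<in> {P \<in> ?\<P>. \<not> P \<subseteq> S}" "B \<in> {P \<in> ?\<P>. \<not> P \<subseteq> S}" for A B
        using that \<P>(2,3) by blast
    qed (use flP in auto)
    obtain Q where Q: "Q \<in> {Q \<in> ?\<Q>. \<not> P \<inter> Q \<subseteq> S}" "\<And>Q'. Q' \<in> {Q \<in> ?\<Q>. \<not> P \<inter> Q \<subseteq> S} \<Longrightarrow> Q \<subseteq> Q'"
    proof (rule flat_chain_least[of "{Q \<in> ?\<Q>. \<not> P \<inter> Q \<subseteq> S}", OF _ E(1)])
      have "P \<inter> U = P" using P(1) subP(2) by blast
      then show "{Q \<in> ?\<Q>. \<not> P \<inter> Q \<subseteq> S} \<noteq> {}" using P(1) by blast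
      show "A \<subseteq> B \<or> B \<subseteq> A"
        if "A \<in> {Q \<in> ?\<Q>. \<not> P \<inter> Q \<subseteq> S}" "B \<in> {Q \<in> ?\<Q>. \<not> P \<inter> Q \<subseteq> S}" for A B
        using that \<Q>(2,3) by blast
    qed (use flQ in auto)
    obtain v where v: "v \<in> P" "v \<in> Q" "v \<notin> S" using Q(1) by blast
    have PQ: "P \<in> ?\<P>" "Q \<in> ?\<Q>" using P(1) Q(1) by auto
    define T where "T = span (insert v \<beta>)"
    have ST: "S \<subseteq> T" unfolding S_def T_def by (rule span_mono) blast
    have vT: "v \<in> T" unfolding T_def by (rule span_base) blast
    have subT: "subspace T" unfolding T_def by simp
    have T: "\<exists>c. x - c *s v \<in> S" if "x \<in> T" for x
      using that unfolding T_def S_def by (simp add: span_breakdown_eq)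
    \<comment> \<open>For both flags it suffices that a member which \<open>T\<close> meets outside
      \<open>S\<close> contains \<open>v\<close>.\<close>
    have lift: "x \<in> span (insert v \<beta> \<inter> W)"
      if W: "subspace W" "S \<inter> W \<subseteq> span (\<beta> \<inter> W)" "x \<in> T" "x \<in> W" "x \<notin> S \<Longrightarrow> v \<in> W" for x W
    proof -
      have mono: "span (\<beta> \<inter> W) \<subseteq> span (insert v \<beta> \<inter> W)" by (rule span_mono) blast
      show ?thesis
      proof (cases "x \<in> S")
        case True
        then show ?thesis using W(2,4) mono by blast
      next
        case False
        obtain c where c: "x - c *s v \<in> S" using T[OF W(3)] by blast
        have "v \<in> W" using W(5) False by blast
        then have "x - c *s v \<in> span (insert v \<beta> \<inter> W)"
          using c W mono subspace_diff subspace_scale by blast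
        moreover have "c *s v \<in> span (insert v \<beta> \<inter> W)"
          using \<open>v \<in> W\<close> by (intro span_scale span_base) blast
        ultimately have "(x - c *s v) + c *s v \<in> span (insert v \<beta> \<inter> W)" by (rule span_add)
        then show ?thesis by simp
      qed
    qed
    have vP: "v \<in> P'" if "P' \<in> ?\<P>" "\<not> P' \<subseteq> S" for P' using P(2) that v(1) by blast
    have "adapted (insert v \<beta>)"
      unfolding adapted_def T_def[symmetric]
    proof (intro conjI ballI subsetI impI)
      show "x \<in> U" if "x \<in> insert v \<beta>" for x using that ad(1) v(1) subP(2)[OF PQ(1)] by blast
      show "independent (insert v \<beta>)" using ad(2) v(3) unfolding S_def by (intro independent_insertI)
    next
      fix P' x assume P': "P' \<in> ?\<P>" and x: "x \<in> T \<inter> P'"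
      show "x \<in> span (insert v \<beta> \<inter> P')"
        using x vP[OF P'] by (intro lift subP(1)[OF P'] ad(3)[OF P']) auto
    next
      fix Q' x assume Q': "Q' \<in> ?\<Q>" and x: "x \<in> T \<inter> Q'"
      have "v \<in> Q'" if xS: "x \<notin> S"
      proof (cases "P \<inter> Q' \<subseteq> S")
        case False
        then show ?thesis using Q(2)[of Q'] Q' v(2) by blast
      next
        case True
        \<comment> \<open>If \<open>P \<inter> Q'\<close> is already spanned, the last clause of
          \<open>adapted\<close> splits \<open>x - c *s v\<close> into parts \<open>p\<close> and
          \<open>q\<close> in \<open>S\<close>. Then \<open>x - q\<close> lies in
          \<open>P \<inter> Q'\<close>, so \<open>x\<close> lies in \<open>S\<close> after
          all.\<close>
        obtain c where c: "x - c *s v \<in> S" using T x by blast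
        have cv: "c *s v \<in> P" using v(1) subspace_scale subP(1)[OF PQ(1)] by blast
        then have "- (c *s v) \<in> P" using subspace_neg subP(1)[OF PQ(1)] by blast
        then obtain p q where pq: "p \<in> P" "p \<in> S" "q \<in> Q'" "q \<in> S" "- (c *s v) + x = p + q"
          using ad(5)[OF PQ(1) Q', of "- (c *s v)" x] x c by auto
        have "x - q = p + c *s v" using pq(5) by (simp add: algebra_simps)
        moreover have "x - q \<in> Q'" using x pq(3) subspace_diff subQ(1)[OF Q'] by blast
        moreover have "p + c *s v \<in> P" using pq(1) cv subspace_add subP(1)[OF PQ(1)] by blast
        ultimately have "x - q \<in> S" using True by auto
        then have "(x - q) + q \<in> S" using pq(4) by (rule subspace_add[OF subS])
        then show ?thesis using xS by simp
      qed
      then show "x \<in> span (insert v \<beta> \<inter> Q')"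
        using x by (intro lift subQ(1)[OF Q'] ad(4)[OF Q']) auto
    next
      fix P' Q' p q assume P': "P' \<in> ?\<P>" and Q': "Q' \<in> ?\<Q>" and pq: "p \<in> P'" "q \<in> Q'" "p + q \<in> T"
      show "\<exists>p'\<in>P' \<inter> T. \<exists>q'\<in>Q' \<inter> T. p + q = p' + q'"
      proof (cases "P' \<subseteq> S")
        case True
        then have "p \<in> T" using pq(1) ST by blast
        then have "(p + q) - p \<in> T" using pq(3) subspace_diff[OF subT] by blast
        then show ?thesis using pq \<open>p \<in> T\<close> by auto
      next
        case False
        \<comment> \<open>As \<open>v\<close> lies in \<open>P'\<close>, the multiple of
          \<open>v\<close> in \<open>p + q\<close> can be absorbed by \<open>p\<close>, which
          reduces the claim to the one for \<open>S\<close>.\<close>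
        then have vP': "v \<in> P'" using vP P' by blast
        obtain c where c: "p + q - c *s v \<in> S" using T pq(3) by blast
        have cvP: "c *s v \<in> P'" using vP' subspace_scale subP(1)[OF P'] by blast
        then have "p - c *s v \<in> P'" using pq(1) subspace_diff subP(1)[OF P'] by blast
        moreover have eq: "(p - c *s v) + q = p + q - c *s v" by (simp add: algebra_simps)
        ultimately obtain p' q' where *: "p' \<in> P'" "p' \<in> S" "q' \<in> Q'" "q' \<in> S" "p + q - c *s v = p' + q'"
          using ad(5)[OF P' Q' _ pq(2), of "p - c *s v", unfolded eq, OF _ c] by blast
        have "p' + c *s v \<in> P'" using *(1) cvP subspace_add subP(1)[OF P'] by blast
        moreover have "p' + c *s v \<in> T"
          using *(2) ST vT subspace_add[OF subT] subspace_scale[OF subT] by blast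
        moreover have "p + q = (p' + c *s v) + q'" using *(5) by (simp add: algebra_simps)
        ultimately show ?thesis using *(3,4) ST by blast
      qed
    qed
    then have "card (insert v \<beta>) \<le> card \<beta>" by (rule \<beta>(2))
    moreover have "v \<notin> \<beta>" using v(3) span_base unfolding S_def by blast
    ultimately show False using bound[OF \<beta>(1)] by simp
  qed
  show thesis
  proof
    show "independent \<beta>" by (rule ad(2))
    show "span \<beta> = U" using \<open>S = U\<close> unfolding S_def .
    show "P \<subseteq> span (\<beta> \<inter> P)" if "P \<in> \<P>" for P using ad(3)[of P] \<P>(2)[OF that] that \<open>S = U\<close> by blast
    show "Q \<subseteq> span (\<beta> \<inter> Q)" if "Q \<in> \<Q>" for Q using ad(4)[of Q] \<Q>(2)[OF that] that \<open>S = U\<close> by blast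
  qed
qed

end

section \<open>Pushouts and pullbacks of vector spaces\<close>

lemma vector_space_field: "vector_space ((*) :: 'k::field \<Rightarrow> 'k \<Rightarrow> 'k)"
  by unfold_locales (auto simp: algebra_simps)

context
  fixes s :: "'k::field \<Rightarrow> 'v::ab_group_add \<Rightarrow> 'v" and A B C D :: "'v set" and f g h k :: "'v \<Rightarrow> 'v"
  assumes vs: "vector_space s"
    and sub: "module.subspace s A" "module.subspace s B" "module.subspace s C" "module.subspace s D"
begin

interpretation vs: vector_space s by (rule vs)

lemma vec_hom_image_subspace:
  assumes "module.subspace s U" "vec_hom s U s W j"
  shows "module.subspace s (j ` U)"
proof -
  obtain g where g: "Vector_Spaces.linear s s g" "\<forall>u\<in>U. g u = j u"
    using vs.linear_subspace_extension[OF assms] by blast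
  interpret g: Vector_Spaces.linear s s g by fact
  have "j ` U = g ` U" using g(2) by (auto simp: image_iff)
  then show ?thesis using g.subspace_image[OF assms(1)] by simp
qed

text \<open>Otherwise a functional that vanishes on both images but not at \<open>d\<close> would be
  a second mediating map to the field, next to 0.\<close>

lemma pushout_square_surj:
  assumes po: "pushout_square s s A B C D f g h k" and d: "d \<in> D"
  obtains b c where "b \<in> B" "c \<in> C" "d = h b + k c"
proof -
  have hk: "vec_hom s B s D h" "vec_hom s C s D k"
    using po unfolding pushout_square_def commutative_square_def by auto
  define E where "E = {x + y | x y. x \<in> h ` B \<and> y \<in> k ` C}"
  have subE: "vs.subspace E"
    unfolding E_def using hk sub by (intro vs.subspace_sums vec_hom_image_subspace)
  have z: "0 \<in> h ` B" "0 \<in> k ` C"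
    using hk sub by (auto intro!: vs.subspace_0 vec_hom_image_subspace)
  have Eh: "h b \<in> E" if "b \<in> B" for b
    unfolding E_def using that z(2) by (intro CollectI exI[of _ "h b"] exI[of _ 0]) simp
  have Ek: "k c \<in> E" if "c \<in> C" for c
    unfolding E_def using that z(1) by (intro CollectI exI[of _ 0] exI[of _ "k c"]) simp
  have "d \<in> E"
  proof (rule ccontr)
    assume "d \<notin> E"
    then obtain \<psi> where \<psi>: "Vector_Spaces.linear s (*) \<psi>" "\<forall>e\<in>E. \<psi> e = 0" "\<psi> d = (1::'k)"
      using ex_linear_functional[OF vs subE] by blast
    interpret \<psi>: Vector_Spaces.linear s "(*)" \<psi> by fact
    have po': "pushout_square s (*) A B C D f g h k"
      by (rule pushout_square_universal[OF vs vector_space_field sub po])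
    have hom: "vec_hom s X (*) UNIV (\<lambda>_. 0)" "vec_hom s X (*) UNIV \<psi>" for X
      by (auto simp: vec_hom_def \<psi>.add \<psi>.scale)
    have "\<psi> (h b) = 0" if "b \<in> B" for b using \<psi>(2) Eh[OF that] by blast
    moreover have "\<psi> (k c) = 0" if "c \<in> C" for c using \<psi>(2) Ek[OF that] by blast
    moreover obtain \<delta> where \<delta>: "\<And>\<delta>'. vec_hom s D (*) UNIV \<delta>' \<and> (\<forall>b\<in>B. \<delta>' (h b) = 0) \<and>
        (\<forall>c\<in>C. \<delta>' (k c) = 0) \<Longrightarrow> \<forall>d\<in>D. \<delta>' d = \<delta> d"
      using po'[unfolded pushout_square_def, THEN conjunct2, rule_format,
          of UNIV "\<lambda>_. 0" "\<lambda>_. 0"] hom by auto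
    ultimately have "\<forall>d\<in>D. \<psi> d = \<delta> d" using hom(2) by (intro \<delta>) blast
    moreover have "\<forall>d\<in>D. 0 = \<delta> d" using hom(1) by (intro \<delta>) blast
    ultimately have "\<psi> d = 0" using d by metis
    then show False using \<psi>(3) by simp
  qed
  then show thesis using that unfolding E_def by blast
qed

text \<open>A functional on pairs that vanishes on the image \<open>R\<close> of \<open>A\<close> is
  a compatible pair of maps to the field. It factors through \<open>D\<close>, so it also vanishes
  at a pair with \<open>h b + k c = 0\<close>; hence such a pair lies in \<open>R\<close>.\<close>

lemma pushout_square_exact:
  assumes po: "pushout_square s s A B C D f g h k" and bc: "b \<in> B" "c \<in> C" "h b + k c = 0"
  obtains a where "a \<in> A" "b = f a" "c = - g a"
proof -
  have f: "vec_hom s A s B f" and g: "vec_hom s A s C g" and h: "vec_hom s B s D h"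
    and k: "vec_hom s C s D k"
    using po unfolding pushout_square_def commutative_square_def by auto
  define s2 where "s2 = (\<lambda>r (p::'v \<times> 'v). (s r (fst p), s r (snd p)))"
  have vs2: "vector_space s2"
    by unfold_locales (auto simp: s2_def vs.scale_left_distrib vs.scale_right_distrib)
  interpret vs2: vector_space s2 by fact
  define R where "R = (\<lambda>a. (f a, - g a)) ` A"
  have subR: "vs2.subspace R"
  proof (rule vs2.subspaceI)
    show "0 \<in> R"
      unfolding R_def using vs.subspace_0[OF sub(1)] vec_hom_0[OF f] vec_hom_0[OF g]
      by (intro image_eqI[of _ _ 0]) (simp_all add: zero_prod_def)
  next
    fix x y assume "x \<in> R" "y \<in> R"
    then obtain a a' where *: "x = (f a, - g a)" "y = (f a', - g a')" "a \<in> A" "a' \<in> A"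
      unfolding R_def by blast
    then have "x + y = (f (a + a'), - g (a + a'))" using f g unfolding vec_hom_def by simp
    then show "x + y \<in> R" unfolding R_def using vs.subspace_add[OF sub(1) *(3,4)] by blast
  next
    fix r x assume "x \<in> R"
    then obtain a where *: "x = (f a, - g a)" "a \<in> A" unfolding R_def by blast
    then have "s2 r x = (f (s r a), - g (s r a))" using f g unfolding vec_hom_def s2_def by simp
    then show "s2 r x \<in> R" unfolding R_def using vs.subspace_scale[OF sub(1) *(2)] by blast
  qed
  have "(b, c) \<in> R"
  proof (rule ccontr)
    assume "(b, c) \<notin> R"
    then obtain \<psi> where \<psi>: "Vector_Spaces.linear s2 (*) \<psi>" "\<forall>e\<in>R. \<psi> e = 0" "\<psi> (b, c) = (1::'k)"
      using ex_linear_functional[OF vs2 subR] by blast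
    interpret \<psi>: Vector_Spaces.linear s2 "(*)" \<psi> by fact
    have split: "\<psi> (x, y) = \<psi> (x, 0) + \<psi> (0, y)" for x y
      using \<psi>.add[of "(x, 0)" "(0, y)"] by simp
    have ng: "\<psi> (0, - x) = - \<psi> (0, x)" for x
      using \<psi>.neg[of "(0, x)"] by simp
    have "\<psi> (f a, 0) = \<psi> (0, g a)" if "a \<in> A" for a
      using \<psi>(2) that split[of "f a" "- g a"] ng unfolding R_def by force
    moreover have "\<psi> (x + y, 0) = \<psi> (x, 0) + \<psi> (y, 0)" "\<psi> (0, x + y) = \<psi> (0, x) + \<psi> (0, y)"
      "\<psi> (s r x, 0) = r * \<psi> (x, 0)" "\<psi> (0, s r x) = r * \<psi> (0, x)" for x y r
      using \<psi>.add[of "(x, 0)" "(y, 0)"] \<psi>.add[of "(0, x)" "(0, y)"]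
        \<psi>.scale[of r "(x, 0)"] \<psi>.scale[of r "(0, x)"] by (simp_all add: s2_def)
    then have "vec_hom s B (*) UNIV (\<lambda>x. \<psi> (x, 0))" "vec_hom s C (*) UNIV (\<lambda>x. \<psi> (0, x))"
      by (auto simp: vec_hom_def)
    moreover have po': "pushout_square s (*) A B C D f g h k"
      by (rule pushout_square_universal[OF vs vector_space_field sub po])
    ultimately obtain \<delta> where \<delta>: "vec_hom s D (*) UNIV \<delta>" "\<forall>b\<in>B. \<delta> (h b) = \<psi> (b, 0)"
        "\<forall>c\<in>C. \<delta> (k c) = \<psi> (0, c)"
      using po'[unfolded pushout_square_def, THEN conjunct2, rule_format,
          of UNIV "\<lambda>x. \<psi> (x, 0)" "\<lambda>x. \<psi> (0, x)"] by auto
    have "h b \<in> D" "k c \<in> D" using h k bc unfolding vec_hom_def by auto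
    then have "\<delta> (h b + k c) = \<delta> (h b) + \<delta> (k c)" using \<delta>(1) unfolding vec_hom_def by blast
    also have "\<dots> = \<psi> (b, c)" using \<delta>(2,3) bc split[of b c] by simp
    finally show False using bc(3) vec_hom_0[OF \<delta>(1) vs.subspace_0[OF sub(4)]] \<psi>(3) by simp
  qed
  then show thesis using that unfolding R_def by blast
qed

text \<open>The field serves as test object: the maps \<open>r \<mapsto> s r b\<close> and
  \<open>r \<mapsto> s r c\<close> are compatible, and the mediating map is evaluated at 1.\<close>

lemma pullback_square_ex:
  assumes pb: "pullback_square s s A B C D f g h k" and bc: "b \<in> B" "c \<in> C" "h b = k c"
  obtains a where "a \<in> A" "f a = b" "g a = c"
proof -
  have h: "vec_hom s B s D h" and k: "vec_hom s C s D k"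
    using pb unfolding pullback_square_def commutative_square_def by auto
  have pb': "pullback_square s (*) A B C D f g h k"
    by (rule pullback_square_universal[OF vs vector_space_field sub pb])
  have "vec_hom (*) UNIV s B (\<lambda>r. s r b)" "vec_hom (*) UNIV s C (\<lambda>r. s r c)"
    using bc vs.subspace_scale[OF sub(2)] vs.subspace_scale[OF sub(3)]
    by (auto simp: vec_hom_def vs.scale_left_distrib)
  moreover have "h (s r b) = k (s r c)" for r using h k bc unfolding vec_hom_def by simp
  ultimately obtain \<delta> where "vec_hom (*) UNIV s A \<delta>" "\<forall>r. f (\<delta> r) = s r b" "\<forall>r. g (\<delta> r) = s r c"
    using pb'[unfolded pullback_square_def, THEN conjunct2, rule_format,
        of UNIV "\<lambda>r. s r b" "\<lambda>r. s r c"] by auto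
  then show thesis using that[of "\<delta> 1"] unfolding vec_hom_def by simp
qed

text \<open>Both \<open>r \<mapsto> s r a\<close> and 0 are mediating maps for the zero
  pair.\<close>

lemma pullback_square_inj:
  assumes pb: "pullback_square s s A B C D f g h k" and a: "a \<in> A" "f a = 0" "g a = 0"
  shows "a = 0"
proof -
  have f: "vec_hom s A s B f" and g: "vec_hom s A s C g"
    and h: "vec_hom s B s D h" and k: "vec_hom s C s D k"
    using pb unfolding pullback_square_def commutative_square_def by auto
  have pb': "pullback_square s (*) A B C D f g h k"
    by (rule pullback_square_universal[OF vs vector_space_field sub pb])
  have hom: "vec_hom (*) UNIV s B (\<lambda>_. 0)" "vec_hom (*) UNIV s C (\<lambda>_. 0)" "vec_hom (*) UNIV s A (\<lambda>_. 0)"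
    "vec_hom (*) UNIV s A (\<lambda>r. s r a)"
    using a(1) vs.subspace_0 sub vs.subspace_scale[OF sub(1)]
    by (auto simp: vec_hom_def vs.scale_left_distrib)
  have "f 0 = 0" "g 0 = 0" "h 0 = 0" "k 0 = 0"
    using vec_hom_0[OF f] vec_hom_0[OF g] vec_hom_0[OF h] vec_hom_0[OF k] vs.subspace_0 sub by auto
  moreover have "f (s r a) = 0" "g (s r a) = 0" for r using f g a unfolding vec_hom_def by auto
  moreover obtain \<delta> where \<delta>: "\<And>\<delta>'. vec_hom (*) UNIV s A \<delta>' \<and> (\<forall>w. f (\<delta>' w) = 0) \<and>
      (\<forall>w. g (\<delta>' w) = 0) \<Longrightarrow> \<forall>w. \<delta>' w = \<delta> w"
    using pb'[unfolded pullback_square_def, THEN conjunct2, rule_format, of UNIV "\<lambda>_. 0" "\<lambda>_. 0"]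
      hom calculation by auto
  ultimately have "\<forall>r. s r a = \<delta> r" using hom(4) by (intro \<delta>) blast
  moreover have "\<forall>r. 0 = \<delta> r" using hom(3) \<open>f 0 = 0\<close> \<open>g 0 = 0\<close> by (intro \<delta>) blast
  ultimately have "s 1 a = 0" by metis
  then show ?thesis by simp
qed

end

section \<open>Interval summands from bars\<close>

text \<open>The maps go from \<open>G\<close> to \<open>F\<close>, since out of a direct sum they
  have an explicit formula; their inverses are what \<open>isomorphic_functors\<close> asks
  for.\<close>

lemma isomorphic_functors_if_bij:
  fixes F :: "('k::field, 'p::order, 'v::ab_group_add) vec_diagram"
    and G :: "('k, 'p, 'w::ab_group_add) vec_diagram"
  assumes bij: "\<And>x. bij_betw (\<psi> x) (obj G x) (obj F x)"
    and add: "\<And>x p q. p \<in> obj G x \<Longrightarrow> q \<in> obj G x \<Longrightarrow> p + q \<in> obj G x \<and> \<psi> x (p + q) = \<psi> x p + \<psi> x q"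
    and scale: "\<And>x c p. p \<in> obj G x \<Longrightarrow> smult G c p \<in> obj G x \<and> \<psi> x (smult G c p) = smult F c (\<psi> x p)"
    and arr: "\<And>x y p. x \<le> y \<Longrightarrow> p \<in> obj G x \<Longrightarrow>
      arr G x y p \<in> obj G y \<and> \<psi> y (arr G x y p) = arr F x y (\<psi> x p)"
  shows "isomorphic_functors F G"
  unfolding isomorphic_functors_def vec_hom_def
proof (intro exI conjI allI ballI impI)
  let ?\<phi> = "\<lambda>x. inv_into (obj G x) (\<psi> x)"
  fix x
  show "bij_betw (?\<phi> x) (obj F x) (obj G x)" by (rule bij_betw_inv_into[OF bij])
  have \<phi>\<psi>: "?\<phi> x (\<psi> x p) = p" if "p \<in> obj G x" for x p
    using bij_betw_inv_into_left[OF bij that] .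
  have ex: "\<exists>p\<in>obj G x. v = \<psi> x p" if "v \<in> obj F x" for x v
    using bij[of x] that unfolding bij_betw_def by blast
  fix v assume "v \<in> obj F x"
  then obtain p where p: "p \<in> obj G x" "v = \<psi> x p" using ex by blast
  then show "?\<phi> x v \<in> obj G x" using \<phi>\<psi> by simp
  show "?\<phi> x (smult F c v) = smult G c (?\<phi> x v)" for c
    using scale[OF p(1), of c] \<phi>\<psi> p by metis
  show "?\<phi> y (arr F x y v) = arr G x y (?\<phi> x v)" if "x \<le> y" for y
    using arr[OF that p(1)] \<phi>\<psi> p by metis
  fix v' assume "v' \<in> obj F x"
  then obtain p' where p': "p' \<in> obj G x" "v' = \<psi> x p'" using ex by blast
  show "?\<phi> x (v + v') = ?\<phi> x v + ?\<phi> x v'"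
    using add[OF p(1) p'(1)] \<phi>\<psi> p p' by metis
qed

context persistence
begin

lemma free_finite:
  assumes "\<And>w. w \<in> \<Omega> \<Longrightarrow> bar w" "free \<Omega>"
  shows "finite {w \<in> \<Omega>. w x \<noteq> 0}"
proof -
  obtain E where E: "finite E" "span E = V x" using fin_V by blast
  have "independent ((\<lambda>w. w x) ` {w \<in> \<Omega>. w x \<noteq> 0})" "inj_on (\<lambda>w. w x) {w \<in> \<Omega>. w x \<noteq> 0}"
    using assms(2) unfolding free_def by auto
  moreover have "(\<lambda>w. w x) ` {w \<in> \<Omega>. w x \<noteq> 0} \<subseteq> span E" using assms(1) barD(1) E(2) by blast
  ultimately show ?thesis using independent_span_bound[OF E(1)] finite_imageD by blast
qed

text \<open>Bars with the same nonempty support are independent at any point of it, so there are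
  only finitely many of them and a counter separates them.\<close>

lemma ex_index_of_support:
  assumes "\<And>w. w \<in> \<Omega> \<Longrightarrow> bar w" "free \<Omega>"
  shows "\<exists>\<kappa> :: ('p \<Rightarrow> 'v) \<Rightarrow> nat. inj_on (\<lambda>w. ({x. w x \<noteq> 0}, \<kappa> w)) (\<Omega> - {\<lambda>_. 0})"
proof -
  define C where "C I = {w \<in> \<Omega> - {\<lambda>_. 0}. {x. w x \<noteq> 0} = I}" for I
  have fin: "finite (C I)" for I
  proof (cases "C I = {}")
    case False
    then obtain w where "w \<in> C I" by blast
    then have "w \<noteq> (\<lambda>_. 0)" "{x. w x \<noteq> 0} = I" unfolding C_def by auto
    then obtain x where "x \<in> I" by auto
    then have "C I \<subseteq> {w \<in> \<Omega>. w x \<noteq> 0}" unfolding C_def by auto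
    then show ?thesis using free_finite[OF assms] finite_subset by blast
  qed simp
  have "\<exists>g :: ('p \<Rightarrow> 'v) \<Rightarrow> nat. inj_on g (C I)" for I
    using finite_imp_inj_to_nat_seg[OF fin[of I]] by blast
  then obtain g :: "'p set \<Rightarrow> ('p \<Rightarrow> 'v) \<Rightarrow> nat" where g: "\<And>I. inj_on (g I) (C I)" by metis
  have "inj_on (\<lambda>w. ({x. w x \<noteq> 0}, g {x. w x \<noteq> 0} w)) (\<Omega> - {\<lambda>_. 0})"
  proof (rule inj_onI)
    fix v w assume vw: "v \<in> \<Omega> - {\<lambda>_. 0}" "w \<in> \<Omega> - {\<lambda>_. 0}"
      "({x. v x \<noteq> 0}, g {x. v x \<noteq> 0} v) = ({x. w x \<noteq> 0}, g {x. w x \<noteq> 0} w)"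
    let ?I = "{x. w x \<noteq> 0}"
    have "v \<in> C ?I" "w \<in> C ?I" "g ?I v = g ?I w" using vw unfolding C_def by auto
    then show "v = w" using g[of ?I] by (simp add: inj_on_def)
  qed
  then show ?thesis by (intro exI[of _ "\<lambda>w. g {x. w x \<noteq> 0} w"])
qed

text \<open>A family of coefficients for the bars alive at \<open>x\<close> is sent to the
  combination of their values. Freeness makes this injective, \<open>spans\<close> makes it
  surjective, and the bar property makes it natural. The zero bar is discarded because its support
  is empty.\<close>

theorem decomposes_into_intervals_if_bars:
  assumes F: "smult F = scale" "\<And>x. obj F x = V x"
      "\<And>x y v. x \<le> y \<Longrightarrow> v \<in> V x \<Longrightarrow> arr F x y v = f x y v"
    and bars: "\<And>w. w \<in> \<Omega> \<Longrightarrow> bar w" and "free \<Omega>" and spans: "\<And>x. spanned \<Omega> x = V x"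
    and P: "\<And>w. w \<in> \<Omega> \<Longrightarrow> w \<noteq> (\<lambda>_. 0) \<Longrightarrow> P {x. w x \<noteq> 0}"
  shows "decomposes_into_intervals F P"
proof -
  let ?\<Omega> = "\<Omega> - {\<lambda>_. 0}"
  obtain \<kappa> :: "('p \<Rightarrow> 'v) \<Rightarrow> nat" where \<kappa>: "inj_on (\<lambda>w. ({x. w x \<noteq> 0}, \<kappa> w)) ?\<Omega>"
    using ex_index_of_support[OF bars \<open>free \<Omega>\<close>] by blast
  define \<iota> where "\<iota> w = ({x. w x \<noteq> 0}, \<kappa> w)" for w
  define \<Lambda> where "\<Lambda> = \<iota> ` ?\<Omega>"
  define W where "W = the_inv_into ?\<Omega> \<iota>"
  have inj\<iota>: "inj_on \<iota> ?\<Omega>" using \<kappa> unfolding \<iota>_def .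
  have W\<iota>: "W (\<iota> w) = w" if "w \<in> ?\<Omega>" for w
    unfolding W_def using the_inv_into_f_f[OF inj\<iota> that] .
  have W: "W i \<in> \<Omega>" "W i \<noteq> (\<lambda>_. 0)" "\<And>x. x \<in> fst i \<longleftrightarrow> W i x \<noteq> 0" if "i \<in> \<Lambda>" for i
  proof -
    obtain w where "w \<in> ?\<Omega>" "i = \<iota> w" using \<open>i \<in> \<Lambda>\<close> unfolding \<Lambda>_def by blast
    then show "W i \<in> \<Omega>" "W i \<noteq> (\<lambda>_. 0)" "\<And>x. x \<in> fst i \<longleftrightarrow> W i x \<noteq> 0"
      using W\<iota> by (auto simp: \<iota>_def)
  qed
  define \<Lambda>' where "\<Lambda>' x = {i \<in> \<Lambda>. x \<in> fst i}" for x
  define N where "N x = {w \<in> \<Omega>. w x \<noteq> 0}" for x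
  have bijW: "bij_betw W (\<Lambda>' x) (N x)" for x
  proof (rule bij_betw_byWitness[where f' = \<iota>])
    show "\<forall>i\<in>\<Lambda>' x. \<iota> (W i) = i"
      unfolding W_def \<Lambda>'_def \<Lambda>_def using f_the_inv_into_f[OF inj\<iota>] by blast
    show "\<forall>w\<in>N x. W (\<iota> w) = w" using W\<iota> unfolding N_def by auto
    show "W ` \<Lambda>' x \<subseteq> N x" using W unfolding \<Lambda>'_def N_def by auto
    show "\<iota> ` N x \<subseteq> \<Lambda>' x" unfolding \<Lambda>'_def N_def \<Lambda>_def by (auto simp: \<iota>_def)
  qed
  have injN: "inj_on (\<lambda>w. w x) (N x)" and indN: "independent ((\<lambda>w. w x) ` N x)" for x
    using \<open>free \<Omega>\<close> unfolding free_def N_def by auto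
  have finN: "finite (N x)" for x unfolding N_def by (rule free_finite[OF bars \<open>free \<Omega>\<close>])
  have bij: "bij_betw (\<lambda>i. W i x) (\<Lambda>' x) ((\<lambda>w. w x) ` N x)" for x
    using bij_betw_trans[OF bijW inj_on_imp_bij_betw[OF injN]] by (simp add: comp_def)
  have fin\<Lambda>': "finite (\<Lambda>' x)" for x using bij_betw_finite[OF bijW] finN by blast
  have reindex: "(\<Sum>i\<in>\<Lambda>' x. u (W i x) *s W i x) = (\<Sum>b\<in>(\<lambda>w. w x) ` N x. u b *s b)" for u x
    using sum.reindex_bij_betw[OF bij, of "\<lambda>b. u b *s b"] .
  have zero: "c i = 0" if "(\<Sum>i\<in>\<Lambda>' x. c i *s W i x) = 0" "i \<in> \<Lambda>' x" for c x i
  proof -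
    define u where "u b = c (the_inv_into (\<Lambda>' x) (\<lambda>i. W i x) b)" for b
    have u: "u (W i x) = c i" if "i \<in> \<Lambda>' x" for i
      unfolding u_def using the_inv_into_f_f[OF bij_betw_imp_inj_on[OF bij] that] by simp
    have "(\<Sum>b\<in>(\<lambda>w. w x) ` N x. u b *s b) = 0"
      unfolding reindex[symmetric] using that(1) u by simp
    moreover have "W i x \<in> (\<lambda>w. w x) ` N x" using bij that(2) unfolding bij_betw_def by blast
    ultimately have "u (W i x) = 0" using independentD[OF indN] finN by blast
    then show "c i = 0" using u that(2) by simp
  qed
  define G :: "'p set \<times> nat \<Rightarrow> ('k, 'p, 'k) vec_diagram" where "G i = interval_module (fst i)" for i
  let ?D = "direct_sum \<Lambda> G"
  let ?lk = "Poly_Mapping.lookup"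
  define \<psi> where "\<psi> x p = (\<Sum>i\<in>\<Lambda>' x. ?lk p i *s W i x)" for x and p :: "('p set \<times> nat) \<Rightarrow>\<^sub>0 'k"
  have objD: "p \<in> obj ?D x \<longleftrightarrow> (\<forall>i. i \<notin> \<Lambda>' x \<longrightarrow> ?lk p i = 0)" for p x
    unfolding direct_sum_def G_def interval_module_def \<Lambda>'_def
    by (auto simp: in_keys_iff subset_iff simp del: split_paired_All split: if_splits)
  have lks: "?lk (smult ?D c p) i = c * ?lk p i" for c p i
    unfolding direct_sum_def G_def interval_module_def
    by (simp add: mapp.rep_eq in_keys_iff when_def)
  have lka: "?lk (arr ?D x y p) i = (if x \<in> fst i \<and> y \<in> fst i then ?lk p i else 0)" for x y p i
    unfolding direct_sum_def G_def interval_module_def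
    by (simp add: mapp.rep_eq in_keys_iff when_def)
  have "isomorphic_functors F ?D"
  proof (rule isomorphic_functors_if_bij[of \<psi>])
    fix x
    show "bij_betw (\<psi> x) (obj ?D x) (obj F x)"
      unfolding bij_betw_def
    proof (intro conjI inj_onI subset_antisym subsetI)
      fix p q assume pq: "p \<in> obj ?D x" "q \<in> obj ?D x" "\<psi> x p = \<psi> x q"
      have "(\<Sum>i\<in>\<Lambda>' x. (?lk p i - ?lk q i) *s W i x) = 0"
        using pq(3) unfolding \<psi>_def by (simp add: scale_left_diff_distrib sum_subtractf)
      from zero[OF this] have "?lk p i = ?lk q i" if "i \<in> \<Lambda>' x" for i using that by simp
      then show "p = q" using pq(1,2) objD by (intro poly_mapping_eqI) metis
    next
      fix v assume "v \<in> \<psi> x ` obj ?D x"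
      then show "v \<in> obj F x"
        unfolding \<psi>_def F(2) \<Lambda>'_def using W(1) bars barD(1)
        by (auto intro!: subspace_sum[OF subspace_V] subspace_scale[OF subspace_V])
    next
      fix v assume "v \<in> obj F x"
      then have "v \<in> span ((\<lambda>w. w x) ` N x)"
        using spans[of x] unfolding F(2) spanned_nonzero N_def by simp
      then obtain u where u: "v = (\<Sum>b\<in>(\<lambda>w. w x) ` N x. u b *s b)"
        using finN by (auto simp: span_finite)
      define p where "p = Abs_poly_mapping (\<lambda>i. if i \<in> \<Lambda>' x then u (W i x) else 0)"
      have lkp: "?lk p i = (if i \<in> \<Lambda>' x then u (W i x) else 0)" for i
        unfolding p_def by (subst lookup_Abs_poly_mapping) (auto intro: finite_subset[OF _ fin\<Lambda>'[of x]])
      then have "p \<in> obj ?D x" "\<psi> x p = v"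
        unfolding objD \<psi>_def u reindex[symmetric] by simp_all
      then show "v \<in> \<psi> x ` obj ?D x" by blast
    qed
  next
    fix x p q assume "p \<in> obj ?D x" "q \<in> obj ?D x"
    then show "p + q \<in> obj ?D x \<and> \<psi> x (p + q) = \<psi> x p + \<psi> x q"
      unfolding objD \<psi>_def by (simp add: lookup_add scale_left_distrib sum.distrib)
  next
    fix x c p assume "p \<in> obj ?D x"
    then show "smult ?D c p \<in> obj ?D x \<and> \<psi> x (smult ?D c p) = smult F c (\<psi> x p)"
      unfolding objD \<psi>_def lks F(1) by (simp add: scale_sum_right)
  next
    fix x y p assume xy: "x \<le> y" and p: "p \<in> obj ?D x"
    have "arr ?D x y p \<in> obj ?D y" using p unfolding objD lka \<Lambda>'_def by auto
    moreover have "\<psi> y (arr ?D x y p) = arr F x y (\<psi> x p)"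
    proof -
      have \<psi>V: "\<psi> x p \<in> V x"
        unfolding \<psi>_def \<Lambda>'_def using W(1) bars barD(1)
        by (auto intro!: subspace_sum[OF subspace_V] subspace_scale[OF subspace_V])
      \<comment> \<open>Bars alive only at \<open>y\<close> receive coefficient 0 from the arrow,
        and bars alive only at \<open>x\<close> contribute the value 0 at \<open>y\<close>.\<close>
      have "\<psi> y (arr ?D x y p) = (\<Sum>i\<in>\<Lambda>' y \<inter> \<Lambda>' x. ?lk p i *s W i y)"
        unfolding \<psi>_def using fin\<Lambda>' by (intro sum.mono_neutral_cong_right) (auto simp: lka \<Lambda>'_def)
      also have "\<dots> = (\<Sum>i\<in>\<Lambda>' x. ?lk p i *s W i y)"
        using fin\<Lambda>' W(3) by (intro sum.mono_neutral_left) (auto simp: \<Lambda>'_def)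
      also have "\<dots> = (\<Sum>i\<in>\<Lambda>' x. ?lk p i *s f x y (W i x))"
        using W barD(2)[OF bars xy] by (intro sum.cong) (auto simp: \<Lambda>'_def)
      also have "\<dots> = f x y (\<psi> x p)" unfolding \<psi>_def by (simp add: f.sum f.scale)
      finally show ?thesis using F(3)[OF xy \<psi>V] by simp
    qed
    ultimately show "arr ?D x y p \<in> obj ?D y \<and> \<psi> y (arr ?D x y p) = arr F x y (\<psi> x p)" by blast
  qed
  moreover have "\<forall>i\<in>\<Lambda>. P (fst i)"
  proof
    fix i assume i: "i \<in> \<Lambda>"
    have "fst i = {x. W i x \<noteq> 0}" using W(3)[OF i] by blast
    then show "P (fst i)" using P W(1,2)[OF i] by simp
  qed
  ultimately show ?thesis unfolding decomposes_into_intervals_def G_def by blast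
qed

end

section \<open>Decompositions adapted to an endpoint\<close>

context vector_space
begin

lemma independent_Un:
  assumes "independent A" "independent B" "span A \<inter> span B \<subseteq> {0}"
  shows "independent (A \<union> B)"
proof -
  have *: "a \<notin> span (A \<union> B - {a})"
    if a: "a \<in> A" and AB: "independent A" "independent B" "span A \<inter> span B \<subseteq> {0}" for a and A B :: "'b set"
  proof
    assume "a \<in> span (A \<union> B - {a})"
    moreover have "A \<union> B - {a} \<subseteq> (A - {a}) \<union> B" by blast
    ultimately have "a \<in> span ((A - {a}) \<union> B)" using span_mono by blast
    then obtain x y where xy: "a = x + y" "x \<in> span (A - {a})" "y \<in> span B" unfolding span_Un by blast
    have "x \<in> span A" using xy(2) span_mono[of "A - {a}" A] by blast
    then have "a - x \<in> span A" using span_base[OF a] by (intro span_diff)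
    then have "y \<in> span A" using xy(1) by simp
    then have "y = 0" using AB(3) xy(3) by blast
    then show False using xy(1,2) a AB(1) unfolding dependent_def by auto
  qed
  have "a \<notin> span (A \<union> B - {a})" if "a \<in> A \<union> B" for a
    using that *[of a A B] *[of a B A] assms by (auto simp: Un_commute Int_commute)
  then show ?thesis unfolding dependent_def by blast
qed

lemma independent_if_image:
  assumes "Vector_Spaces.linear scale scale h" "independent (h ` B)" "inj_on h B"
  shows "independent B"
proof -
  interpret h: Vector_Spaces.linear scale scale h by fact
  have "a \<notin> span (B - {a})" if a: "a \<in> B" for a
  proof
    assume "a \<in> span (B - {a})"
    then have "h a \<in> span (h ` (B - {a}))" using h.span_image by blast
    moreover have "h ` (B - {a}) = h ` B - {h a}" using assms(3) a by (auto dest: inj_onD)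
    ultimately show False using assms(2) a unfolding dependent_def by auto
  qed
  then show ?thesis unfolding dependent_def by blast
qed

end

context persistence
begin

lemma spanned_disjoint:
  assumes "free \<Omega>" "\<Omega>1 \<subseteq> \<Omega>" "\<Omega>2 \<subseteq> \<Omega>" "\<Omega>1 \<inter> \<Omega>2 = {}" "v \<in> spanned \<Omega>1 x" "v \<in> spanned \<Omega>2 x"
  shows "v = 0"
proof -
  let ?N = "\<lambda>\<Omega>. (\<lambda>w. w x) ` {w \<in> \<Omega>. w x \<noteq> 0}"
  have fr: "inj_on (\<lambda>w. w x) {w \<in> \<Omega>. w x \<noteq> 0}" "independent (?N \<Omega>)" using assms(1) unfolding free_def by auto
  have "v \<in> span (?N \<Omega>1) \<inter> span (?N \<Omega>2)" using assms(5,6) unfolding spanned_nonzero by blast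
  also have "\<dots> \<subseteq> span (?N \<Omega>1 \<inter> ?N \<Omega>2)"
    by (rule independent_span_disjoint[OF fr(2)]) (use assms(2,3) in blast)+
  also have "?N \<Omega>1 \<inter> ?N \<Omega>2 = {}"
  proof (rule ccontr)
    assume "?N \<Omega>1 \<inter> ?N \<Omega>2 \<noteq> {}"
    then obtain w w' where *: "w \<in> \<Omega>1" "w' \<in> \<Omega>2" "w x = w' x" "w x \<noteq> 0" "w' x \<noteq> 0" by force
    then have "w = w'" using assms(2,3) by (intro inj_onD[OF fr(1)]) auto
    then show False using * assms(4) by blast
  qed
  finally show ?thesis by simp
qed

end

context chain_persistence
begin

text \<open>Since \<open>\<beta>\<close> is adapted to the kernel of \<open>f b x\<close>, its
  vectors outside this kernel stay independent at \<open>x\<close>. The submodule generated at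
  \<open>b\<close> is pure because each of its vectors at \<open>y\<close> comes from
  \<open>b\<close> through \<open>x\<close>.\<close>

lemma bar_decomposition_from_least:
  assumes b: "\<And>x. b \<le> x" and \<beta>: "independent \<beta>" "span \<beta> = V b"
    and ker: "\<And>x. {u \<in> V b. f b x u = 0} \<subseteq> span (\<beta> \<inter> {u \<in> V b. f b x u = 0})"
  obtains \<Omega> where "\<And>w. w \<in> (\<lambda>v x. f b x v) ` \<beta> \<union> \<Omega> \<Longrightarrow> bar w" "free ((\<lambda>v x. f b x v) ` \<beta> \<union> \<Omega>)"
    "\<And>x. spanned ((\<lambda>v x. f b x v) ` \<beta> \<union> \<Omega>) x = V x" "(\<lambda>v x. f b x v) ` \<beta> \<inter> \<Omega> = {}"
proof -
  let ?\<Omega>0 = "(\<lambda>v x. f b x v) ` \<beta>"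
  have \<beta>V: "v \<in> V b" if "v \<in> \<beta>" for v using span_base[OF that] \<beta>(2) by simp
  have bars: "bar w" if w: "w \<in> ?\<Omega>0" for w
  proof -
    obtain v where "v \<in> V b" "w = (\<lambda>x. f b x v)" using w \<beta>V by blast
    then show ?thesis using f_in[OF b] f_comp[OF b] by (intro barI) simp_all
  qed
  have sp: "spanned ?\<Omega>0 x = f b x ` V b" for x
    unfolding spanned_def image_image by (simp add: f.span_image \<beta>(2))
  have "free ?\<Omega>0"
    unfolding free_def
  proof (intro allI conjI)
    fix x
    define K where "K = {u \<in> V b. f b x u = 0}"
    have inj: "inj_on (f b x) (span (\<beta> - K))"
      unfolding f.inj_on_iff_eq_0[OF subspace_span]
    proof (intro ballI impI)
      fix u assume u: "u \<in> span (\<beta> - K)" "f b x u = 0"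
      have "u \<in> V b" using u(1) span_mono[of "\<beta> - K" \<beta>] \<beta>(2) by blast
      then have "u \<in> span (\<beta> \<inter> K)" using ker[of x] u(2) unfolding K_def by blast
      then have "u \<in> span ((\<beta> - K) \<inter> (\<beta> \<inter> K))"
        using u(1) independent_span_disjoint[OF \<beta>(1), of "\<beta> - K" "\<beta> \<inter> K"] by blast
      moreover have "(\<beta> - K) \<inter> (\<beta> \<inter> K) = {}" by blast
      ultimately show "u = 0" by simp
    qed
    have N: "{w \<in> ?\<Omega>0. w x \<noteq> 0} = (\<lambda>v x. f b x v) ` (\<beta> - K)"
      using \<beta>V unfolding K_def by auto
    have "independent (f b x ` (\<beta> - K))"
      using independent_mono[OF \<beta>(1)] by (intro f.independent_injective_image inj) blast
    then show "independent ((\<lambda>w. w x) ` {w \<in> ?\<Omega>0. w x \<noteq> 0})" unfolding N image_image .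
    have "inj_on (f b x) (\<beta> - K)" using inj span_superset by (rule inj_on_subset)
    then show "inj_on (\<lambda>w. w x) {w \<in> ?\<Omega>0. w x \<noteq> 0}" unfolding N by (auto simp: inj_on_def)
  qed
  moreover have "pure ?\<Omega>0"
    unfolding pure_def sp
  proof (intro allI impI)
    fix x y u assume "x \<le> y" "f x y u \<in> f b y ` V b"
    then obtain u' where "u' \<in> V b" "f x y u = f x y (f b x u')" using f_comp[OF b] by auto
    then show "\<exists>\<sigma>\<in>f b x ` V b. f x y u = f x y \<sigma>" by blast
  qed
  ultimately obtain \<Omega> where \<Omega>: "?\<Omega>0 \<subseteq> \<Omega>" "\<And>w. w \<in> \<Omega> \<Longrightarrow> bar w" "free \<Omega>" "\<And>x. spanned \<Omega> x = V x"
    using bar_decomposition[OF bars] by blast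
  have "?\<Omega>0 \<union> (\<Omega> - ?\<Omega>0) = \<Omega>" using \<Omega>(1) by blast
  then show thesis using that[of "\<Omega> - ?\<Omega>0"] \<Omega> by simp
qed

text \<open>The points where \<open>v\<close> has preimages form an up-closed set, and there the
  fibres over \<open>v\<close> are nonempty flats, among which \<open>flat_inverse_limit\<close>
  picks compatible points. Below this set the bar is 0.\<close>

lemma lift_to_bar:
  assumes t: "\<And>x. x \<le> t" and v: "v \<in> V t"
  shows "\<exists>w. bar w \<and> w t = v \<and> (\<forall>x. v \<in> f x t ` V x \<longrightarrow> f x t (w x) = v) \<and> (\<forall>x. v \<notin> f x t ` V x \<longrightarrow> w x = 0)"
proof -
  define L where "L = {x. v \<in> f x t ` V x}"
  \<comment> \<open>The equation \<open>f x t u = v\<close> is written with the zero subspace to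
    match \<open>flat_fibre\<close>.\<close>
  define X where "X x = {u \<in> V x. f x t u - v \<in> {0}}" for x
  obtain w where w: "\<And>x. x \<in> L \<Longrightarrow> w x \<in> X x"
    "\<And>x y. x \<in> L \<Longrightarrow> y \<in> L \<Longrightarrow> x \<le> y \<Longrightarrow> f x y (w x) = w y"
  proof (rule flat_inverse_limit[of L X])
    show "flat scale (X x)" for x unfolding X_def by (rule flat_fibre) simp
    show "X x \<noteq> {}" if "x \<in> L" for x using that unfolding X_def L_def by auto
    show "f x y u \<in> X y" if "x \<le> y" "u \<in> X x" for x y u
      using that f_in f_comp[OF that(1) t] unfolding X_def by simp
  qed (auto simp: X_def)
  define w' where "w' x = (if x \<in> L then w x else 0)" for x
  have wV: "w x \<in> V x" "f x t (w x) = v" if "x \<in> L" for x using w(1)[OF that] unfolding X_def by auto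
  have Lup: "y \<in> L" if "x \<in> L" "x \<le> y" for x y
  proof -
    have "v = f y t (f x y (w x))" using wV[OF that(1)] f_comp[OF that(2) t] by simp
    then show ?thesis unfolding L_def using f_in[OF that(2) wV(1)[OF that(1)]] by blast
  qed
  have "bar w'"
  proof (rule barI)
    show "w' x \<in> V x" for x unfolding w'_def using wV subspace_0[OF subspace_V] by simp
    show "f x y (w' x) = w' y" if "x \<le> y" "w' x \<noteq> 0" for x y
      using that w(2) Lup[OF _ that(1)] unfolding w'_def by (simp split: if_splits)
  qed
  moreover have "t \<in> L" unfolding L_def using v f_id by force
  then have "w' t = v" using wV f_id unfolding w'_def by metis
  moreover have "\<forall>x. v \<in> f x t ` V x \<longrightarrow> f x t (w' x) = v" "\<forall>x. v \<notin> f x t ` V x \<longrightarrow> w' x = 0"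
    using wV unfolding w'_def L_def by simp_all
  ultimately show ?thesis by blast
qed

text \<open>The map to \<open>t\<close> returns \<open>v\<close> from \<open>l v\<close> wherever
  the lift is alive, so these lifts are independent and \<open>f x t\<close> is injective on their
  span. As \<open>\<beta>\<close> is adapted to the images, each vector at \<open>x\<close> has the
  same image at \<open>t\<close> as some combination of lifts; together with injectivity this gives
  purity.\<close>

lemma bar_decomposition_to_greatest:
  assumes t: "\<And>x. x \<le> t" and \<beta>: "independent \<beta>" "span \<beta> = V t"
    and im: "\<And>x. f x t ` V x \<subseteq> span (\<beta> \<inter> f x t ` V x)"
  obtains l \<Omega> where "\<forall>w\<in>l ` \<beta> \<union> \<Omega>. bar w" "free (l ` \<beta> \<union> \<Omega>)"
    "\<forall>x. spanned (l ` \<beta> \<union> \<Omega>) x = V x" "\<forall>v\<in>\<beta>. l v t = v"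
    "\<forall>v\<in>\<beta>. \<forall>x. v \<in> f x t ` V x \<longrightarrow> f x t (l v x) = v"
    "\<forall>x. \<forall>\<sigma>\<in>spanned (l ` \<beta>) x. f x t \<sigma> = 0 \<longrightarrow> \<sigma> = 0" "\<forall>w\<in>\<Omega>. w t = 0"
proof -
  have \<beta>V: "v \<in> V t" if "v \<in> \<beta>" for v using span_base[OF that] \<beta>(2) by simp
  have "\<forall>v\<in>\<beta>. \<exists>w. bar w \<and> w t = v \<and> (\<forall>x. v \<in> f x t ` V x \<longrightarrow> f x t (w x) = v) \<and>
      (\<forall>x. v \<notin> f x t ` V x \<longrightarrow> w x = 0)"
    using lift_to_bar[OF t \<beta>V] by blast
  then obtain l where l: "\<And>v. v \<in> \<beta> \<Longrightarrow> bar (l v)" "\<And>v. v \<in> \<beta> \<Longrightarrow> l v t = v"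
    "\<And>v x. v \<in> \<beta> \<Longrightarrow> v \<in> f x t ` V x \<Longrightarrow> f x t (l v x) = v"
    "\<And>v x. v \<in> \<beta> \<Longrightarrow> v \<notin> f x t ` V x \<Longrightarrow> l v x = 0"
    by metis
  have bars: "bar w" if "w \<in> l ` \<beta>" for w using that l(1) by blast
  have ne0: "v \<noteq> 0" if "v \<in> \<beta>" for v using that \<beta>(1) dependent_zero by blast
  define \<beta>' where "\<beta>' x = \<beta> \<inter> f x t ` V x" for x
  have l\<beta>': "f x t (l v x) = v" if "v \<in> \<beta>' x" for v x using l(3) that unfolding \<beta>'_def by blast
  have l0: "l v x \<noteq> 0 \<longleftrightarrow> v \<in> \<beta>' x" if "v \<in> \<beta>" for v x
    using l\<beta>'[of v x] l(4)[OF that, of x] ne0[OF that] f.zero that unfolding \<beta>'_def by auto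
  have N: "{w \<in> l ` \<beta>. w x \<noteq> 0} = l ` \<beta>' x" for x
    using l0 unfolding \<beta>'_def by auto
  let ?B = "\<lambda>x. (\<lambda>v. l v x) ` \<beta>' x"
  have imB: "f x t ` ?B x = \<beta>' x" for x using l\<beta>' by (force simp: image_image)
  have injB: "inj_on (f x t) (?B x)" for x using l\<beta>' by (auto simp: inj_on_def)
  have "independent (\<beta>' x)" for x
    unfolding \<beta>'_def by (rule independent_mono[OF \<beta>(1)]) blast
  then have ind: "independent (f x t ` ?B x)" for x unfolding imB .
  have sp: "spanned (l ` \<beta>) x = span (?B x)" for x
    unfolding spanned_nonzero N image_image ..
  have inj0: "\<sigma> = 0" if "\<sigma> \<in> spanned (l ` \<beta>) x" "f x t \<sigma> = 0" for \<sigma> x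
    using f.inj_on_span_independent_image[OF ind injB, of x] that
    by (simp add: f.inj_on_iff_eq_0[OF subspace_span] sp)
  have "free (l ` \<beta>)"
    unfolding free_def N image_image
  proof (intro allI conjI)
    fix x
    show "independent (?B x)" by (rule independent_if_image[OF linear_f ind injB])
    show "inj_on (\<lambda>w. w x) (l ` \<beta>' x)"
    proof (rule inj_onI)
      fix w w' assume w: "w \<in> l ` \<beta>' x" "w' \<in> l ` \<beta>' x" "w x = w' x"
      then obtain v v' where "w = l v" "w' = l v'" "v \<in> \<beta>' x" "v' \<in> \<beta>' x" by blast
      then show "w = w'" using l\<beta>' w(3) by metis
    qed
  qed
  moreover have "pure (l ` \<beta>)"
    unfolding pure_def
  proof (intro allI impI)
    fix x y u assume xy: "x \<le> y" and u: "u \<in> V x" and fu: "f x y u \<in> spanned (l ` \<beta>) y"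
    have "f x t u \<in> span (\<beta>' x)" using im u unfolding \<beta>'_def by blast
    then have "f x t u \<in> f x t ` span (?B x)" by (simp add: f.span_image[symmetric] imB)
    then obtain \<sigma> where \<sigma>: "\<sigma> \<in> spanned (l ` \<beta>) x" "f x t u = f x t \<sigma>" unfolding sp by blast
    have "\<sigma> \<in> V x" using \<sigma>(1) spanned_subset bars by blast
    \<comment> \<open>Equal images at \<open>t\<close> suffice: both vectors lie in the span of the
      lifts at \<open>y\<close>, where the map to \<open>t\<close> is injective.\<close>
    then have "f y t (f x y u - f x y \<sigma>) = 0" using f_comp[OF xy t] u \<sigma>(2) by (simp add: f.diff)
    moreover have "f x y u - f x y \<sigma> \<in> spanned (l ` \<beta>) y"
      using fu f_spanned[OF bars xy \<sigma>(1)] subspace_diff[OF subspace_spanned] by blast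
    ultimately have "f x y u - f x y \<sigma> = 0" by (rule inj0[rotated])
    then show "\<exists>\<sigma>\<in>spanned (l ` \<beta>) x. f x y u = f x y \<sigma>" using \<sigma>(1) by auto
  qed
  ultimately obtain \<Omega> where \<Omega>: "l ` \<beta> \<subseteq> \<Omega>" "\<And>w. w \<in> \<Omega> \<Longrightarrow> bar w" "free \<Omega>" "\<And>x. spanned \<Omega> x = V x"
    using bar_decomposition[OF bars] by blast
  have eq: "l ` \<beta> \<union> (\<Omega> - l ` \<beta>) = \<Omega>" using \<Omega>(1) by blast
  \<comment> \<open>The lifts already span \<open>V t\<close>, which leaves no room for a further
    independent value.\<close>
  have \<Omega>t: "w t = 0" if w: "w \<in> \<Omega> - l ` \<beta>" for w
  proof (rule spanned_disjoint[OF \<Omega>(3,1) Diff_subset])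
    have "\<beta> \<subseteq> spanned (l ` \<beta>) t"
    proof
      fix v assume "v \<in> \<beta>"
      then show "v \<in> spanned (l ` \<beta>) t" using spanned_base[of "l v" "l ` \<beta>" t] l(2) by auto
    qed
    then have "span \<beta> \<subseteq> spanned (l ` \<beta>) t" by (intro span_minimal subspace_spanned)
    then show "w t \<in> spanned (l ` \<beta>) t" using \<Omega>(2) w barD(1) \<beta>(2) by blast
    show "w t \<in> spanned (\<Omega> - l ` \<beta>) t" using w by (rule spanned_base)
  qed blast
  show thesis
    by (rule that[of l "\<Omega> - l ` \<beta>", unfolded eq]) (use \<Omega>(2-4) l(2,3) inj0 \<Omega>t in simp_all)
qed

end

section \<open>Decomposition over a product of two chains\<close>

lemma poset_interval_if_directed:
  assumes "\<And>x y z. x \<in> I \<Longrightarrow> y \<in> I \<Longrightarrow> x \<le> z \<Longrightarrow> z \<le> y \<Longrightarrow> z \<in> I"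
    and "\<And>x y. x \<in> I \<Longrightarrow> y \<in> I \<Longrightarrow> \<exists>z\<in>I. x \<le> z \<and> y \<le> z"
  shows "poset_interval I"
  unfolding poset_interval_def
proof (intro conjI ballI)
  show "\<forall>z. x \<le> z \<and> z \<le> y \<longrightarrow> z \<in> I" if "x \<in> I" "y \<in> I" for x y using assms(1) that by blast
  fix x y assume xy: "x \<in> I" "y \<in> I"
  then obtain z where z: "z \<in> I" "x \<le> z" "y \<le> z" using assms(2) by blast
  \<comment> \<open>The zigzag \<open>x \<le> z \<ge> y \<le> y\<close>, with \<open>n = 1\<close>;
    its last step is trivial because a zigzag has to end in an upper point
    \<open>b n\<close>.\<close>
  let ?a = "\<lambda>i :: nat. if i = 0 then x else y" and ?b = "\<lambda>i :: nat. if i = 0 then z else y"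
  show "\<exists>n (a :: nat \<Rightarrow> _) b. a 0 = x \<and> b n = y \<and>
      (\<forall>i\<le>n. a i \<in> I \<and> b i \<in> I \<and> a i \<le> b i) \<and> (\<forall>i<n. a (Suc i) \<le> b i)"
    by (rule exI[of _ 1], rule exI[of _ ?a], rule exI[of _ ?b]) (use xy z in simp)
qed

lemma poset_interval_chain:
  fixes J :: "'p::linorder set"
  assumes "\<And>x y z. x \<in> J \<Longrightarrow> y \<in> J \<Longrightarrow> x \<le> z \<Longrightarrow> z \<le> y \<Longrightarrow> z \<in> J"
  shows "poset_interval J"
proof (rule poset_interval_if_directed[of J, OF assms])
  show "\<exists>z\<in>J. x \<le> z \<and> y \<le> z" if "x \<in> J" "y \<in> J" for x y
    using that by (intro bexI[of _ "max x y"]) (auto simp: max_def)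
qed

lemma poset_interval_Times:
  fixes J :: "'a::linorder set" and K :: "'b::linorder set"
  assumes "poset_interval J" "poset_interval K"
  shows "poset_interval (J \<times> K)"
proof (rule poset_interval_if_directed)
  show "z \<in> J \<times> K" if "x \<in> J \<times> K" "y \<in> J \<times> K" "x \<le> z" "z \<le> y" for x y z
    using that assms unfolding poset_interval_def less_eq_prod_def by (metis mem_Times_iff)
  show "\<exists>z\<in>J \<times> K. x \<le> z \<and> y \<le> z" if "x \<in> J \<times> K" "y \<in> J \<times> K" for x y
    using that by (intro bexI[of _ "(max (fst x) (fst y), max (snd x) (snd y))"]) (auto simp: max_def)
qed

lemma (in persistence) chain_restrict:
  fixes e :: "'c::linorder \<Rightarrow> 'p"
  assumes "\<And>x y. x \<le> y \<Longrightarrow> e x \<le> e y"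
  shows "chain_persistence scale (\<lambda>x. V (e x)) (\<lambda>x y. f (e x) (e y))"
proof unfold_locales
  show "\<exists>E. finite E \<and> span E = V (e x)" for x by (rule fin_V)
qed (use subspace_V f_in f_id f_comp assms f.add f.scale in \<open>simp_all\<close>)

lemma (in chain_persistence) bar_support_interval:
  assumes "bar w"
  shows "poset_interval {x. w x \<noteq> 0}"
  using bar_support_convex[OF assms] by (intro poset_interval_chain) simp

section \<open>Grids, and the pushout of the two edges at the least corner\<close>

locale grid_persistence = persistence scale V f
  for scale :: "'k::field \<Rightarrow> 'v::ab_group_add \<Rightarrow> 'v" (infixr \<open>*s\<close> 75)
    and V :: "'a::linorder \<times> 'b::linorder \<Rightarrow> 'v set" and f
begin

text \<open>By \<open>surj\<close> and \<open>exact\<close>, each \<open>V (x, y)\<close> is a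
  pushout of the edges, so bars of the edges extend over the grid by transport. The bars of
  \<open>\<beta>\<close> run along both edges and are counted once, on the side of \<open>A\<close>.
  Exactness shows that all relations between the edges come from the corner.\<close>

theorem bars_from_corner:
  fixes a0 :: 'a and b0 :: 'b
  assumes a0: "\<And>x. a0 \<le> x" and b0: "\<And>y. b0 \<le> y"
    and surj: "\<And>x y d. d \<in> V (x, y) \<Longrightarrow>
      \<exists>a\<in>V (x, b0). \<exists>b\<in>V (a0, y). d = f (x, b0) (x, y) a + f (a0, y) (x, y) b"
    and exact: "\<And>x y a b. a \<in> V (x, b0) \<Longrightarrow> b \<in> V (a0, y) \<Longrightarrow>
      f (x, b0) (x, y) a + f (a0, y) (x, y) b = 0 \<Longrightarrow>
      \<exists>u\<in>V (a0, b0). a = f (a0, b0) (x, b0) u \<and> b = - f (a0, b0) (a0, y) u"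
  obtains \<Omega> where "\<And>w. w \<in> \<Omega> \<Longrightarrow> bar w" "free \<Omega>" "\<And>z. spanned \<Omega> z = V z"
    "\<And>w. w \<in> \<Omega> \<Longrightarrow> (\<exists>J K. down_closed J \<and> down_closed K \<and> {z. w z \<noteq> 0} = J \<times> K) \<or>
      (\<exists>J. poset_interval J \<and> {z. w z \<noteq> 0} = J \<times> UNIV) \<or>
      (\<exists>K. poset_interval K \<and> {z. w z \<noteq> 0} = UNIV \<times> K)"
proof -
  let ?o = "(a0, b0)"
  interpret A: chain_persistence scale "\<lambda>x. V (x, b0)" "\<lambda>x y. f (x, b0) (y, b0)"
    by (rule chain_restrict) simp
  interpret B: chain_persistence scale "\<lambda>y. V (a0, y)" "\<lambda>x y. f (a0, x) (a0, y)"
    by (rule chain_restrict) simp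
  define KA where "KA x = {u \<in> V ?o. f ?o (x, b0) u = 0}" for x
  define KB where "KB y = {u \<in> V ?o. f ?o (a0, y) u = 0}" for y
  have subK: "subspace {u \<in> V ?o. f ?o z u = 0}" for z
    using subspace_inter[OF subspace_V f.subspace_kernel] by (simp add: Int_def)
  have Kmono: "{u \<in> V ?o. f ?o z u = 0} \<subseteq> {u \<in> V ?o. f ?o z' u = 0}" if "z \<le> z'" for z z'
  proof
    fix u assume "u \<in> {u \<in> V ?o. f ?o z u = 0}"
    then have u: "u \<in> V ?o" "f ?o z u = 0" by auto
    have "f ?o z' u = f z z' (f ?o z u)" using f_comp[OF _ that u(1)] a0 b0 by (cases z) simp
    then show "u \<in> {u \<in> V ?o. f ?o z' u = 0}" using u f.zero by simp
  qed
  obtain E where E: "finite E" "span E = V ?o" using fin_V by blast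
  obtain \<beta> where \<beta>: "independent \<beta>" "span \<beta> = V ?o"
    "\<And>P. P \<in> range KA \<Longrightarrow> P \<subseteq> span (\<beta> \<inter> P)" "\<And>Q. Q \<in> range KB \<Longrightarrow> Q \<subseteq> span (\<beta> \<inter> Q)"
  proof (rule adapted_basis_of_two_flags[OF E(1), of "V ?o" "range KA" "range KB"])
    show "P \<subseteq> P' \<or> P' \<subseteq> P" if P: "P \<in> range KA" "P' \<in> range KA" for P P'
    proof -
      obtain x x' where "P = KA x" "P' = KA x'" using P by blast
      then show ?thesis
        using linear[of x x'] Kmono[of "(x, b0)" "(x', b0)"] Kmono[of "(x', b0)" "(x, b0)"]
        unfolding KA_def by auto
    qed
    show "P \<subseteq> P' \<or> P' \<subseteq> P" if P: "P \<in> range KB" "P' \<in> range KB" for P P'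
    proof -
      obtain y y' where "P = KB y" "P' = KB y'" using P by blast
      then show ?thesis
        using linear[of y y'] Kmono[of "(a0, y)" "(a0, y')"] Kmono[of "(a0, y')" "(a0, y)"]
        unfolding KB_def by auto
    qed
  qed (use E(2) subspace_V subK in \<open>auto simp: KA_def KB_def\<close>)
  have \<beta>V: "v \<in> V ?o" if "v \<in> \<beta>" for v using span_base[OF that] \<beta>(2) by simp
  define lA where "lA v = (\<lambda>x. f ?o (x, b0) v)" for v
  define lB where "lB v = (\<lambda>y. f ?o (a0, y) v)" for v
  obtain RA where RA: "\<And>w. w \<in> lA ` \<beta> \<union> RA \<Longrightarrow> A.bar w" "A.free (lA ` \<beta> \<union> RA)"
    "\<And>x. A.spanned (lA ` \<beta> \<union> RA) x = V (x, b0)" "lA ` \<beta> \<inter> RA = {}"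
    using A.bar_decomposition_from_least[OF a0 \<beta>(1,2)] \<beta>(3) unfolding KA_def lA_def by blast
  obtain RB where RB: "\<And>w. w \<in> lB ` \<beta> \<union> RB \<Longrightarrow> B.bar w" "B.free (lB ` \<beta> \<union> RB)"
    "\<And>y. B.spanned (lB ` \<beta> \<union> RB) y = V (a0, y)" "lB ` \<beta> \<inter> RB = {}"
    using B.bar_decomposition_from_least[OF b0 \<beta>(1,2)] \<beta>(4) unfolding KB_def lB_def by blast
  have le: "?o \<le> z" "(x, b0) \<le> (x, y)" "(a0, y) \<le> (x, y)" "?o \<le> (x, b0)" "?o \<le> (a0, y)" for x y z
    using a0 b0 by (cases z; simp)+
  have comp: "f (x, b0) (x, y) (f ?o (x, b0) u) = f ?o (x, y) u"
    "f (a0, y) (x, y) (f ?o (a0, y) u) = f ?o (x, y) u" if "u \<in> V ?o" for x y u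
    using f_comp le that by blast+
  have lA_img: "A.spanned (lA ` \<gamma>) x = f ?o (x, b0) ` span \<gamma>" for \<gamma> x
    unfolding A.spanned_def lA_def image_image by (simp add: f.span_image)
  have lB_img: "B.spanned (lB ` \<gamma>) y = f ?o (a0, y) ` span \<gamma>" for \<gamma> y
    unfolding B.spanned_def lB_def image_image by (simp add: f.span_image)
  \<comment> \<open>Exactness expresses the relation by a vector \<open>u\<close> at the corner.
    Then \<open>\<gamma>\<close> lies both in the span of the bars of \<open>\<beta>\<close> and in
    that of \<open>RB\<close>, hence is 0, and so \<open>u\<close> dies at
    \<open>(a0, y)\<close>.\<close>
  have ker: "\<gamma> = 0 \<and> (\<exists>u\<in>span (\<beta> \<inter> KB y). \<alpha> = f ?o (x, b0) u)"
    if \<alpha>\<gamma>: "\<alpha> \<in> V (x, b0)" "\<gamma> \<in> B.spanned RB y" "f (x, b0) (x, y) \<alpha> + f (a0, y) (x, y) \<gamma> = 0" for x y \<alpha> \<gamma>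
  proof -
    have "\<gamma> \<in> V (a0, y)" using \<alpha>\<gamma>(2) B.spanned_subset[OF RB(1)] B.spanned_mono[of RB "lB ` \<beta> \<union> RB"] by blast
    then obtain u where u: "u \<in> V ?o" "\<alpha> = f ?o (x, b0) u" "\<gamma> = - f ?o (a0, y) u"
      using exact \<alpha>\<gamma>(1,3) by blast
    have "f ?o (a0, y) u \<in> B.spanned (lB ` \<beta>) y" unfolding lB_img \<beta>(2) using u(1) by blast
    then have "\<gamma> \<in> B.spanned (lB ` \<beta>) y" using u(3) subspace_neg[OF B.subspace_spanned] by blast
    then have "\<gamma> = 0" using B.spanned_disjoint[OF RB(2) _ _ RB(4)] \<alpha>\<gamma>(2) by blast
    then have "u \<in> KB y" using u unfolding KB_def by simp
    then show ?thesis using \<beta>(4) u(2) \<open>\<gamma> = 0\<close> by blast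
  qed
  define DA where "DA a = (\<lambda>z. f (fst z, b0) z (a (fst z)))" for a :: "'a \<Rightarrow> 'v"
  define DB where "DB b = (\<lambda>z. f (a0, snd z) z (b (snd z)))" for b :: "'b \<Rightarrow> 'v"
  have DA_lA: "DA (lA v) (x, y) = f ?o (x, y) v" if "v \<in> \<beta>" for v x y
    unfolding DA_def lA_def using comp(1) \<beta>V[OF that] by simp
  \<comment> \<open>The family \<open>\<Gamma>\<close> is kept general: the bars alive at a point
    give freeness, and a single bar gives the support of its transport.\<close>
  have kerA: "\<alpha> = 0 \<and> \<gamma> = 0"
    if "\<Gamma> \<subseteq> lA ` \<beta> \<union> RA" "\<And>a. a \<in> \<Gamma> \<Longrightarrow> a \<notin> lA ` (\<beta> \<inter> KB y)" "\<alpha> \<in> A.spanned \<Gamma> x"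
      "\<gamma> \<in> B.spanned RB y" "f (x, b0) (x, y) \<alpha> + f (a0, y) (x, y) \<gamma> = 0" for \<Gamma> \<alpha> \<gamma> x y
  proof -
    have "\<alpha> \<in> V (x, b0)" using that(3) A.spanned_mono[OF that(1)] RA(3) by blast
    then have *: "\<gamma> = 0" "\<alpha> \<in> A.spanned (lA ` (\<beta> \<inter> KB y)) x"
      using ker[OF _ that(4,5)] unfolding lA_img by blast+
    have "\<alpha> = 0"
      by (rule A.spanned_disjoint[OF RA(2) that(1) _ _ that(3) *(2)]) (use that(2) in blast)+
    then show ?thesis using *(1) by blast
  qed
  have KB0: "DA (lA v) (x, y) = 0" if "v \<in> \<beta> \<inter> KB y" for v x y
    using DA_lA[of v x y] comp(2)[of v y x] that f.zero unfolding KB_def by auto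
  have inj: "\<alpha> = 0 \<and> \<gamma> = 0"
    if "\<alpha> \<in> A.spanned {a \<in> lA ` \<beta> \<union> RA. DA a (x, y) \<noteq> 0} x"
      "\<gamma> \<in> B.spanned RB y" "f (x, b0) (x, y) \<alpha> + f (a0, y) (x, y) \<gamma> = 0" for \<alpha> \<gamma> x y
    by (rule kerA[OF _ _ that]) (use KB0 in auto)
  have barA: "bar (DA a)" if "a \<in> lA ` \<beta> \<union> RA" for a
  proof (rule barI)
    have aV: "a x \<in> V (x, b0)" for x using A.barD(1)[OF RA(1)[OF that]] .
    show "DA a z \<in> V z" for z unfolding DA_def using aV f_in[OF le(2)] by (cases z) simp
    fix z z' assume "z \<le> z'" "DA a z \<noteq> 0"
    then obtain x y x' y' where z: "z = (x, y)" "z' = (x', y')" "x \<le> x'" "y \<le> y'"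
      by (cases z; cases z') auto
    have "a x \<noteq> 0" using \<open>DA a z \<noteq> 0\<close> f.zero unfolding DA_def z by auto
    then have "f (x, b0) (x', b0) (a x) = a x'" using A.barD(2)[OF RA(1)[OF that]] z(3) by blast
    moreover have "f (x', b0) (x', y') (f (x, b0) (x', b0) (a x)) = f (x, b0) (x', y') (a x)"
      "f (x, y) (x', y') (f (x, b0) (x, y) (a x)) = f (x, b0) (x', y') (a x)"
      using aV z b0 by (intro f_comp; simp)+
    ultimately show "f z z' (DA a z) = DA a z'" unfolding DA_def z by simp
  qed
  have barB: "bar (DB b)" if "b \<in> RB" for b
  proof (rule barI)
    have b: "B.bar b" using RB(1) that by blast
    have bV: "b y \<in> V (a0, y)" for y using B.barD(1)[OF b] .
    show "DB b z \<in> V z" for z unfolding DB_def using bV f_in[OF le(3)] by (cases z) simp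
    fix z z' assume "z \<le> z'" "DB b z \<noteq> 0"
    then obtain x y x' y' where z: "z = (x, y)" "z' = (x', y')" "x \<le> x'" "y \<le> y'"
      by (cases z; cases z') auto
    have "b y \<noteq> 0" using \<open>DB b z \<noteq> 0\<close> f.zero unfolding DB_def z by auto
    then have "f (a0, y) (a0, y') (b y) = b y'" using B.barD(2)[OF b] z(4) by blast
    moreover have "f (a0, y') (x', y') (f (a0, y) (a0, y') (b y)) = f (a0, y) (x', y') (b y)"
      "f (x, y) (x', y') (f (a0, y) (x, y) (b y)) = f (a0, y) (x', y') (b y)"
      using bV z a0 by (intro f_comp; simp)+
    ultimately show "f z z' (DB b z) = DB b z'" unfolding DB_def z by simp
  qed
  let ?\<Omega> = "DA ` (lA ` \<beta> \<union> RA) \<union> DB ` RB"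
  show thesis
  proof (rule that)
    show "bar w" if "w \<in> ?\<Omega>" for w using that barA barB by blast
    show "free ?\<Omega>"
      unfolding free_def
    proof (rule allI)
      fix z :: "'a \<times> 'b"
      obtain x y where z: "z = (x, y)" by (cases z)
      let ?g = "f (x, b0) (x, y)" and ?h = "f (a0, y) (x, y)"
      define CA where "CA = {a \<in> lA ` \<beta> \<union> RA. DA a (x, y) \<noteq> 0}"
      define CB where "CB = {b \<in> RB. DB b (x, y) \<noteq> 0}"
      have DA: "DA a (x, y) = ?g (a x)" and DB: "DB b (x, y) = ?h (b y)" for a b
        unfolding DA_def DB_def by simp_all
      have nzA: "a x \<noteq> 0" if "a \<in> CA" for a using that f.zero unfolding CA_def DA by auto
      have nzB: "b y \<noteq> 0" if "b \<in> CB" for b using that f.zero unfolding CB_def DB by auto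
      have frA: "inj_on (\<lambda>a. a x) CA" "independent ((\<lambda>a. a x) ` CA)"
      proof -
        have sub: "CA \<subseteq> {a \<in> lA ` \<beta> \<union> RA. a x \<noteq> 0}" using nzA unfolding CA_def by blast
        show "inj_on (\<lambda>a. a x) CA" using RA(2) inj_on_subset[OF _ sub] unfolding A.free_def by blast
        show "independent ((\<lambda>a. a x) ` CA)"
          using RA(2) independent_mono[OF _ image_mono[OF sub]] unfolding A.free_def by blast
      qed
      have frB: "inj_on (\<lambda>b. b y) CB" "independent ((\<lambda>b. b y) ` CB)"
      proof -
        have sub: "CB \<subseteq> {b \<in> lB ` \<beta> \<union> RB. b y \<noteq> 0}" using nzB unfolding CB_def by blast
        show "inj_on (\<lambda>b. b y) CB" using RB(2) inj_on_subset[OF _ sub] unfolding B.free_def by blast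
        show "independent ((\<lambda>b. b y) ` CB)"
          using RB(2) independent_mono[OF _ image_mono[OF sub]] unfolding B.free_def by blast
      qed
      have inj': "\<alpha> = 0 \<and> \<gamma> = 0"
        if "\<alpha> \<in> span ((\<lambda>a. a x) ` CA)" "\<gamma> \<in> span ((\<lambda>b. b y) ` CB)" "?g \<alpha> + ?h \<gamma> = 0" for \<alpha> \<gamma>
      proof (rule inj)
        show "\<alpha> \<in> A.spanned {a \<in> lA ` \<beta> \<union> RA. DA a (x, y) \<noteq> 0} x"
          using that(1) unfolding A.spanned_def CA_def .
        have "CB \<subseteq> RB" unfolding CB_def by blast
        then show "\<gamma> \<in> B.spanned RB y" using that(2) B.spanned_mono[of CB RB] unfolding B.spanned_def by blast
      qed (rule that(3))
      have N: "{w \<in> ?\<Omega>. w z \<noteq> 0} = DA ` CA \<union> DB ` CB" unfolding CA_def CB_def z by blast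
      have evA: "(\<lambda>w. w z) ` DA ` CA = ?g ` (\<lambda>a. a x) ` CA" unfolding z image_image DA ..
      have evB: "(\<lambda>w. w z) ` DB ` CB = ?h ` (\<lambda>b. b y) ` CB" unfolding z image_image DB ..
      have injg: "inj_on ?g (span ((\<lambda>a. a x) ` CA))"
        unfolding f.inj_on_iff_eq_0[OF subspace_span]
        using inj'[OF _ span_zero] f.zero by (metis add.right_neutral)
      have injh: "inj_on ?h (span ((\<lambda>b. b y) ` CB))"
        unfolding f.inj_on_iff_eq_0[OF subspace_span]
        using inj'[OF span_zero] f.zero by (metis add.left_neutral)
      have "independent (?g ` (\<lambda>a. a x) ` CA \<union> ?h ` (\<lambda>b. b y) ` CB)"
      proof (rule independent_Un)
        show "independent (?g ` (\<lambda>a. a x) ` CA)" by (rule f.independent_injective_image[OF frA(2) injg])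
        show "independent (?h ` (\<lambda>b. b y) ` CB)" by (rule f.independent_injective_image[OF frB(2) injh])
        show "span (?g ` (\<lambda>a. a x) ` CA) \<inter> span (?h ` (\<lambda>b. b y) ` CB) \<subseteq> {0}"
        proof
          fix d assume "d \<in> span (?g ` (\<lambda>a. a x) ` CA) \<inter> span (?h ` (\<lambda>b. b y) ` CB)"
          then obtain \<alpha> \<gamma> where *: "\<alpha> \<in> span ((\<lambda>a. a x) ` CA)" "\<gamma> \<in> span ((\<lambda>b. b y) ` CB)"
            "d = ?g \<alpha>" "d = ?h \<gamma>" unfolding f.span_image by blast
          then have "?g \<alpha> + ?h (- \<gamma>) = 0" by (metis add.right_inverse f.neg)
          then have "\<alpha> = 0" using inj' *(1) span_neg[OF *(2)] by blast
          then show "d \<in> {0}" using *(3) f.zero by simp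
        qed
      qed
      moreover have "inj_on (\<lambda>w. w z) (DA ` CA \<union> DB ` CB)"
      proof (rule inj_onI)
        have cross: "?g (a x) \<noteq> ?h (b y)" if "a \<in> CA" "b \<in> CB" for a b
        proof
          assume "?g (a x) = ?h (b y)"
          then have "?g (a x) + ?h (- b y) = 0" by (metis add.right_inverse f.neg)
          moreover have "a x \<in> span ((\<lambda>a. a x) ` CA)" "- b y \<in> span ((\<lambda>b. b y) ` CB)"
            using that by (auto intro: span_base span_neg)
          ultimately show False using inj' nzA[OF that(1)] by blast
        qed
        have injA: "a = a'" if "a \<in> CA" "a' \<in> CA" "?g (a x) = ?g (a' x)" for a a'
        proof (rule inj_onD[OF frA(1) _ that(1,2)])
          show "a x = a' x" by (rule inj_onD[OF injg that(3)]) (use that in \<open>auto intro: span_base\<close>)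
        qed
        have injB: "b = b'" if "b \<in> CB" "b' \<in> CB" "?h (b y) = ?h (b' y)" for b b'
        proof (rule inj_onD[OF frB(1) _ that(1,2)])
          show "b y = b' y" by (rule inj_onD[OF injh that(3)]) (use that in \<open>auto intro: span_base\<close>)
        qed
        fix w w' assume w: "w \<in> DA ` CA \<union> DB ` CB" "w' \<in> DA ` CA \<union> DB ` CB" "w z = w' z"
        consider a a' where "w = DA a" "w' = DA a'" "a \<in> CA" "a' \<in> CA"
          | b b' where "w = DB b" "w' = DB b'" "b \<in> CB" "b' \<in> CB"
          | a b where "w = DA a" "w' = DB b" "a \<in> CA" "b \<in> CB"
          | a b where "w = DB b" "w' = DA a" "a \<in> CA" "b \<in> CB"
          using w(1,2) by blast
        then show "w = w'"
        proof cases
          case 1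
          then have "?g (a x) = ?g (a' x)" using w(3) unfolding z by (simp add: DA)
          then show ?thesis using injA 1 by blast
        next
          case 2
          then have "?h (b y) = ?h (b' y)" using w(3) unfolding z by (simp add: DB)
          then show ?thesis using injB 2 by blast
        next
          case 3
          then have "?g (a x) = ?h (b y)" using w(3) unfolding z by (simp add: DA DB)
          then show ?thesis using cross 3 by blast
        next
          case 4
          then have "?g (a x) = ?h (b y)" using w(3) unfolding z by (simp add: DA DB)
          then show ?thesis using cross 4 by blast
        qed
      qed
      ultimately show "inj_on (\<lambda>w. w z) {w \<in> ?\<Omega>. w z \<noteq> 0} \<and> independent ((\<lambda>w. w z) ` {w \<in> ?\<Omega>. w z \<noteq> 0})"
        unfolding N image_Un[of "\<lambda>w. w z"] evA evB by blast
    qed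
    show "spanned ?\<Omega> z = V z" for z
    proof (rule subset_antisym)
      show "spanned ?\<Omega> z \<subseteq> V z" using barA barB by (intro spanned_subset) blast
      obtain x y where z: "z = (x, y)" by (cases z)
      have gA: "f (x, b0) z ` A.spanned (lA ` \<beta> \<union> RA) x \<subseteq> spanned ?\<Omega> z"
        unfolding A.spanned_def f.span_image[symmetric]
      proof (intro span_minimal subspace_spanned image_subsetI)
        fix v assume "v \<in> (\<lambda>w. w x) ` (lA ` \<beta> \<union> RA)"
        then obtain a where "v = a x" "DA a \<in> ?\<Omega>" by blast
        then show "f (x, b0) z v \<in> spanned ?\<Omega> z" using spanned_base[of "DA a" ?\<Omega> z] unfolding DA_def z by simp
      qed
      have gB: "f (a0, y) z ` B.spanned (lB ` \<beta> \<union> RB) y \<subseteq> spanned ?\<Omega> z"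
        unfolding B.spanned_def f.span_image[symmetric]
      proof (intro span_minimal subspace_spanned image_subsetI)
        fix v assume "v \<in> (\<lambda>w. w y) ` (lB ` \<beta> \<union> RB)"
        then obtain b where b: "v = b y" "b \<in> lB ` \<beta> \<union> RB" by blast
        show "f (a0, y) z v \<in> spanned ?\<Omega> z"
          using b(2)
        proof
          assume "b \<in> RB"
          then have "DB b \<in> ?\<Omega>" by blast
          from spanned_base[OF this, of z] show ?thesis unfolding DB_def z b(1) by simp
        next
          \<comment> \<open>Such a bar is already present from the other edge: both transports of
            \<open>v\<close> to \<open>z\<close> equal \<open>f ?o z v\<close>.\<close>
          assume "b \<in> lB ` \<beta>"
          then obtain v where v: "v \<in> \<beta>" "b = lB v" by blast
          then have "DA (lA v) \<in> ?\<Omega>" by blast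
          from spanned_base[OF this, of z] show ?thesis
            using DA_lA[OF v(1)] comp(2)[OF \<beta>V[OF v(1)]] unfolding z b(1) v(2) lB_def by simp
        qed
      qed
      show "V z \<subseteq> spanned ?\<Omega> z"
      proof
        fix d assume "d \<in> V z"
        then obtain a b where ab: "a \<in> V (x, b0)" "b \<in> V (a0, y)" "d = f (x, b0) z a + f (a0, y) z b"
          using surj unfolding z by blast
        have "f (x, b0) z a \<in> spanned ?\<Omega> z" using gA ab(1) RA(3) by blast
        moreover have "f (a0, y) z b \<in> spanned ?\<Omega> z" using gB ab(2) RB(3) by blast
        ultimately show "d \<in> spanned ?\<Omega> z" unfolding ab(3) by (rule subspace_add[OF subspace_spanned])
      qed
    qed
    fix w assume "w \<in> ?\<Omega>"
    then consider v where "v \<in> \<beta>" "w = DA (lA v)" | a where "a \<in> RA" "w = DA a" | b where "b \<in> RB" "w = DB b"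
      by blast
    then show "(\<exists>J K. down_closed J \<and> down_closed K \<and> {z. w z \<noteq> 0} = J \<times> K) \<or>
      (\<exists>J. poset_interval J \<and> {z. w z \<noteq> 0} = J \<times> UNIV) \<or>
      (\<exists>K. poset_interval K \<and> {z. w z \<noteq> 0} = UNIV \<times> K)"
    proof cases
      case 1
      let ?J = "{x. lA v x \<noteq> 0}" and ?K = "{y. lB v y \<noteq> 0}"
      have v: "v \<in> V ?o" using \<beta>V 1 by blast
      have "down_closed ?J"
        unfolding down_closed_def
      proof (intro ballI allI impI CollectI notI)
        fix x x' assume "x \<in> ?J" "x' \<le> x" "lA v x' = 0"
        moreover have "f (x', b0) (x, b0) (lA v x') = lA v x"
          unfolding lA_def using v le \<open>x' \<le> x\<close> by (intro f_comp) auto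
        ultimately show False using f.zero by simp
      qed
      moreover have "down_closed ?K"
        unfolding down_closed_def
      proof (intro ballI allI impI CollectI notI)
        fix y y' assume "y \<in> ?K" "y' \<le> y" "lB v y' = 0"
        moreover have "f (a0, y') (a0, y) (lB v y') = lB v y"
          unfolding lB_def using v le \<open>y' \<le> y\<close> by (intro f_comp) auto
        ultimately show False using f.zero by simp
      qed
      \<comment> \<open>By exactness, \<open>v\<close> survives at \<open>(x, y)\<close> as soon as
        it survives along each edge; this makes the support a product.\<close>
      moreover have "w (x, y) \<noteq> 0 \<longleftrightarrow> lA v x \<noteq> 0 \<and> lB v y \<noteq> 0" for x y
      proof
        assume "w (x, y) \<noteq> 0"
        then have "f ?o (x, y) v \<noteq> 0" using 1 DA_lA by simp
        then show "lA v x \<noteq> 0 \<and> lB v y \<noteq> 0"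
          using comp(1)[OF v, of x y] comp(2)[OF v, of y x] f.zero unfolding lA_def lB_def by metis
      next
        assume nz: "lA v x \<noteq> 0 \<and> lB v y \<noteq> 0"
        show "w (x, y) \<noteq> 0"
        proof
          assume "w (x, y) = 0"
          then have "f (x, b0) (x, y) (lA v x) + f (a0, y) (x, y) 0 = 0"
            using 1 f.zero unfolding DA_def by simp
          moreover have "lA v \<notin> lA ` (\<beta> \<inter> KB y)"
          proof
            assume "lA v \<in> lA ` (\<beta> \<inter> KB y)"
            then obtain v' where v': "v' \<in> \<beta>" "v' \<in> KB y" "lA v = lA v'" by blast
            \<comment> \<open>The value of \<open>lA v\<close> at \<open>a0\<close> is
              \<open>v\<close>, so the bar determines the vector.\<close>
            then have "v = v'" using fun_cong[OF v'(3), of a0] f_id v \<beta>V unfolding lA_def by simp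
            then show False using nz v'(2) unfolding KB_def lB_def by blast
          qed
          moreover have "lA v x \<in> A.spanned {lA v} x" by (rule A.spanned_base) simp
          ultimately have "lA v x = 0 \<and> (0 :: 'v) = 0"
            using 1(1) subspace_0[OF B.subspace_spanned] by (intro kerA[of "{lA v}" y _ x 0]) auto
          then show False using nz by blast
        qed
      qed
      then have "{z. w z \<noteq> 0} = ?J \<times> ?K" by auto
      ultimately show ?thesis by blast
    next
      case 2
      have a: "A.bar a" using RA(1) 2 by blast
      have "w (x, y) \<noteq> 0 \<longleftrightarrow> a x \<noteq> 0" for x y
      proof
        show "a x \<noteq> 0" if "w (x, y) \<noteq> 0" using that 2 f.zero unfolding DA_def by auto
        assume nz: "a x \<noteq> 0"
        show "w (x, y) \<noteq> 0"
        proof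
          assume "w (x, y) = 0"
          then have "f (x, b0) (x, y) (a x) + f (a0, y) (x, y) 0 = 0"
            using 2 f.zero unfolding DA_def by simp
          moreover have "a \<notin> lA ` (\<beta> \<inter> KB y)" using 2 RA(4) by blast
          moreover have "a x \<in> A.spanned {a} x" by (rule A.spanned_base) simp
          ultimately have "a x = 0 \<and> (0 :: 'v) = 0"
            using 2(1) subspace_0[OF B.subspace_spanned] by (intro kerA[of "{a}" y _ x 0]) auto
          then show False using nz by blast
        qed
      qed
      then have "{z. w z \<noteq> 0} = {x. a x \<noteq> 0} \<times> UNIV" by auto
      then show ?thesis using A.bar_support_interval[OF a] by blast
    next
      case 3
      have b: "B.bar b" using RB(1) 3 by blast
      have "w (x, y) \<noteq> 0 \<longleftrightarrow> b y \<noteq> 0" for x y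
      proof
        show "b y \<noteq> 0" if "w (x, y) \<noteq> 0" using that 3 f.zero unfolding DB_def by auto
        assume nz: "b y \<noteq> 0"
        show "w (x, y) \<noteq> 0"
        proof
          assume "w (x, y) = 0"
          then have "f (x, b0) (x, y) 0 + f (a0, y) (x, y) (b y) = 0"
            using 3 f.zero unfolding DB_def by simp
          moreover have "b y \<in> B.spanned RB y" using 3 by (intro B.spanned_base)
          ultimately show False using ker[of 0 x "b y" y] nz subspace_0[OF subspace_V] by blast
        qed
      qed
      then have "{z. w z \<noteq> 0} = UNIV \<times> {y. b y \<noteq> 0}" by auto
      then show ?thesis using B.bar_support_interval[OF b] by blast
    qed
  qed
qed

end

section \<open>The dual case: the pullback of the two edges at the greatest corner\<close>

context grid_persistence
begin

text \<open>By \<open>inj\<close> and \<open>ex\<close>, a vector at \<open>(x, y)\<close> is a pair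
  of vectors on the two edges with the same image at the corner. Accordingly a bar of the grid is
  built from a pair: the two lifts of a vector of \<open>\<beta>\<close>, or a bar that vanishes at
  the corner together with 0.\<close>

theorem bars_to_corner:
  fixes a1 :: 'a and b1 :: 'b
  assumes a1: "\<And>x. x \<le> a1" and b1: "\<And>y. y \<le> b1"
    and inj: "\<And>x y d. d \<in> V (x, y) \<Longrightarrow> f (x, y) (x, b1) d = 0 \<Longrightarrow> f (x, y) (a1, y) d = 0 \<Longrightarrow> d = 0"
    and ex: "\<And>x y a b. a \<in> V (x, b1) \<Longrightarrow> b \<in> V (a1, y) \<Longrightarrow>
      f (x, b1) (a1, b1) a = f (a1, y) (a1, b1) b \<Longrightarrow>
      \<exists>d\<in>V (x, y). f (x, y) (x, b1) d = a \<and> f (x, y) (a1, y) d = b"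
  obtains \<Omega> where "\<And>w. w \<in> \<Omega> \<Longrightarrow> bar w" "free \<Omega>" "\<And>z. spanned \<Omega> z = V z"
    "\<And>w. w \<in> \<Omega> \<Longrightarrow> (\<exists>J K. up_closed J \<and> up_closed K \<and> {z. w z \<noteq> 0} = J \<times> K) \<or>
      (\<exists>J. poset_interval J \<and> {z. w z \<noteq> 0} = J \<times> UNIV) \<or>
      (\<exists>K. poset_interval K \<and> {z. w z \<noteq> 0} = UNIV \<times> K)"
proof -
  let ?o = "(a1, b1)"
  interpret A: chain_persistence scale "\<lambda>x. V (x, b1)" "\<lambda>x y. f (x, b1) (y, b1)"
    by (rule chain_restrict) simp
  interpret B: chain_persistence scale "\<lambda>y. V (a1, y)" "\<lambda>x y. f (a1, x) (a1, y)"
    by (rule chain_restrict) simp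
  define IA where "IA x = f (x, b1) ?o ` V (x, b1)" for x
  define IB where "IB y = f (a1, y) ?o ` V (a1, y)" for y
  have le: "z \<le> ?o" "(x, y) \<le> (x, b1)" "(x, y) \<le> (a1, y)" "(x, b1) \<le> ?o" "(a1, y) \<le> ?o" for x y z
    using a1 b1 by (cases z; simp)+
  have Imono: "f z ?o ` V z \<subseteq> f z' ?o ` V z'" if "z \<le> z'" for z z'
  proof
    fix u assume "u \<in> f z ?o ` V z"
    then obtain v where v: "v \<in> V z" "u = f z ?o v" by blast
    then have "u = f z' ?o (f z z' v)" using f_comp[OF that le(1)] by simp
    then show "u \<in> f z' ?o ` V z'" using f_in[OF that v(1)] by blast
  qed
  have IV: "f z ?o ` V z \<subseteq> V ?o" for z using f_in[OF le(1)] by blast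
  have subI: "subspace (f z ?o ` V z)" for z by (rule f.subspace_image[OF subspace_V])
  obtain E where E: "finite E" "span E = V ?o" using fin_V by blast
  obtain \<beta> where \<beta>: "independent \<beta>" "span \<beta> = V ?o"
    "\<And>P. P \<in> range IA \<Longrightarrow> P \<subseteq> span (\<beta> \<inter> P)" "\<And>Q. Q \<in> range IB \<Longrightarrow> Q \<subseteq> span (\<beta> \<inter> Q)"
  proof (rule adapted_basis_of_two_flags[OF E(1), of "V ?o" "range IA" "range IB"])
    show "P \<subseteq> P' \<or> P' \<subseteq> P" if P: "P \<in> range IA" "P' \<in> range IA" for P P'
    proof -
      obtain x x' where "P = IA x" "P' = IA x'" using P by blast
      then show ?thesis
        using linear[of x x'] Imono[of "(x, b1)" "(x', b1)"] Imono[of "(x', b1)" "(x, b1)"]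
        unfolding IA_def by auto
    qed
    show "P \<subseteq> P' \<or> P' \<subseteq> P" if P: "P \<in> range IB" "P' \<in> range IB" for P P'
    proof -
      obtain y y' where "P = IB y" "P' = IB y'" using P by blast
      then show ?thesis
        using linear[of y y'] Imono[of "(a1, y)" "(a1, y')"] Imono[of "(a1, y')" "(a1, y)"]
        unfolding IB_def by auto
    qed
    show "subspace P" "P \<subseteq> V ?o" if P: "P \<in> range IA" for P
    proof -
      obtain x where x: "P = IA x" using P by blast
      show "subspace P" "P \<subseteq> V ?o" unfolding x IA_def by (rule subI, rule IV)
    qed
    show "subspace P" "P \<subseteq> V ?o" if P: "P \<in> range IB" for P
    proof -
      obtain x where x: "P = IB x" using P by blast
      show "subspace P" "P \<subseteq> V ?o" unfolding x IB_def by (rule subI, rule IV)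
    qed
  qed (use E(2) subspace_V in auto)
  have \<beta>V: "v \<in> V ?o" if "v \<in> \<beta>" for v using span_base[OF that] \<beta>(2) by simp
  have ne0: "v \<noteq> 0" if "v \<in> \<beta>" for v using that \<beta>(1) dependent_zero by blast
  have imA: "f (x, b1) ?o ` V (x, b1) \<subseteq> span (\<beta> \<inter> f (x, b1) ?o ` V (x, b1))" for x
    using \<beta>(3)[of "IA x"] unfolding IA_def by simp
  have imB: "f (a1, y) ?o ` V (a1, y) \<subseteq> span (\<beta> \<inter> f (a1, y) ?o ` V (a1, y))" for y
    using \<beta>(4)[of "IB y"] unfolding IB_def by simp
  obtain lA RA where A': "\<forall>w\<in>lA ` \<beta> \<union> RA. A.bar w" "A.free (lA ` \<beta> \<union> RA)"
    "\<forall>x. A.spanned (lA ` \<beta> \<union> RA) x = V (x, b1)" "\<forall>v\<in>\<beta>. lA v a1 = v"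
    "\<forall>v\<in>\<beta>. \<forall>x. v \<in> f (x, b1) ?o ` V (x, b1) \<longrightarrow> f (x, b1) ?o (lA v x) = v"
    "\<forall>x. \<forall>\<sigma>\<in>A.spanned (lA ` \<beta>) x. f (x, b1) ?o \<sigma> = 0 \<longrightarrow> \<sigma> = 0" "\<forall>w\<in>RA. w a1 = 0"
    by (rule A.bar_decomposition_to_greatest[OF a1 \<beta>(1,2) imA])
  note RA = A'(1)[rule_format] A'(2) A'(3)[rule_format] and lA = A'(4-6)[rule_format]
    and RA0 = A'(7)[rule_format]
  obtain lB RB where B': "\<forall>w\<in>lB ` \<beta> \<union> RB. B.bar w" "B.free (lB ` \<beta> \<union> RB)"
    "\<forall>x. B.spanned (lB ` \<beta> \<union> RB) x = V (a1, x)" "\<forall>v\<in>\<beta>. lB v b1 = v"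
    "\<forall>v\<in>\<beta>. \<forall>x. v \<in> f (a1, x) ?o ` V (a1, x) \<longrightarrow> f (a1, x) ?o (lB v x) = v"
    "\<forall>x. \<forall>\<sigma>\<in>B.spanned (lB ` \<beta>) x. f (a1, x) ?o \<sigma> = 0 \<longrightarrow> \<sigma> = 0" "\<forall>w\<in>RB. w b1 = 0"
    by (rule B.bar_decomposition_to_greatest[OF b1 \<beta>(1,2) imB])
  note RB = B'(1)[rule_format] B'(2) B'(3)[rule_format] and lB = B'(4-6)[rule_format]
    and RB0 = B'(7)[rule_format]
  define p where "p z = f z (fst z, b1)" for z
  define q where "q z = f z (a1, snd z)" for z
  \<comment> \<open>The pair \<open>(a, b)\<close> as a vector of \<open>V z\<close>: it exists when
    the images at the corner agree, and it is unique by \<open>inj\<close>.\<close>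
  define pr where "pr z a b = (SOME d. d \<in> V z \<and> p z d = a \<and> q z d = b)" for z a b
  have pr: "pr z a b \<in> V z" "p z (pr z a b) = a" "q z (pr z a b) = b"
    if ab: "a \<in> V (fst z, b1)" "b \<in> V (a1, snd z)" "f (fst z, b1) ?o a = f (a1, snd z) ?o b" for z a b
  proof -
    have "\<exists>d. d \<in> V z \<and> p z d = a \<and> q z d = b" using ex[OF ab] unfolding p_def q_def by auto
    from someI_ex[OF this] show "pr z a b \<in> V z" "p z (pr z a b) = a" "q z (pr z a b) = b"
      unfolding pr_def by blast+
  qed
  have pq0: "d = 0" if "d \<in> V z" "p z d = 0" "q z d = 0" for z d
    using inj[of d "fst z" "snd z"] that unfolding p_def q_def by simp
  have pqV: "p z d \<in> V (fst z, b1)" "q z d \<in> V (a1, snd z)" if "d \<in> V z" for z d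
    using f_in[OF _ that] a1 b1 unfolding p_def q_def by (auto simp: less_eq_prod_def)
  have pq_comp: "f (fst z, b1) ?o (p z d) = f z ?o d" "f (a1, snd z) ?o (q z d) = f z ?o d" if "d \<in> V z" for z d
    using f_comp[OF _ _ that] a1 b1 unfolding p_def q_def by (auto simp: less_eq_prod_def)
  have p_lin: "p z (c + d) = p z c + p z d" "p z (c - d) = p z c - p z d" "p z (r *s d) = r *s p z d" "p z 0 = 0"
    "q z (c + d) = q z c + q z d" "q z (c - d) = q z c - q z d" "q z (r *s d) = r *s q z d" "q z 0 = 0" for z c d r
    unfolding p_def q_def by (simp_all add: f.add f.diff f.scale f.zero)
  \<comment> \<open>Joint injectivity of \<open>p\<close> and \<open>q\<close> reduces the bar
    condition to the two edges.\<close>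
  have barI': "bar w"
    if wV: "\<And>z. w z \<in> V z"
      and wp: "\<And>z z'. z \<le> z' \<Longrightarrow> w z \<noteq> 0 \<Longrightarrow> f (fst z, b1) (fst z', b1) (p z (w z)) = p z' (w z')"
      and wq: "\<And>z z'. z \<le> z' \<Longrightarrow> w z \<noteq> 0 \<Longrightarrow> f (a1, snd z) (a1, snd z') (q z (w z)) = q z' (w z')" for w
  proof (rule barI[OF wV])
    fix z z' assume z: "z \<le> z'" "w z \<noteq> 0"
    have le': "z \<le> (fst z, b1)" "(fst z, b1) \<le> (fst z', b1)" "z' \<le> (fst z', b1)"
      "z \<le> (a1, snd z)" "(a1, snd z) \<le> (a1, snd z')" "z' \<le> (a1, snd z')"
      using z(1) a1 b1 by (auto simp: less_eq_prod_def)
    have "p z' (f z z' (w z)) = f (fst z, b1) (fst z', b1) (p z (w z))"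
      unfolding p_def using f_comp[OF le'(1,2) wV] f_comp[OF z(1) le'(3) wV] by simp
    moreover have "q z' (f z z' (w z)) = f (a1, snd z) (a1, snd z') (q z (w z))"
      unfolding q_def using f_comp[OF le'(4,5) wV] f_comp[OF z(1) le'(6) wV] by simp
    ultimately have "p z' (f z z' (w z) - w z') = 0" "q z' (f z z' (w z) - w z') = 0"
      using wp[OF z] wq[OF z] p_lin by simp_all
    moreover have "f z z' (w z) - w z' \<in> V z'" using f_in[OF z(1) wV] wV subspace_diff[OF subspace_V] by blast
    ultimately have "f z z' (w z) - w z' = 0" by (rule pq0[rotated])
    then show "f z z' (w z) = w z'" by simp
  qed
  have lA_ne0: "v \<in> f (x, b1) ?o ` V (x, b1) \<and> f (x, b1) ?o (lA v x) = v" if "v \<in> \<beta>" "lA v x \<noteq> 0" for v x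
  proof -
    have bar: "A.bar (lA v)" using RA(1) that(1) by blast
    then have "f (x, b1) ?o (lA v x) = v" "lA v x \<in> V (x, b1)"
      using A.barD(2)[OF bar a1 that(2)] A.barD(1)[OF bar] lA(1)[OF that(1)] by auto
    then show ?thesis by force
  qed
  have lB_ne0: "v \<in> f (a1, x) ?o ` V (a1, x) \<and> f (a1, x) ?o (lB v x) = v" if "v \<in> \<beta>" "lB v x \<noteq> 0" for v x
  proof -
    have bar: "B.bar (lB v)" using RB(1) that(1) by blast
    then have "f (a1, x) ?o (lB v x) = v" "lB v x \<in> V (a1, x)"
      using B.barD(2)[OF bar b1 that(2)] B.barD(1)[OF bar] lB(1)[OF that(1)] by auto
    then show ?thesis by force
  qed
  have RA_ker: "f (x, b1) ?o (a x) = 0" if "a \<in> RA" for a x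
  proof (cases "a x = 0")
    case True
    then show ?thesis by (simp add: f.zero)
  next
    case False
    have bar: "A.bar a" using RA(1) that by blast
    then show ?thesis using A.barD(2)[OF bar a1 False] RA0[OF that] by simp
  qed
  have RB_ker: "f (a1, y) ?o (b y) = 0" if "b \<in> RB" for b y
  proof (cases "b y = 0")
    case True
    then show ?thesis by (simp add: f.zero)
  next
    case False
    have bar: "B.bar b" using RB(1) that by blast
    then show ?thesis using B.barD(2)[OF bar b1 False] RB0[OF that] by simp
  qed
  have disj: "a \<notin> lA ` \<beta>" if "a \<in> RA" for a
  proof
    assume "a \<in> lA ` \<beta>"
    then obtain v where "v \<in> \<beta>" "a = lA v" by blast
    then show False using lA(1) ne0 RA0[OF that] by metis
  qed
  \<comment> \<open>The partner of \<open>a\<close> on the other edge. For \<open>a = lA v\<close>,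
    the vector \<open>v\<close> is recovered as the value at \<open>a1\<close>.\<close>
  define m where "m a = (if a \<in> lA ` \<beta> then lB (a a1) else (\<lambda>_. 0))" for a
  have m_lA: "m (lA v) = lB v" if "v \<in> \<beta>" for v using that lA(1) unfolding m_def by simp
  have m_RA: "m a = (\<lambda>_. 0)" if "a \<in> RA" for a using disj[OF that] unfolding m_def by simp
  \<comment> \<open>For a vector \<open>v\<close> of \<open>\<beta>\<close> both lifts must be
    nonzero: a nonzero lift has image \<open>v\<close> at the corner and is thus incompatible with
    0. Bars of \<open>RA\<close> have partner 0, so only their own value counts.\<close>
  define alive where "alive a z \<longleftrightarrow> a (fst z) \<noteq> 0 \<and> (a \<in> lA ` \<beta> \<longrightarrow> m a (snd z) \<noteq> 0)" for a z
  define DA where "DA a z = (if alive a z then pr z (a (fst z)) (m a (snd z)) else 0)" for a z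
  define DB where "DB b z = pr z 0 (b (snd z))" for b z
  have DA: "DA a z \<in> V z" "p z (DA a z) = a (fst z)" "q z (DA a z) = m a (snd z)"
    if a: "a \<in> lA ` \<beta> \<union> RA" and al: "alive a z" for a z
  proof -
    have "a (fst z) \<in> V (fst z, b1)" using A.barD(1)[OF RA(1)[OF a]] .
    moreover have "m a (snd z) \<in> V (a1, snd z) \<and> f (fst z, b1) ?o (a (fst z)) = f (a1, snd z) ?o (m a (snd z))"
      using a
    proof
      assume "a \<in> lA ` \<beta>"
      then obtain v where v: "v \<in> \<beta>" "a = lA v" by blast
      then have "lA v (fst z) \<noteq> 0" "lB v (snd z) \<noteq> 0" using al m_lA unfolding alive_def by auto
      then show ?thesis
        using lA_ne0[OF v(1)] lB_ne0[OF v(1)] B.barD(1)[OF RB(1)] v m_lA by auto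
    next
      assume "a \<in> RA"
      then show ?thesis using RA_ker m_RA subspace_0[OF subspace_V] f.zero by simp
    qed
    ultimately show "DA a z \<in> V z" "p z (DA a z) = a (fst z)" "q z (DA a z) = m a (snd z)"
      using pr al unfolding DA_def by simp_all
  qed
  have DA_alive: "DA a z \<noteq> 0 \<longleftrightarrow> alive a z" if a: "a \<in> lA ` \<beta> \<union> RA" for a z
  proof
    show "alive a z" if "DA a z \<noteq> 0" using that unfolding DA_def by presburger
    show "DA a z \<noteq> 0" if al: "alive a z"
    proof
      assume "DA a z = 0"
      then have "a (fst z) = 0" using DA(2)[OF a al] p_lin(4) by simp
      then show False using al unfolding alive_def by simp
    qed
  qed
  have DA_V: "DA a z \<in> V z" if a: "a \<in> lA ` \<beta> \<union> RA" for a z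
    using DA(1)[OF a] subspace_0[OF subspace_V] unfolding DA_def by (cases "alive a z") simp_all
  have DA_RA: "p z (DA a z) = a (fst z)" "q z (DA a z) = 0" if a: "a \<in> RA" for a z
  proof -
    have "p z (DA a z) = a (fst z) \<and> q z (DA a z) = 0"
    proof (cases "alive a z")
      case True
      then show ?thesis using DA(2,3)[of a z] a m_RA by simp
    next
      case False
      then have "a (fst z) = 0" using disj[OF a] unfolding alive_def by blast
      then show ?thesis using False p_lin unfolding DA_def by simp
    qed
    then show "p z (DA a z) = a (fst z)" "q z (DA a z) = 0" by auto
  qed
  have upA: "lA v x' \<noteq> 0" if "v \<in> \<beta>" "lA v x \<noteq> 0" "x \<le> x'" for v x x'
  proof -
    have "A.bar (lA v)" using RA(1) that(1) by blast
    moreover have "lA v a1 \<noteq> 0" using lA(1) ne0 that(1) by simp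
    ultimately show ?thesis using A.bar_support_convex[of "lA v"] that(2,3) a1 by blast
  qed
  have upB: "lB v y' \<noteq> 0" if "v \<in> \<beta>" "lB v y \<noteq> 0" "y \<le> y'" for v y y'
  proof -
    have "B.bar (lB v)" using RB(1) that(1) by blast
    moreover have "lB v b1 \<noteq> 0" using lB(1) ne0 that(1) by simp
    ultimately show ?thesis using B.bar_support_convex[of "lB v"] that(2,3) b1 by blast
  qed
  have barA: "bar (DA a)" if a: "a \<in> lA ` \<beta> \<union> RA" for a
  proof (rule barI')
    show "DA a z \<in> V z" for z by (rule DA_V[OF a])
    fix z z' assume z: "z \<le> z'" "DA a z \<noteq> 0"
    have al: "alive a z" using z(2) DA_alive[OF a] by blast
    have zz: "fst z \<le> fst z'" "snd z \<le> snd z'" using z(1) by (auto simp: less_eq_prod_def)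
    have fa: "f (fst z, b1) (fst z', b1) (a (fst z)) = a (fst z')"
      using A.barD(2)[OF RA(1)[OF a] zz(1)] al unfolding alive_def by blast
    have "a (fst z') = p z' (DA a z') \<and> f (a1, snd z) (a1, snd z') (m a (snd z)) = q z' (DA a z')"
      using a
    proof
      assume "a \<in> RA"
      then show ?thesis using DA_RA m_RA f.zero by simp
    next
      assume "a \<in> lA ` \<beta>"
      then obtain v where v: "v \<in> \<beta>" "a = lA v" by blast
      then have nz: "lA v (fst z) \<noteq> 0" "lB v (snd z) \<noteq> 0" using al m_lA unfolding alive_def by auto
      have "alive a z'"
        unfolding alive_def v(2) m_lA[OF v(1)] using upA[OF v(1) nz(1) zz(1)] upB[OF v(1) nz(2) zz(2)] by blast
      moreover have "f (a1, snd z) (a1, snd z') (lB v (snd z)) = lB v (snd z')"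
        using B.barD(2)[of "lB v", OF _ zz(2) nz(2)] RB(1) v(1) by blast
      ultimately show ?thesis using DA(2,3)[OF a] m_lA[OF v(1)] unfolding v(2) by simp
    qed
    then show "f (fst z, b1) (fst z', b1) (p z (DA a z)) = p z' (DA a z')"
      "f (a1, snd z) (a1, snd z') (q z (DA a z)) = q z' (DA a z')"
      using DA(2,3)[OF a al] fa by simp_all
  qed
  have DB: "DB b z \<in> V z" "p z (DB b z) = 0" "q z (DB b z) = b (snd z)" if b: "b \<in> RB" for b z
  proof -
    have "b (snd z) \<in> V (a1, snd z)" using B.barD(1)[OF RB(1)] b by blast
    moreover have "f (fst z, b1) ?o 0 = f (a1, snd z) ?o (b (snd z))" using RB_ker[OF b] f.zero by simp
    ultimately show "DB b z \<in> V z" "p z (DB b z) = 0" "q z (DB b z) = b (snd z)"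
      unfolding DB_def using pr subspace_0[OF subspace_V] by blast+
  qed
  have DB_alive: "DB b z \<noteq> 0 \<longleftrightarrow> b (snd z) \<noteq> 0" if b: "b \<in> RB" for b z
    using DB[OF b, of z] pq0[of "DB b z" z] p_lin(8) by metis
  have barB: "bar (DB b)" if b: "b \<in> RB" for b
  proof (rule barI')
    show "DB b z \<in> V z" for z by (rule DB(1)[OF b])
    fix z z' assume z: "z \<le> z'" "DB b z \<noteq> 0"
    show "f (fst z, b1) (fst z', b1) (p z (DB b z)) = p z' (DB b z')" using DB(2)[OF b] f.zero by simp
    have "snd z \<le> snd z'" using z(1) by (auto simp: less_eq_prod_def)
    then show "f (a1, snd z) (a1, snd z') (q z (DB b z)) = q z' (DB b z')"
      using DB(3)[OF b] B.barD(2)[OF RB(1)] b z(2) DB_alive[OF b] by simp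
  qed
  let ?\<Omega> = "DA ` (lA ` \<beta> \<union> RA) \<union> DB ` RB"
  show thesis
  proof (rule that)
    show "bar w" if "w \<in> ?\<Omega>" for w using that barA barB by blast
    show "free ?\<Omega>"
      unfolding free_def
    proof (rule allI)
      fix z :: "'a \<times> 'b"
      define CA where "CA = {a \<in> lA ` \<beta> \<union> RA. DA a z \<noteq> 0}"
      define CB where "CB = {b \<in> RB. DB b z \<noteq> 0}"
      have CA: "a \<in> lA ` \<beta> \<union> RA" "p z (DA a z) = a (fst z)" "a (fst z) \<noteq> 0" if "a \<in> CA" for a
      proof -
        show a: "a \<in> lA ` \<beta> \<union> RA" using that unfolding CA_def by blast
        have al: "alive a z" using that DA_alive[OF a] unfolding CA_def by blast
        show "p z (DA a z) = a (fst z)" by (rule DA(2)[OF a al])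
        show "a (fst z) \<noteq> 0" using al unfolding alive_def by blast
      qed
      have CB: "b \<in> RB" "p z (DB b z) = 0" "q z (DB b z) = b (snd z)" "b (snd z) \<noteq> 0" if "b \<in> CB" for b
      proof -
        show b: "b \<in> RB" using that unfolding CB_def by blast
        show "p z (DB b z) = 0" "q z (DB b z) = b (snd z)" by (rule DB[OF b])+
        show "b (snd z) \<noteq> 0" using that DB_alive[OF b] unfolding CB_def by blast
      qed
      have frA: "inj_on (\<lambda>a. a (fst z)) CA" "independent ((\<lambda>a. a (fst z)) ` CA)"
      proof -
        have sub: "CA \<subseteq> {a \<in> lA ` \<beta> \<union> RA. a (fst z) \<noteq> 0}" using CA by blast
        show "inj_on (\<lambda>a. a (fst z)) CA" using RA(2) inj_on_subset[OF _ sub] unfolding A.free_def by blast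
        show "independent ((\<lambda>a. a (fst z)) ` CA)"
          using RA(2) independent_mono[OF _ image_mono[OF sub]] unfolding A.free_def by blast
      qed
      have frB: "inj_on (\<lambda>b. b (snd z)) CB" "independent ((\<lambda>b. b (snd z)) ` CB)"
      proof -
        have sub: "CB \<subseteq> {b \<in> lB ` \<beta> \<union> RB. b (snd z) \<noteq> 0}" using CB by blast
        show "inj_on (\<lambda>b. b (snd z)) CB" using RB(2) inj_on_subset[OF _ sub] unfolding B.free_def by blast
        show "independent ((\<lambda>b. b (snd z)) ` CB)"
          using RB(2) independent_mono[OF _ image_mono[OF sub]] unfolding B.free_def by blast
      qed
      have linp: "Vector_Spaces.linear scale scale (p z)" "Vector_Spaces.linear scale scale (q z)"
        unfolding p_def q_def by (rule linear_f)+
      interpret p: Vector_Spaces.linear scale scale "p z" by (rule linp)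
      let ?BA = "(\<lambda>a. DA a z) ` CA" and ?BB = "(\<lambda>b. DB b z) ` CB"
      have imA: "p z ` ?BA = (\<lambda>a. a (fst z)) ` CA" unfolding image_image using CA(2) by (rule image_cong[OF refl])
      have imB: "q z ` ?BB = (\<lambda>b. b (snd z)) ` CB" unfolding image_image using CB(3) by (rule image_cong[OF refl])
      have "inj_on (\<lambda>a. p z (DA a z)) CA" using frA(1) CA(2) by (simp cong: inj_on_cong)
      then have injp: "inj_on (p z) ?BA" by (rule inj_on_imageI[unfolded comp_def])
      have "inj_on (\<lambda>b. q z (DB b z)) CB" using frB(1) CB(3) by (simp cong: inj_on_cong)
      then have injq: "inj_on (q z) ?BB" by (rule inj_on_imageI[unfolded comp_def])
      have indA: "independent ?BA" by (rule independent_if_image[OF linp(1) _ injp]) (unfold imA, rule frA(2))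
      have indB: "independent ?BB" by (rule independent_if_image[OF linp(2) _ injq]) (unfold imB, rule frB(2))
      have "inj_on (p z) (span ?BA)"
        by (rule p.inj_on_span_independent_image[OF _ injp]) (unfold imA, rule frA(2))
      then have injp': "d = 0" if "d \<in> span ?BA" "p z d = 0" for d
        using that unfolding p.inj_on_iff_eq_0[OF subspace_span] by blast
      \<comment> \<open>As \<open>p z\<close> is injective on the span of the values of the
        \<open>DA\<close> bars and kills those of the \<open>DB\<close> bars, the two spans meet
        only in 0.\<close>
      have "p z d = 0" if "d \<in> span ?BB" for d
        by (rule p.eq_0_on_span[OF _ that]) (use CB(2) in auto)
      then have "span ?BA \<inter> span ?BB \<subseteq> {0}" using injp' by blast
      then have ind: "independent (?BA \<union> ?BB)" by (rule independent_Un[OF indA indB])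
      have N: "{w \<in> ?\<Omega>. w z \<noteq> 0} = DA ` CA \<union> DB ` CB" unfolding CA_def CB_def by blast
      have ev: "(\<lambda>w. w z) ` (DA ` CA \<union> DB ` CB) = ?BA \<union> ?BB" by (simp only: image_Un image_image)
      have "inj_on (\<lambda>w. w z) (DA ` CA \<union> DB ` CB)"
      proof (rule inj_onI)
        have cross: "DA a z \<noteq> DB b z" if "a \<in> CA" "b \<in> CB" for a b
          using CA(2,3)[OF that(1)] CB(2)[OF that(2)] by metis
        fix w w' assume w: "w \<in> DA ` CA \<union> DB ` CB" "w' \<in> DA ` CA \<union> DB ` CB" "w z = w' z"
        consider a a' where "w = DA a" "w' = DA a'" "a \<in> CA" "a' \<in> CA"
          | b b' where "w = DB b" "w' = DB b'" "b \<in> CB" "b' \<in> CB"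
          | a b where "w = DA a" "w' = DB b" "a \<in> CA" "b \<in> CB"
          | a b where "w = DB b" "w' = DA a" "a \<in> CA" "b \<in> CB"
          using w(1,2) by blast
        then show "w = w'"
        proof cases
          case 1
          then have "a (fst z) = a' (fst z)" using w(3) CA(2) by metis
          then show ?thesis using inj_onD[OF frA(1)] 1 by blast
        next
          case 2
          then have "b (snd z) = b' (snd z)" using w(3) CB(3) by metis
          then show ?thesis using inj_onD[OF frB(1)] 2 by blast
        next
          case 3
          then show ?thesis using cross w(3) by metis
        next
          case 4
          then show ?thesis using cross w(3) by metis
        qed
      qed
      then show "inj_on (\<lambda>w. w z) {w \<in> ?\<Omega>. w z \<noteq> 0} \<and> independent ((\<lambda>w. w z) ` {w \<in> ?\<Omega>. w z \<noteq> 0})"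
        unfolding N ev using ind by blast
    qed
    show "spanned ?\<Omega> z = V z" for z
    proof (rule subset_antisym)
      show "spanned ?\<Omega> z \<subseteq> V z" using barA barB by (intro spanned_subset) blast
      define Z where "Z = spanned ?\<Omega> z"
      have subZ: "subspace Z" unfolding Z_def by (rule subspace_spanned)
      have ZV: "Z \<subseteq> V z" unfolding Z_def by fact
      have DA_Z: "DA a z \<in> Z" if "a \<in> lA ` \<beta> \<union> RA" for a
        unfolding Z_def by (rule spanned_base) (use that in blast)
      have DB_Z: "DB b z \<in> Z" if "b \<in> RB" for b
        unfolding Z_def by (rule spanned_base) (use that in blast)
      interpret p: Vector_Spaces.linear scale scale "p z" unfolding p_def by (rule linear_f)
      interpret q: Vector_Spaces.linear scale scale "q z" unfolding q_def by (rule linear_f)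
      \<comment> \<open>Bars from \<open>RA\<close> and \<open>RB\<close> have zero projection to
        the other edge, so their contributions to the two projections of a vector can be removed
        separately.\<close>
      have 1: "A.spanned RA (fst z) \<subseteq> p z ` {\<zeta> \<in> Z. q z \<zeta> = 0}"
        unfolding A.spanned_def
      proof (intro span_minimal p.subspace_image image_subsetI)
        show "a (fst z) \<in> p z ` {\<zeta> \<in> Z. q z \<zeta> = 0}" if "a \<in> RA" for a
          using DA_RA[OF that] DA_Z that by (intro image_eqI[of _ _ "DA a z"]) auto
        show "subspace {\<zeta> \<in> Z. q z \<zeta> = 0}"
          using subspace_inter[OF subZ q.subspace_kernel] by (simp add: Int_def)
      qed
      have 2: "B.spanned RB (snd z) \<subseteq> q z ` {\<zeta> \<in> Z. p z \<zeta> = 0}"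
        unfolding B.spanned_def
      proof (intro span_minimal q.subspace_image image_subsetI)
        show "b (snd z) \<in> q z ` {\<zeta> \<in> Z. p z \<zeta> = 0}" if "b \<in> RB" for b
          using DB[OF that] DB_Z that by (intro image_eqI[of _ _ "DB b z"]) auto
        show "subspace {\<zeta> \<in> Z. p z \<zeta> = 0}"
          using subspace_inter[OF subZ p.subspace_kernel] by (simp add: Int_def)
      qed
      let ?SA = "A.spanned (lA ` \<beta>) (fst z)" and ?SB = "B.spanned (lB ` \<beta>) (snd z)"
      \<comment> \<open>These vectors of \<open>\<beta>\<close> lift nontrivially on both edges, so
        their bars are alive at \<open>z\<close>. The conditions on the projections keep them in the
        spans on which the maps to the corner are injective.\<close>
      have 3: "span ((\<beta> \<inter> IA (fst z)) \<inter> (\<beta> \<inter> IB (snd z))) \<subseteq> f z ?o ` {\<zeta> \<in> Z. p z \<zeta> \<in> ?SA \<and> q z \<zeta> \<in> ?SB}"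
      proof (intro span_minimal f.subspace_image subsetI)
        have "{\<zeta> \<in> Z. p z \<zeta> \<in> ?SA \<and> q z \<zeta> \<in> ?SB} = Z \<inter> ({\<zeta>. p z \<zeta> \<in> ?SA} \<inter> {\<zeta>. q z \<zeta> \<in> ?SB})" by blast
        then show "subspace {\<zeta> \<in> Z. p z \<zeta> \<in> ?SA \<and> q z \<zeta> \<in> ?SB}"
          using subspace_inter[OF subZ subspace_inter[OF
            p.subspace_linear_preimage[OF A.subspace_spanned] q.subspace_linear_preimage[OF B.subspace_spanned]]]
          by metis
        fix v assume "v \<in> (\<beta> \<inter> IA (fst z)) \<inter> (\<beta> \<inter> IB (snd z))"
        then have v: "v \<in> \<beta>" "v \<in> IA (fst z)" "v \<in> IB (snd z)" by auto
        have lv: "f (fst z, b1) ?o (lA v (fst z)) = v" "f (a1, snd z) ?o (lB v (snd z)) = v"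
          using lA(2)[OF v(1)] lB(2)[OF v(1)] v(2,3) unfolding IA_def IB_def by auto
        have "lA v (fst z) \<noteq> 0" "lB v (snd z) \<noteq> 0" using lv ne0[OF v(1)] f.zero by metis+
        then have al: "alive (lA v) z" unfolding alive_def m_lA[OF v(1)] by blast
        have a: "lA v \<in> lA ` \<beta> \<union> RA" using v(1) by blast
        have "f z ?o (DA (lA v) z) = v" using pq_comp(1)[OF DA_V[OF a, of z]] DA(2)[OF a al] lv(1) by simp
        moreover have "p z (DA (lA v) z) \<in> ?SA" "q z (DA (lA v) z) \<in> ?SB"
          using DA(2,3)[OF a al] m_lA[OF v(1)] v(1) A.spanned_base B.spanned_base by auto
        ultimately show "v \<in> f z ?o ` {\<zeta> \<in> Z. p z \<zeta> \<in> ?SA \<and> q z \<zeta> \<in> ?SB}"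
          using DA_Z[OF a] by (intro image_eqI[of _ _ "DA (lA v) z"]) auto
      qed
      show "V z \<subseteq> spanned ?\<Omega> z"
        unfolding Z_def[symmetric]
      proof
        fix d assume d: "d \<in> V z"
        have "p z d \<in> A.spanned (lA ` \<beta> \<union> RA) (fst z)" unfolding RA(3) by (rule pqV(1)[OF d])
        then obtain \<alpha>0 \<alpha>1 where \<alpha>: "p z d = \<alpha>0 + \<alpha>1" "\<alpha>0 \<in> ?SA" "\<alpha>1 \<in> A.spanned RA (fst z)"
          unfolding A.spanned_def image_Un span_Un by blast
        have "q z d \<in> B.spanned (lB ` \<beta> \<union> RB) (snd z)" unfolding RB(3) by (rule pqV(2)[OF d])
        then obtain \<gamma>0 \<gamma>1 where \<gamma>: "q z d = \<gamma>0 + \<gamma>1" "\<gamma>0 \<in> ?SB" "\<gamma>1 \<in> B.spanned RB (snd z)"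
          unfolding B.spanned_def image_Un span_Un by blast
        obtain \<zeta>1 where \<zeta>1: "\<zeta>1 \<in> Z" "q z \<zeta>1 = 0" "\<alpha>1 = p z \<zeta>1" using 1 \<alpha>(3) by blast
        obtain \<zeta>2 where \<zeta>2: "\<zeta>2 \<in> Z" "p z \<zeta>2 = 0" "\<gamma>1 = q z \<zeta>2" using 2 \<gamma>(3) by blast
        define d' where "d' = d - \<zeta>1 - \<zeta>2"
        have d': "p z d' = \<alpha>0" "q z d' = \<gamma>0" unfolding d'_def using \<alpha>(1) \<gamma>(1) \<zeta>1 \<zeta>2 by (simp_all add: p_lin)
        have d'V: "d' \<in> V z"
          unfolding d'_def using d \<zeta>1(1) \<zeta>2(1) ZV by (intro subspace_diff[OF subspace_V]) auto
        have "f z ?o d' \<in> IA (fst z)" "f z ?o d' \<in> IB (snd z)"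
          unfolding IA_def IB_def
          by (rule image_eqI[where x = "p z d'"], use pq_comp[OF d'V] pqV[OF d'V] in simp_all)
            (rule image_eqI[where x = "q z d'"], use pq_comp[OF d'V] pqV[OF d'V] in simp_all)
        \<comment> \<open>Here the common basis is decisive: a vector in both images is a
          combination of basis vectors that each lie in both.\<close>
        then have "f z ?o d' \<in> span (\<beta> \<inter> IA (fst z)) \<inter> span (\<beta> \<inter> IB (snd z))" using \<beta>(3,4) by blast
        then have "f z ?o d' \<in> span ((\<beta> \<inter> IA (fst z)) \<inter> (\<beta> \<inter> IB (snd z)))"
          using independent_span_disjoint[OF \<beta>(1) Int_lower1 Int_lower1] by blast
        then obtain \<zeta> where \<zeta>: "\<zeta> \<in> Z" "p z \<zeta> \<in> ?SA" "q z \<zeta> \<in> ?SB" "f z ?o d' = f z ?o \<zeta>" using 3 by blast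
        have dV: "d' - \<zeta> \<in> V z" using d'V \<zeta>(1) ZV subspace_diff[OF subspace_V] by blast
        have f0: "f z ?o (d' - \<zeta>) = 0" using \<zeta>(4) by (simp add: f.diff)
        have "p z (d' - \<zeta>) \<in> ?SA"
          using d'(1) \<alpha>(2) \<zeta>(2) subspace_diff[OF A.subspace_spanned] by (simp add: p_lin)
        \<comment> \<open>The image at the corner is 0, and on the span of the lifts the map to the
          corner is injective.\<close>
        then have "p z (d' - \<zeta>) = 0" by (rule lA(3)) (simp only: pq_comp(1)[OF dV] f0)
        moreover have "q z (d' - \<zeta>) \<in> ?SB"
          using d'(2) \<gamma>(2) \<zeta>(3) subspace_diff[OF B.subspace_spanned] by (simp add: p_lin)
        then have "q z (d' - \<zeta>) = 0" by (rule lB(3)) (simp only: pq_comp(2)[OF dV] f0)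
        ultimately have "d' - \<zeta> = 0" by (rule pq0[OF dV])
        then have "d = \<zeta> + \<zeta>2 + \<zeta>1" unfolding d'_def by (simp add: algebra_simps)
        then show "d \<in> Z" using \<zeta>(1) \<zeta>1(1) \<zeta>2(1) subspace_add[OF subZ] by blast
      qed
    qed
    fix w assume "w \<in> ?\<Omega>"
    then consider v where "v \<in> \<beta>" "w = DA (lA v)" | a where "a \<in> RA" "w = DA a" | b where "b \<in> RB" "w = DB b"
      by blast
    then show "(\<exists>J K. up_closed J \<and> up_closed K \<and> {z. w z \<noteq> 0} = J \<times> K) \<or>
      (\<exists>J. poset_interval J \<and> {z. w z \<noteq> 0} = J \<times> UNIV) \<or>
      (\<exists>K. poset_interval K \<and> {z. w z \<noteq> 0} = UNIV \<times> K)"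
    proof cases
      case 1
      have "up_closed {x. lA v x \<noteq> 0}" "up_closed {y. lB v y \<noteq> 0}"
        unfolding up_closed_def using upA[OF 1(1)] upB[OF 1(1)] by blast+
      moreover have "{z. w z \<noteq> 0} = {x. lA v x \<noteq> 0} \<times> {y. lB v y \<noteq> 0}"
      proof -
        have "w z \<noteq> 0 \<longleftrightarrow> lA v (fst z) \<noteq> 0 \<and> lB v (snd z) \<noteq> 0" for z
          using DA_alive[of "lA v" z] 1 m_lA[OF 1(1)] unfolding alive_def by auto
        then show ?thesis by auto
      qed
      ultimately show ?thesis by blast
    next
      case 2
      have "{z. w z \<noteq> 0} = {x. a x \<noteq> 0} \<times> UNIV"
      proof -
        have "w z \<noteq> 0 \<longleftrightarrow> a (fst z) \<noteq> 0" for z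
          using DA_alive[of a z] 2 disj[OF 2(1)] unfolding alive_def by auto
        then show ?thesis by auto
      qed
      then show ?thesis using A.bar_support_interval[of a] RA(1) 2(1) by blast
    next
      case 3
      have "{z. w z \<noteq> 0} = UNIV \<times> {y. b y \<noteq> 0}"
        using DB_alive[OF 3(1)] 3(2) by auto
      then show ?thesis using B.bar_support_interval[of b] RB(1) 3(1) by blast
    qed
  qed
qed

end

section \<open>Codegree one and degree one\<close>

lemma ex_persistence:
  fixes F :: "('k::field, 'p::order, 'v::ab_group_add) vec_diagram"
  assumes "vec_functor F" and "pointwise_fin_dim F"
  shows "\<exists>f. persistence (smult F) (obj F) f \<and> (\<forall>x y. x \<le> y \<longrightarrow> (\<forall>v\<in>obj F x. f x y v = arr F x y v))"
proof -
  note F = assms(1)[unfolded vec_functor_def]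
  interpret vector_space "smult F" by (rule conjunct1[OF F])
  note sub = F[THEN conjunct2, THEN conjunct1, rule_format]
    and hom = F[THEN conjunct2, THEN conjunct2, THEN conjunct1, rule_format]
    and arr_id = F[THEN conjunct2, THEN conjunct2, THEN conjunct2, THEN conjunct1, rule_format]
    and arr_comp = F[THEN conjunct2, THEN conjunct2, THEN conjunct2, THEN conjunct2, rule_format]
  have ex: "\<exists>g. Vector_Spaces.linear (smult F) (smult F) g \<and> (x \<le> y \<longrightarrow> (\<forall>v\<in>obj F x. g v = arr F x y v))" for x y
  proof (cases "x \<le> y")
    case True
    then show ?thesis using linear_subspace_extension[OF sub hom[OF True]] by blast
  next
    case False
    \<comment> \<open>Without \<open>x \<le> y\<close> any linear map will do; the identity is
      taken.\<close>
    have "Vector_Spaces.linear (smult F) (smult F) (\<lambda>v. v)"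
      unfolding Vector_Spaces.linear_iff using vector_space_axioms by simp
    then show ?thesis using False by blast
  qed
  define f where "f x y = (SOME g. Vector_Spaces.linear (smult F) (smult F) g \<and>
      (x \<le> y \<longrightarrow> (\<forall>v\<in>obj F x. g v = arr F x y v)))" for x y
  have f: "Vector_Spaces.linear (smult F) (smult F) (f x y)"
    "x \<le> y \<Longrightarrow> v \<in> obj F x \<Longrightarrow> f x y v = arr F x y v" for x y v
    using someI_ex[OF ex[of x y]] unfolding f_def by blast+
  have "persistence (smult F) (obj F) f"
  proof
    show "\<exists>E. finite E \<and> span E = obj F x" for x
      using assms(2) unfolding pointwise_fin_dim_def fin_dim_subspace_def by blast
    show f_in: "f x y v \<in> obj F y" if "x \<le> y" "v \<in> obj F x" for x y v
      using f(2)[OF that] hom[OF that(1)] that(2) unfolding vec_hom_def by simp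
    show "f x x v = v" if "v \<in> obj F x" for x v
      using f(2)[OF order_refl that] arr_id[OF that] by simp
    show "f y z (f x y v) = f x z v" if "x \<le> y" "y \<le> z" "v \<in> obj F x" for x y z v
      using f(2)[OF that(1,3)] f(2)[OF that(2) f_in[OF that(1,3)]]
        f(2)[OF order_trans[OF that(1,2)] that(3)] arr_comp[OF that] by simp
  qed (use sub f(1)[unfolded Vector_Spaces.linear_iff] in simp_all)
  then show ?thesis using f(2) by blast
qed

lemma decomposes_if_codegree_1:
  fixes F :: "('k::field, ennreal \<times> ennreal, 'v::ab_group_add) vec_diagram"
  assumes F: "vec_functor F" and fin: "pointwise_fin_dim F" and cod: "codegree_1 F"
  shows "decomposes_into_intervals F (\<lambda>I. death_block I \<or> vertical_block I \<or> horizontal_block I)"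
proof -
  obtain f where f: "persistence (smult F) (obj F) f"
    and f_arr: "\<forall>x y. x \<le> y \<longrightarrow> (\<forall>v\<in>obj F x. f x y v = arr F x y v)"
    using ex_persistence[OF F fin] by blast
  have arr: "arr F x y v = f x y v" if "x \<le> y" "v \<in> obj F x" for x y v
    by (rule f_arr[rule_format, OF that, symmetric])
  interpret persistence "smult F" "obj F" f by (rule f)
  interpret grid_persistence "smult F" "obj F" f ..
  \<comment> \<open>The elements \<open>(x, 0)\<close> and \<open>(0, y)\<close> have infimum
    \<open>(0, 0)\<close> and supremum \<open>(x, y)\<close>, so this square recovers every value
    from the two edges.\<close>
  have po: "pushout_square (smult F) (smult F) (obj F (0, 0)) (obj F (x, 0)) (obj F (0, y)) (obj F (x, y))
      (arr F (0, 0) (x, 0)) (arr F (0, 0) (0, y)) (arr F (x, 0) (x, y)) (arr F (0, y) (x, y))" for x y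
    using cod[unfolded codegree_1_def, rule_format, of "(x, 0)" "(0, y)"]
    by (simp add: inf_prod_def sup_prod_def inf.absorb2 inf.absorb1 sup.absorb1 sup.absorb2)
  obtain \<Omega> where \<Omega>: "\<And>w. w \<in> \<Omega> \<Longrightarrow> bar w" "free \<Omega>" "\<And>z. spanned \<Omega> z = obj F z"
    "\<And>w. w \<in> \<Omega> \<Longrightarrow> (\<exists>J K. down_closed J \<and> down_closed K \<and> {z. w z \<noteq> 0} = J \<times> K) \<or>
      (\<exists>J. poset_interval J \<and> {z. w z \<noteq> 0} = J \<times> UNIV) \<or>
      (\<exists>K. poset_interval K \<and> {z. w z \<noteq> 0} = UNIV \<times> K)"
  proof (rule bars_from_corner[of 0 0])
    fix x y :: ennreal and d assume "d \<in> obj F (x, y)"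
    then obtain b c where *: "b \<in> obj F (x, 0)" "c \<in> obj F (0, y)"
      "d = arr F (x, 0) (x, y) b + arr F (0, y) (x, y) c"
      by (rule pushout_square_surj[OF vector_space_axioms subspace_V subspace_V subspace_V subspace_V po])
    then show "\<exists>a\<in>obj F (x, 0). \<exists>b\<in>obj F (0, y). d = f (x, 0) (x, y) a + f (0, y) (x, y) b"
      using arr by (intro bexI[OF _ *(1)] bexI[OF _ *(2)]) simp
  next
    fix x y :: ennreal and a b
    assume ab: "a \<in> obj F (x, 0)" "b \<in> obj F (0, y)" "f (x, 0) (x, y) a + f (0, y) (x, y) b = 0"
    then have "arr F (x, 0) (x, y) a + arr F (0, y) (x, y) b = 0" using arr by simp
    then obtain u where "u \<in> obj F (0, 0)" "a = arr F (0, 0) (x, 0) u" "b = - arr F (0, 0) (0, y) u"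
      by (rule pushout_square_exact[OF vector_space_axioms subspace_V subspace_V subspace_V subspace_V po ab(1,2)])
    then show "\<exists>u\<in>obj F (0, 0). a = f (0, 0) (x, 0) u \<and> b = - f (0, 0) (0, y) u"
      using arr by auto
  qed auto
  show ?thesis
  proof (rule decomposes_into_intervals_if_bars[OF refl refl arr \<Omega>(1-3)])
    fix w assume w: "w \<in> \<Omega>"
    have pU: "poset_interval (UNIV :: ennreal set)" by (rule poset_interval_chain) simp
    have pd: "poset_interval J" if "down_closed J" for J :: "ennreal set"
      using that unfolding down_closed_def by (intro poset_interval_chain) blast
    show "death_block {z. w z \<noteq> 0} \<or> vertical_block {z. w z \<noteq> 0} \<or> horizontal_block {z. w z \<noteq> 0}"
      using \<Omega>(4)[OF w] poset_interval_Times pU pd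
      unfolding death_block_def vertical_block_def horizontal_block_def by metis
  qed
qed

lemma decomposes_if_degree_1:
  fixes F :: "('k::field, ennreal \<times> ennreal, 'v::ab_group_add) vec_diagram"
  assumes F: "vec_functor F" and fin: "pointwise_fin_dim F" and deg: "degree_1 F"
  shows "decomposes_into_intervals F (\<lambda>I. birth_block I \<or> vertical_block I \<or> horizontal_block I)"
proof -
  let ?i = "top :: ennreal"
  obtain f where f: "persistence (smult F) (obj F) f"
    and f_arr: "\<forall>x y. x \<le> y \<longrightarrow> (\<forall>v\<in>obj F x. f x y v = arr F x y v)"
    using ex_persistence[OF F fin] by blast
  have arr: "arr F x y v = f x y v" if "x \<le> y" "v \<in> obj F x" for x y v
    by (rule f_arr[rule_format, OF that, symmetric])
  interpret persistence "smult F" "obj F" f by (rule f)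
  interpret grid_persistence "smult F" "obj F" f ..
  \<comment> \<open>Dually, \<open>(x, ?i)\<close> and \<open>(?i, y)\<close> have infimum
    \<open>(x, y)\<close> and supremum \<open>(?i, ?i)\<close>.\<close>
  have pb: "pullback_square (smult F) (smult F) (obj F (x, y)) (obj F (x, ?i)) (obj F (?i, y)) (obj F (?i, ?i))
      (arr F (x, y) (x, ?i)) (arr F (x, y) (?i, y)) (arr F (x, ?i) (?i, ?i)) (arr F (?i, y) (?i, ?i))" for x y
    using deg[unfolded degree_1_def, rule_format, of "(x, ?i)" "(?i, y)"]
    by (simp add: inf_prod_def sup_prod_def)
  obtain \<Omega> where \<Omega>: "\<And>w. w \<in> \<Omega> \<Longrightarrow> bar w" "free \<Omega>" "\<And>z. spanned \<Omega> z = obj F z"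
    "\<And>w. w \<in> \<Omega> \<Longrightarrow> (\<exists>J K. up_closed J \<and> up_closed K \<and> {z. w z \<noteq> 0} = J \<times> K) \<or>
      (\<exists>J. poset_interval J \<and> {z. w z \<noteq> 0} = J \<times> UNIV) \<or>
      (\<exists>K. poset_interval K \<and> {z. w z \<noteq> 0} = UNIV \<times> K)"
  proof (rule bars_to_corner[of ?i ?i])
    fix x y :: ennreal and d
    assume d: "d \<in> obj F (x, y)" "f (x, y) (x, ?i) d = 0" "f (x, y) (?i, y) d = 0"
    then have "arr F (x, y) (x, ?i) d = 0" "arr F (x, y) (?i, y) d = 0" using arr by simp_all
    then show "d = 0"
      by (rule pullback_square_inj[OF vector_space_axioms subspace_V subspace_V subspace_V subspace_V pb d(1)])
  next
    fix x y :: ennreal and a b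
    assume ab: "a \<in> obj F (x, ?i)" "b \<in> obj F (?i, y)" "f (x, ?i) (?i, ?i) a = f (?i, y) (?i, ?i) b"
    then have "arr F (x, ?i) (?i, ?i) a = arr F (?i, y) (?i, ?i) b" using arr by simp
    then obtain d where "d \<in> obj F (x, y)" "arr F (x, y) (x, ?i) d = a" "arr F (x, y) (?i, y) d = b"
      by (rule pullback_square_ex[OF vector_space_axioms subspace_V subspace_V subspace_V subspace_V pb ab(1,2)])
    then show "\<exists>d\<in>obj F (x, y). f (x, y) (x, ?i) d = a \<and> f (x, y) (?i, y) d = b"
      using arr by auto
  qed auto
  show ?thesis
  proof (rule decomposes_into_intervals_if_bars[OF refl refl arr \<Omega>(1-3)])
    fix w assume w: "w \<in> \<Omega>"
    have pU: "poset_interval (UNIV :: ennreal set)" by (rule poset_interval_chain) simp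
    have pu: "poset_interval J" if "up_closed J" for J :: "ennreal set"
      using that unfolding up_closed_def by (intro poset_interval_chain) blast
    show "birth_block {z. w z \<noteq> 0} \<or> vertical_block {z. w z \<noteq> 0} \<or> horizontal_block {z. w z \<noteq> 0}"
      using \<Omega>(4)[OF w] poset_interval_Times pU pu
      unfolding birth_block_def vertical_block_def horizontal_block_def by metis
  qed
qed

theorem proposition4p2:
  fixes F :: "('k::field, ennreal \<times> ennreal, 'v::ab_group_add) vec_diagram"
  assumes "vec_functor F" and "pointwise_fin_dim F"
  shows "(codegree_1 F \<longrightarrow>
      decomposes_into_intervals F (\<lambda>I. death_block I \<or> vertical_block I \<or> horizontal_block I)) \<and>
    (degree_1 F \<longrightarrow>
      decomposes_into_intervals F (\<lambda>I. birth_block I \<or> vertical_block I \<or> horizontal_block I))"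
  using decomposes_if_codegree_1[OF assms] decomposes_if_degree_1[OF assms] by blast

end
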